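(* Let $m\in\mathbb N$ and let $\mathcal L=\sum_{|\gamma|=m}a_\gamma\partial^\gamma$ (with $a_\gamma\in\mathbb C$) be an elliptic operator of anisotropic order $m$ on $\mathbb R^d$. Suppose $0<\alpha<\eta<m$ with $\alpha,\eta\notin\mathbb N$. There exists a constant $C$ such that for all germs $U$ over $\mathbb R^d$ with $\|U\|_{G^\eta(\mathbb R^d)}<\infty$ it holds $$\|U\|_{G^\eta(\mathbb R^d)}\le C\big([\mathcal LU]_{G^{\eta-m}(\mathbb R^d)}+[U]_{G^{\eta,\alpha}(\mathbb R^d)}\big).$$
   Context: Fix a scaling $\mathfrak s\in\mathbb N^d$; for $\beta\in\mathbb N_0^d$, $|\beta|:=\sum_i\mathfrak s_i\beta_i$. The anisotropic distance is $d(x,y):=\sum_{i}|x_i-y_i|^{1/\mathfrak s_i}$, $B_R(x)$ the open ball for $d$, and $\mathcal P_k$ the polynomials $\sum_{|\beta|\le k}c_\beta z^\beta$. $\mathcal L$ is elliptic if for every open $D\subseteq\mathbb R^d$ and $u\in\mathcal D'(D)$, $\mathcal Lu\in C^\infty(D)$ implies $u\in C^\infty(D)$. A germ over $D$ is a family $U=(U_x)_{x\in D}$ of continuous $U_x:D\to\mathbb C$. $\|U\|_{G^\eta(D)}$ is the infimum of all $M>0$ with $|U_x(y)|\le M\,d(x,y)^\eta$ for all $x,y\in D$; $[U]_{G^{\eta,\alpha}(D)}$ is the infimum of all $M>0$ such that for all $x,y\in D$ there is $P\in\mathcal P_{\lfloor\eta\rfloor}$ with $|(U_x-U_y-P)(z)|\le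 M\,d(y,z)^\alpha(d(x,y)+d(y,z))^{\eta-\alpha}$ for all $z\in D$. For $\gamma<0$, with $k:=\lceil|\gamma|\rceil$, $\mathcal B$ is the set of $\varphi\in C_c^\infty(\mathbb R^d)$ supported in $B_1(0)$ with $\sup_{|\beta|\le k}\sup|\partial^\beta\varphi|\le 1$, and $\varphi_x^\lambda(y):=\lambda^{-\sum_i\mathfrak s_i}\varphi(\lambda^{-\mathfrak s_1}(y_1-x_1),\dots,\lambda^{-\mathfrak s_d}(y_d-x_d))$. For open $D$ and $V=(V_x)_{x\in D}$, $V_x\in\mathcal D'(D)$, $[V]_{G^\gamma(D)}:=\sup_{\varphi\in\mathcal B}\sup_{x\in D}\sup_{\lambda>0,\,B_\lambda(x)\subseteq D}\lambda^{-\gamma}|\langle V_x,\varphi_x^\lambda\rangle|$. $\mathcal LU:=(\mathcal LU_x)_x$, $\mathcal L$ acting distributionally in the active variable. *)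

theory Defs
  imports "HOL-Analysis.Analysis"
begin

text \<open>A scaling is s :: 'n \<Rightarrow> nat with all s i \<ge> 1. Multi-indices are 'n \<Rightarrow> nat.\<close>

definition aniso_deg :: "('n::finite \<Rightarrow> nat) \<Rightarrow> ('n \<Rightarrow> nat) \<Rightarrow> nat" where
  "aniso_deg s \<beta> = (\<Sum>i\<in>UNIV. s i * \<beta> i)"

definition aniso_dist :: "('n::finite \<Rightarrow> nat) \<Rightarrow> real^'n \<Rightarrow> real^'n \<Rightarrow> real" where
  "aniso_dist s x y = (\<Sum>i\<in>UNIV. \<bar>x$i - y$i\<bar> powr (1 / real (s i)))"

definition aniso_ball :: "('n::finite \<Rightarrow> nat) \<Rightarrow> real^'n \<Rightarrow> real \<Rightarrow> (real^'n) set" where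
  "aniso_ball s x R = {y. aniso_dist s x y < R}"

definition aniso_polys :: "('n::finite \<Rightarrow> nat) \<Rightarrow> nat \<Rightarrow> (real^'n \<Rightarrow> complex) set" where
  "aniso_polys s k = {P. \<exists>c :: ('n \<Rightarrow> nat) \<Rightarrow> complex.
      P = (\<lambda>z. \<Sum>\<beta>\<in>{\<beta>. aniso_deg s \<beta> \<le> k}. c \<beta> * (\<Prod>i\<in>UNIV. complex_of_real (z$i) ^ \<beta> i))}"

definition partial :: "'n::finite \<Rightarrow> (real^'n \<Rightarrow> complex) \<Rightarrow> real^'n \<Rightarrow> complex" where
  "partial i f x = vector_derivative (\<lambda>t. f (x + t *\<^sub>R axis i 1)) (at 0)"

fun pderivs :: "'n::finite list \<Rightarrow> (real^'n \<Rightarrow> complex) \<Rightarrow> real^'n \<Rightarrow> complex" where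
  "pderivs [] f = f"
| "pderivs (i # is) f = partial i (pderivs is f)"

text \<open>\<partial>^\<beta>: differentiate \<beta> i times in direction i (order is immaterial for smooth f).\<close>
definition pdiff :: "('n::finite \<Rightarrow> nat) \<Rightarrow> (real^'n \<Rightarrow> complex) \<Rightarrow> real^'n \<Rightarrow> complex" where
  "pdiff \<beta> f = pderivs (SOME l. \<forall>i. count_list l i = \<beta> i) f"

definition smooth_on :: "(real^'n::finite) set \<Rightarrow> (real^'n \<Rightarrow> complex) \<Rightarrow> bool" where
  "smooth_on D f \<longleftrightarrow> (\<forall>is. continuous_on D (pderivs is f) \<and>
      (\<forall>i. \<forall>x\<in>D. (\<lambda>t. pderivs is f (x + t *\<^sub>R axis i 1)) differentiable (at 0)))"

definition test_fun :: "(real^'n::finite) set \<Rightarrow> (real^'n \<Rightarrow> complex) \<Rightarrow> bool" where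
  "test_fun D \<phi> \<longleftrightarrow> smooth_on UNIV \<phi> \<and> compact (closure {x. \<phi> x \<noteq> 0})
      \<and> closure {x. \<phi> x \<noteq> 0} \<subseteq> D"

definition is_distribution :: "(real^'n::finite) set \<Rightarrow> ((real^'n \<Rightarrow> complex) \<Rightarrow> complex) \<Rightarrow> bool" where
  "is_distribution D T \<longleftrightarrow>
     (\<forall>\<phi> \<psi>. test_fun D \<phi> \<longrightarrow> test_fun D \<psi> \<longrightarrow> T (\<lambda>x. \<phi> x + \<psi> x) = T \<phi> + T \<psi>) \<and>
     (\<forall>c \<phi>. test_fun D \<phi> \<longrightarrow> T (\<lambda>x. c * \<phi> x) = c * T \<phi>) \<and>
     (\<forall>K. compact K \<and> K \<subseteq> D \<longrightarrow> (\<exists>C N. \<forall>\<phi>. test_fun D \<phi> \<and> closure {x. \<phi> x \<noteq> 0} \<subseteq> K \<longrightarrow>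
         norm (T \<phi>) \<le> C * (\<Sum>\<beta>\<in>{\<beta>::'n\<Rightarrow>nat. sum \<beta> UNIV \<le> N}. Sup (range (\<lambda>x. norm (pdiff \<beta> \<phi> x))))))"

definition distr_smooth :: "(real^'n::finite) set \<Rightarrow> ((real^'n \<Rightarrow> complex) \<Rightarrow> complex) \<Rightarrow> bool" where
  "distr_smooth D T \<longleftrightarrow> (\<exists>g. smooth_on D g \<and>
      (\<forall>\<phi>. test_fun D \<phi> \<longrightarrow> T \<phi> = integral D (\<lambda>y. g y * \<phi> y)))"

definition opL :: "('n::finite \<Rightarrow> nat) \<Rightarrow> nat \<Rightarrow> (('n \<Rightarrow> nat) \<Rightarrow> complex)
    \<Rightarrow> (real^'n \<Rightarrow> complex) \<Rightarrow> real^'n \<Rightarrow> complex" where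
  "opL s m a f = (\<lambda>x. \<Sum>\<gamma>\<in>{\<gamma>. aniso_deg s \<gamma> = m}. a \<gamma> * pdiff \<gamma> f x)"

definition opL_t :: "('n::finite \<Rightarrow> nat) \<Rightarrow> nat \<Rightarrow> (('n \<Rightarrow> nat) \<Rightarrow> complex)
    \<Rightarrow> (real^'n \<Rightarrow> complex) \<Rightarrow> real^'n \<Rightarrow> complex" where
  "opL_t s m a f = (\<lambda>x. \<Sum>\<gamma>\<in>{\<gamma>. aniso_deg s \<gamma> = m}. a \<gamma> * (-1) ^ (sum \<gamma> UNIV) * pdiff \<gamma> f x)"

definition opL_distr :: "('n::finite \<Rightarrow> nat) \<Rightarrow> nat \<Rightarrow> (('n \<Rightarrow> nat) \<Rightarrow> complex)
    \<Rightarrow> ((real^'n \<Rightarrow> complex) \<Rightarrow> complex) \<Rightarrow> (real^'n \<Rightarrow> complex) \<Rightarrow> complex" where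
  "opL_distr s m a T = (\<lambda>\<phi>. T (opL_t s m a \<phi>))"

definition elliptic :: "('n::finite \<Rightarrow> nat) \<Rightarrow> nat \<Rightarrow> (('n \<Rightarrow> nat) \<Rightarrow> complex) \<Rightarrow> bool" where
  "elliptic s m a \<longleftrightarrow> (\<forall>D u. open D \<longrightarrow> is_distribution D u \<longrightarrow>
      distr_smooth D (opL_distr s m a u) \<longrightarrow> distr_smooth D u)"

definition fun_distr :: "(real^'n::finite \<Rightarrow> complex) \<Rightarrow> (real^'n \<Rightarrow> complex) \<Rightarrow> complex" where
  "fun_distr f = (\<lambda>\<phi>. integral UNIV (\<lambda>y. f y * \<phi> y))"

definition germ_norm :: "('n::finite \<Rightarrow> nat) \<Rightarrow> real \<Rightarrow> (real^'n \<Rightarrow> real^'n \<Rightarrow> complex) \<Rightarrow> ereal" where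
  "germ_norm s \<eta> U = Inf {ereal M | M. M > 0 \<and>
      (\<forall>x y. norm (U x y) \<le> M * aniso_dist s x y powr \<eta>)}"

definition germ_seminorm :: "('n::finite \<Rightarrow> nat) \<Rightarrow> real \<Rightarrow> real \<Rightarrow> (real^'n \<Rightarrow> real^'n \<Rightarrow> complex) \<Rightarrow> ereal" where
  "germ_seminorm s \<eta> \<alpha> U = Inf {ereal M | M. M > 0 \<and>
      (\<forall>x y. \<exists>P\<in>aniso_polys s (nat \<lfloor>\<eta>\<rfloor>). \<forall>z.
         norm (U x z - U y z - P z) \<le>
           M * aniso_dist s y z powr \<alpha> * (aniso_dist s x y + aniso_dist s y z) powr (\<eta> - \<alpha>))}"

text \<open>Test function class \<B> for gamma < 0, and rescaling phi_x^lambda.\<close>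
definition testB :: "('n::finite \<Rightarrow> nat) \<Rightarrow> real \<Rightarrow> (real^'n \<Rightarrow> complex) set" where
  "testB s \<gamma> = {\<phi>. smooth_on UNIV \<phi> \<and> compact (closure {x. \<phi> x \<noteq> 0}) \<and>
      closure {x. \<phi> x \<noteq> 0} \<subseteq> aniso_ball s 0 1 \<and>
      (\<forall>\<beta>. aniso_deg s \<beta> \<le> nat \<lceil>\<bar>\<gamma>\<bar>\<rceil> \<longrightarrow> (\<forall>y. norm (pdiff \<beta> \<phi> y) \<le> 1))}"

definition rescale :: "('n::finite \<Rightarrow> nat) \<Rightarrow> (real^'n \<Rightarrow> complex) \<Rightarrow> real^'n \<Rightarrow> real
    \<Rightarrow> real^'n \<Rightarrow> complex" where
  "rescale s \<phi> x lam = (\<lambda>y. complex_of_real (lam powr (- real (\<Sum>i\<in>UNIV. s i))) *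
      \<phi> (\<chi> i. lam powr (- real (s i)) * (y$i - x$i)))"

definition distr_germ_seminorm :: "('n::finite \<Rightarrow> nat) \<Rightarrow> real \<Rightarrow> (real^'n) set
    \<Rightarrow> (real^'n \<Rightarrow> (real^'n \<Rightarrow> complex) \<Rightarrow> complex) \<Rightarrow> ereal" where
  "distr_germ_seminorm s \<gamma> D V = Sup {ereal (lam powr (- \<gamma>) * norm (V x (rescale s \<phi> x lam))) |
      \<phi> x lam. \<phi> \<in> testB s \<gamma> \<and> x \<in> D \<and> lam > 0 \<and> aniso_ball s x lam \<subseteq> D}"

definition opL_germ :: "('n::finite \<Rightarrow> nat) \<Rightarrow> nat \<Rightarrow> (('n \<Rightarrow> nat) \<Rightarrow> complex)
    \<Rightarrow> (real^'n \<Rightarrow> real^'n \<Rightarrow> complex) \<Rightarrow> real^'n \<Rightarrow> (real^'n \<Rightarrow> complex) \<Rightarrow> complex" where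
  "opL_germ s m a U = (\<lambda>x. opL_distr s m a (fun_distr (U x)))"

end

theory Submission
  imports Defs
begin

text \<open>Ellipticity forces the symbol \<open>P\<close> of the operator to be nonzero away from the origin:
  a zero \<open>\<xi>\<close> of \<open>P\<close> would, by homogeneity, produce a whole orbit of zeros and hence a lacunary
  series of plane waves that is a continuous solution without a derivative at
  the origin. Therefore \<open>M = \<bar>P\<bar>\<^sup>2\<close> is
  coercive, and the heat kernels \<open>K\<^sub>t\<close> with Fourier multiplier \<open>exp (- t M)\<close> are Schwartz
  functions. Differences of two such kernels, or of their derivatives, lie in the range of the
  transposed operator on Schwartz functions, so on \<open>U x\<close> they are controlled by the seminorm
  of the image germ. As the growth exponent \<open>\<eta>\<close> is not an integer, letting \<open>t\<close> tend to
  infinity (derivatives of degree above \<open>\<eta>\<close>) or to zero (degree below \<open>\<eta>\<close>, tested at the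
  base point) controls single kernels, up to a small multiple of the germ norm.
  Finally \<open>K\<^sub>t\<close> reproduces polynomials of degree below \<open>m\<close>, and near \<open>y\<close> the function \<open>U x\<close>
  is such a polynomial up to \<open>U y\<close> and a seminorm error, so \<open>U x y\<close> is recovered from the
  action of \<open>K\<^sub>t\<close> for a small \<open>t\<close> and the remaining multiple of the norm is absorbed.\<close>

section \<open>Iterated partial derivatives\<close>

text \<open>The germ norm is finite but carries no bound of its own, so every estimate tolerates an
  error \<delta> N. The square of \<open>\<bar>P\<bar>\<close> is taken because \<open>P\<close> is
  complex valued and exp (- t P) need not decay.

  The obstruction to bounding a function u by its image under the operator are the solutions of L u
  = 0, polynomial ones in particular. A bound N |z|^\<eta> excludes these only when used both near 0
  and near infinity. In quantitative form: a heat kernel derivative of degree k at spatial scale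
  \<tau>, tested against such a bound, has size \<tau>^(\<eta> - k). Large \<tau> helps for k >
  \<eta>, and there a translation of the kernel by y becomes negligible. Small \<tau> helps for k <
  \<eta>, but only for kernels centred at the base point. To reach other centres, the pairing is
  integrated along coordinate directions, which uses derivatives of higher degree; hence a
  descending induction on k.

  The pairing with a heat kernel at y differs from a multiple of u(y) through a second germ member,
  which is small near y, and through the seminorm error; a polynomial is reproduced exactly. All of
  this is done for d(x,y) = 1 and transported by dilation.\<close>

abbreviation smooth :: "(real^'n::finite \<Rightarrow> complex) \<Rightarrow> bool" where
  "smooth \<equiv> smooth_on UNIV"

text \<open>A relation beside the total function \<open>partial\<close>: its rules compose without
  differentiability side conditions, and \<open>has_pd_partial\<close> turns each of them into an
  equation for \<open>partial\<close>.\<close>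

definition has_pd :: "'n::finite \<Rightarrow> (real^'n \<Rightarrow> complex) \<Rightarrow> (real^'n \<Rightarrow> complex) \<Rightarrow> bool" where
  "has_pd i f f' \<longleftrightarrow> (\<forall>x. ((\<lambda>t. f (x + t *\<^sub>R axis i 1)) has_vector_derivative f' x) (at 0))"

lemma has_pd_partial: "has_pd i f f' \<Longrightarrow> partial i f = f'"
  by (auto simp: has_pd_def partial_def vector_derivative_at)

lemma has_pd_at:
  assumes "has_pd i f f'"
  shows "((\<lambda>t. f (x + t *\<^sub>R axis i 1)) has_vector_derivative f' (x + t *\<^sub>R axis i 1)) (at t)"
proof -
  have 1: "((\<lambda>h. f ((x + t *\<^sub>R axis i 1) + h *\<^sub>R axis i 1)) has_vector_derivative f' (x + t *\<^sub>R axis i 1)) (at 0)"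
    using assms by (simp add: has_pd_def)
  have 2: "((\<lambda>h. h - t) has_vector_derivative 1) (at t)"
    by (auto intro!: derivative_eq_intros)
  have "((\<lambda>h. f ((x + t *\<^sub>R axis i 1) + h *\<^sub>R axis i 1)) \<circ> (\<lambda>h. h - t) has_vector_derivative 1 *\<^sub>R f' (x + t *\<^sub>R axis i 1)) (at t)"
    by (rule vector_diff_chain_at[OF 2]) (use 1 in simp)
  then show ?thesis
    by (simp add: o_def algebra_simps)
qed

lemma has_pd_add: "has_pd i f f' \<Longrightarrow> has_pd i g g' \<Longrightarrow> has_pd i (\<lambda>x. f x + g x) (\<lambda>x. f' x + g' x)"
  by (auto simp: has_pd_def intro!: derivative_eq_intros)

lemma has_pd_mult:
  assumes "has_pd i f f'" "has_pd i g g'"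
  shows "has_pd i (\<lambda>x. f x * g x) (\<lambda>x. f x * g' x + f' x * g x)"
  unfolding has_pd_def
proof
  fix x
  show "((\<lambda>t. f (x + t *\<^sub>R axis i 1) * g (x + t *\<^sub>R axis i 1)) has_vector_derivative f x * g' x + f' x * g x) (at 0)"
    using has_vector_derivative_mult[OF assms[unfolded has_pd_def, rule_format], of x] by simp
qed

lemma has_pd_const: "has_pd i (\<lambda>x. c) (\<lambda>x. 0)"
  by (auto simp: has_pd_def intro!: derivative_eq_intros)

lemma has_pd_coord: "has_pd i (\<lambda>x. complex_of_real (x $ j)) (\<lambda>x. if i = j then 1 else 0)"
  unfolding has_pd_def
  by (auto simp: axis_def intro!: derivative_eq_intros has_vector_derivative_of_real)

lemma has_pd_cmult: "has_pd i f f' \<Longrightarrow> has_pd i (\<lambda>x. c * f x) (\<lambda>x. c * f' x)"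
  using has_pd_mult[OF has_pd_const[of i c]] by simp

lemma smooth_cont: "smooth f \<Longrightarrow> continuous_on UNIV f"
  by (metis pderivs.simps(1) smooth_on_def)

lemma smooth_has_pd:
  assumes "smooth f" shows "has_pd i f (partial i f)"
proof -
  have "(\<lambda>t. pderivs [] f (x + t *\<^sub>R axis i 1)) differentiable (at 0)" for x
    using assms by (auto simp: smooth_on_def simp del: pderivs.simps)
  then show ?thesis
    by (auto simp: has_pd_def partial_def vector_derivative_works)
qed

lemma pderivs_snoc: "pderivs l (partial i f) = pderivs (l @ [i]) f"
  by (induction l) auto

lemma pderivs_append: "pderivs k (pderivs l f) = pderivs (k @ l) f"
  by (induction k) auto

lemma smooth_pderivs: "smooth f \<Longrightarrow> smooth (pderivs l f)"
  unfolding smooth_on_def pderivs_append by blast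

lemma smooth_partial: "smooth f \<Longrightarrow> smooth (partial i f)"
  using smooth_pderivs[of f "[i]"] by simp

text \<open>\<open>smooth_on\<close> speaks of all iterated derivatives at once. A class of
  continuous functions that contains the first partial derivatives of its members traps all
  iterates, so a closure property reduces to finding a class invariant under one
  differentiation.\<close>

lemma smooth_coinduct:
  assumes f: "f \<in> W"
    and cont: "\<And>f. f \<in> W \<Longrightarrow> continuous_on UNIV f"
    and step: "\<And>f i. f \<in> W \<Longrightarrow> \<exists>f'\<in>W. has_pd i f f'"
  shows "smooth f" and "pderivs l f \<in> W"
proof -
  have *: "pderivs l f \<in> W" for l
  proof (induction l)
    case (Cons j l)
    from step[OF Cons, where i = j] show ?case
      by (auto dest: has_pd_partial)
  qed (simp add: f)
  then show "pderivs l f \<in> W" .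
  show "smooth f"
    unfolding smooth_on_def
  proof (intro allI conjI ballI)
    fix l i x
    show "continuous_on UNIV (pderivs l f)" by (rule cont[OF *])
    from step[OF *[of l], where i = i] show "(\<lambda>t. pderivs l f (x + t *\<^sub>R axis i 1)) differentiable at 0"
      by (auto simp: has_pd_def intro: differentiableI_vector)
  qed
qed

lemma smooth_const: "smooth (\<lambda>x. c)"
proof (rule smooth_coinduct(1)[of _ "{(\<lambda>x. c) |c. True}"])
  fix f :: "real^'a \<Rightarrow> complex" and i assume "f \<in> {(\<lambda>x. c) |c. True}"
  then show "\<exists>f'\<in>{(\<lambda>x. c) |c. True}. has_pd i f f'"
    using has_pd_const[of i] by blast
qed auto

lemma smooth_add:
  assumes "smooth f" "smooth g" shows "smooth (\<lambda>x. f x + g x)"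
proof (rule smooth_coinduct(1)[of _ "{(\<lambda>x. f x + g x) |f g. smooth f \<and> smooth g}"])
  fix h :: "real^'a \<Rightarrow> complex" and i
  assume "h \<in> {(\<lambda>x. f x + g x) |f g. smooth f \<and> smooth g}"
  then obtain f g where h: "h = (\<lambda>x. f x + g x)" "smooth f" "smooth g" by auto
  then show "\<exists>h'\<in>{(\<lambda>x. f x + g x) |f g. smooth f \<and> smooth g}. has_pd i h h'"
    by (intro bexI[of _ "\<lambda>x. partial i f x + partial i g x"])
      (auto intro!: has_pd_add smooth_has_pd smooth_partial)
next
  show "(\<lambda>x. f x + g x) \<in> {(\<lambda>x. f x + g x) |f g. smooth f \<and> smooth g}" using assms by blast
qed (auto dest!: smooth_cont intro!: continuous_intros)

text \<open>Products alone are not stable under differentiation; by the Leibniz rule, finite sums of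
  products of smooth functions are.\<close>

inductive_set prod_span :: "(real^'n::finite \<Rightarrow> complex) set" where
  prod: "smooth f \<Longrightarrow> smooth g \<Longrightarrow> (\<lambda>x. f x * g x) \<in> prod_span"
| add: "f \<in> prod_span \<Longrightarrow> g \<in> prod_span \<Longrightarrow> (\<lambda>x. f x + g x) \<in> prod_span"

lemma smooth_mult:
  assumes "smooth f" "smooth g" shows "smooth (\<lambda>x. f x * g x)"
proof (rule smooth_coinduct(1)[of _ prod_span])
  show "(\<lambda>x. f x * g x) \<in> prod_span" using assms by (rule prod_span.prod)
next
  fix h :: "real^'a \<Rightarrow> complex" assume "h \<in> prod_span"
  then show "continuous_on UNIV h"
    by induction (auto dest!: smooth_cont intro!: continuous_intros)
next
  fix h :: "real^'a \<Rightarrow> complex" and i assume "h \<in> prod_span"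
  then show "\<exists>h'\<in>prod_span. has_pd i h h'"
  proof induction
    case (prod f g)
    have "has_pd i (\<lambda>x. f x * g x) (\<lambda>x. f x * partial i g x + partial i f x * g x)"
      by (rule has_pd_mult[OF smooth_has_pd[OF prod(1)] smooth_has_pd[OF prod(2)]])
    moreover have "(\<lambda>x. f x * partial i g x + partial i f x * g x) \<in> prod_span"
      by (rule prod_span.add[OF prod_span.prod prod_span.prod]) (rule prod smooth_partial[OF prod(1)] smooth_partial[OF prod(2)])+
    ultimately show ?case by (rule bexI)
  next
    case (add f g)
    then obtain f' g' where "f' \<in> prod_span" "has_pd i f f'" "g' \<in> prod_span" "has_pd i g g'"
      by blast
    then show ?case
      by (intro bexI[of _ "\<lambda>x. f' x + g' x"] has_pd_add prod_span.add)
  qed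
qed

lemma smooth_cmult: "smooth f \<Longrightarrow> smooth (\<lambda>x. c * f x)"
  by (intro smooth_mult smooth_const)

lemma smooth_sum: "(\<And>k. k \<in> A \<Longrightarrow> smooth (f k)) \<Longrightarrow> smooth (\<lambda>x. \<Sum>k\<in>A. f k x)"
  by (induction A rule: infinite_finite_induct) (auto intro!: smooth_const smooth_add)

lemma pderivs_add:
  assumes "smooth f" "smooth g"
  shows "pderivs l (\<lambda>x. f x + g x) = (\<lambda>x. pderivs l f x + pderivs l g x)"
proof (induction l)
  case (Cons i l)
  then show ?case
    using has_pd_partial[OF has_pd_add[OF smooth_has_pd smooth_has_pd],
        OF smooth_pderivs[OF assms(1)] smooth_pderivs[OF assms(2)]] by simp
qed simp

lemma pderivs_cmult:
  assumes "smooth f"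
  shows "pderivs l (\<lambda>x. c * f x) = (\<lambda>x. c * pderivs l f x)"
proof (induction l)
  case (Cons i l)
  then show ?case
    using has_pd_partial[OF has_pd_cmult[OF smooth_has_pd], OF smooth_pderivs[OF assms]] by simp
qed simp

section \<open>Diagonal affine substitutions: translations, scalings and anisotropic dilations in
  one form\<close>

definition diag_aff :: "('n::finite \<Rightarrow> real) \<Rightarrow> real^'n \<Rightarrow> real^'n \<Rightarrow> real^'n" where
  "diag_aff r b x = (\<chi> i. r i * x $ i + b $ i)"

lemma continuous_diag_aff [continuous_intros]: "continuous_on S (diag_aff r b)"
  unfolding diag_aff_def by (intro continuous_intros)

lemma diag_aff_axis: "diag_aff r b (x + t *\<^sub>R axis i 1) = diag_aff r b x + (t * r i) *\<^sub>R axis i 1"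
  by (auto simp: diag_aff_def vec_eq_iff axis_def algebra_simps)

lemma has_pd_diag_aff:
  assumes "has_pd i f f'"
  shows "has_pd i (\<lambda>x. f (diag_aff r b x)) (\<lambda>x. of_real (r i) * f' (diag_aff r b x))"
  unfolding has_pd_def diag_aff_axis
proof
  fix x
  have 1: "((\<lambda>t. f (diag_aff r b x + t *\<^sub>R axis i 1)) has_vector_derivative f' (diag_aff r b x)) (at (0 * r i))"
    using assms by (simp add: has_pd_def)
  have 2: "((\<lambda>t. t * r i) has_vector_derivative r i) (at 0)"
    by (auto intro!: derivative_eq_intros)
  from vector_diff_chain_at[OF 2 1]
  show "((\<lambda>t. f (diag_aff r b x + (t * r i) *\<^sub>R axis i 1)) has_vector_derivative complex_of_real (r i) * f' (diag_aff r b x)) (at 0)"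
    by (simp add: o_def scaleR_conv_of_real)
qed

lemma continuous_on_diag_comp:
  "continuous_on UNIV f \<Longrightarrow> continuous_on UNIV (\<lambda>x. f (diag_aff r b x))"
  by (rule continuous_on_compose2[of UNIV f]) (auto intro!: continuous_intros)

lemma smooth_diag_aff:
  assumes "smooth f" shows "smooth (\<lambda>x. f (diag_aff r b x))"
\<comment> \<open>The scalar c absorbs the factor r i that each differentiation in direction i
  produces.\<close>
proof (rule smooth_coinduct(1)[of _ "{(\<lambda>x. c * f (diag_aff r b x)) |c f. smooth f}"])
  have "(\<lambda>x. f (diag_aff r b x)) = (\<lambda>x. 1 * f (diag_aff r b x))" by simp
  with assms show "(\<lambda>x. f (diag_aff r b x)) \<in> {(\<lambda>x. c * f (diag_aff r b x)) |c f. smooth f}"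
    by blast
next
  fix h i assume "h \<in> {(\<lambda>x. c * f (diag_aff r b x)) |c f. smooth f}"
  then obtain c f where h: "h = (\<lambda>x. c * f (diag_aff r b x))" "smooth f" by auto
  then have "has_pd i h (\<lambda>x. (c * of_real (r i)) * partial i f (diag_aff r b x))"
    using has_pd_cmult[OF has_pd_diag_aff[OF smooth_has_pd]] by (simp add: mult.assoc)
  then show "\<exists>h'\<in>{(\<lambda>x. c * f (diag_aff r b x)) |c f. smooth f}. has_pd i h h'"
    using smooth_partial[OF h(2)] by blast
next
  fix h assume "h \<in> {(\<lambda>x. c * f (diag_aff r b x)) |c f. smooth f}"
  then show "continuous_on UNIV h"
    using continuous_on_mult[OF continuous_on_const continuous_on_diag_comp[OF smooth_cont]] by blast
qed

lemma pderivs_diag_aff: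
  assumes "smooth f"
  shows "pderivs l (\<lambda>x. f (diag_aff r b x)) = (\<lambda>x. of_real (\<Prod>i\<leftarrow>l. r i) * pderivs l f (diag_aff r b x))"
proof (induction l)
  case (Cons i l)
  have "has_pd i (\<lambda>x. of_real (\<Prod>i\<leftarrow>l. r i) * pderivs l f (diag_aff r b x))
     (\<lambda>x. of_real (\<Prod>i\<leftarrow>l. r i) * (of_real (r i) * partial i (pderivs l f) (diag_aff r b x)))"
    by (rule has_pd_cmult[OF has_pd_diag_aff[OF smooth_has_pd[OF smooth_pderivs[OF assms]]]])
  from has_pd_partial[OF this] Cons show ?case by (simp add: algebra_simps)
qed simp

lemma diag_aff_shift: "diag_aff (\<lambda>_. 1) b x = x + b"
  by (simp add: diag_aff_def vec_eq_iff)

lemma diag_aff_scale: "diag_aff (\<lambda>_. c) 0 x = c *\<^sub>R x"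
  by (simp add: diag_aff_def vec_eq_iff)

lemma smooth_shift: "smooth f \<Longrightarrow> smooth (\<lambda>x. f (x - b))"
  using smooth_diag_aff[of f "\<lambda>_. 1" "- b"] by (simp add: diag_aff_shift)

lemma pderivs_shift: "smooth f \<Longrightarrow> pderivs l (\<lambda>x. f (x - b)) = (\<lambda>x. pderivs l f (x - b))"
  using pderivs_diag_aff[of f l "\<lambda>_. 1" "- b"] by (simp add: diag_aff_shift map_replicate_const prod_list_replicate)

text \<open>Crude Leibniz rule: each differentiation at most doubles the number of terms, whence 2 ^
  n. The bounds F and G concern a single point x, so that bounds decaying in x can be
  inserted.\<close>

lemma pderivs_mult_bound:
  assumes "smooth f" "smooth g"
    and "\<And>l. length l \<le> n \<Longrightarrow> norm (pderivs l f x) \<le> F"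
    and "\<And>l. length l \<le> n \<Longrightarrow> norm (pderivs l g x) \<le> G"
    and "length l \<le> n"
  shows "norm (pderivs l (\<lambda>x. f x * g x) x) \<le> 2 ^ n * F * G"
  using assms
proof (induction n arbitrary: f g l)
  case 0
  from 0(3)[of "[]"] 0(4)[of "[]"] 0(5) show ?case
    by (auto simp: norm_mult intro: mult_mono order_trans[OF norm_ge_zero])
next
  case (Suc n)
  have F: "0 \<le> F" using Suc(4)[of "[]"] order_trans[OF norm_ge_zero] by auto
  have G: "0 \<le> G" using Suc(5)[of "[]"] order_trans[OF norm_ge_zero] by auto
  show ?case
  proof (cases "length l \<le> n")
    case True
    then have "norm (pderivs l (\<lambda>x. f x * g x) x) \<le> 2 ^ n * F * G"
      using Suc by auto
    also have "\<dots> \<le> 2 ^ Suc n * F * G" using F G by (simp add: mult_right_mono)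
    finally show ?thesis .
  next
    case False
    \<comment> \<open>The innermost derivative is split off, since it acts on the product itself;
      both resulting products satisfy the induction hypothesis with the same F and G.\<close>
    then obtain k i where l: "l = k @ [i]" and k: "length k \<le> n"
      using Suc(6) by (cases l rule: rev_cases) auto
    have "partial i (\<lambda>x. f x * g x) = (\<lambda>x. f x * partial i g x + partial i f x * g x)"
      by (rule has_pd_partial[OF has_pd_mult[OF smooth_has_pd[OF Suc.prems(1)] smooth_has_pd[OF Suc.prems(2)]]])
    then have "pderivs l (\<lambda>x. f x * g x) x = pderivs k (\<lambda>x. f x * partial i g x) x + pderivs k (\<lambda>x. partial i f x * g x) x"
      unfolding l pderivs_snoc[symmetric]
      by (simp add: pderivs_add smooth_mult smooth_partial Suc.prems)
    moreover have "norm (pderivs k (\<lambda>x. f x * partial i g x) x) \<le> 2 ^ n * F * G"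
      by (rule Suc.IH) (use Suc.prems k in \<open>auto simp: smooth_partial pderivs_snoc\<close>)
    moreover have "norm (pderivs k (\<lambda>x. partial i f x * g x) x) \<le> 2 ^ n * F * G"
      by (rule Suc.IH) (use Suc.prems k in \<open>auto simp: smooth_partial pderivs_snoc\<close>)
    ultimately show ?thesis
      using norm_triangle_ineq[of "pderivs k (\<lambda>x. f x * partial i g x) x" "pderivs k (\<lambda>x. partial i f x * g x) x"]
      by simp
  qed
qed

section \<open>Rapid decay and integration\<close>

definition rdecay :: "('a::real_normed_vector \<Rightarrow> 'b::real_normed_vector) \<Rightarrow> bool" where
  "rdecay f \<longleftrightarrow> (\<forall>p::nat. \<exists>C. \<forall>x. norm (f x) * (1 + norm x) ^ p \<le> C)"

definition pgrow :: "('a::real_normed_vector \<Rightarrow> 'b::real_normed_vector) \<Rightarrow> bool" where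
  "pgrow f \<longleftrightarrow> (\<exists>C (p::nat). \<forall>x. norm (f x) \<le> C * (1 + norm x) ^ p)"

lemma rdecayE:
  assumes "rdecay f"
  obtains C where "C \<ge> 0" "\<And>x. norm (f x) * (1 + norm x) ^ p \<le> C"
proof -
  obtain C where C: "\<And>x. norm (f x) * (1 + norm x) ^ p \<le> C"
    using assms by (auto simp: rdecay_def)
  have "0 \<le> norm (f 0) * (1 + norm (0::'a)) ^ p" by simp
  also note C[of 0]
  finally show ?thesis using C that by blast
qed

lemma pgrowE:
  assumes "pgrow f"
  obtains C p where "C \<ge> 0" "\<And>x. norm (f x) \<le> C * (1 + norm x) ^ p"
proof -
  obtain C p where C: "\<And>x. norm (f x) \<le> C * (1 + norm x) ^ p"
    using assms by (auto simp: pgrow_def)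
  have "0 \<le> norm (f 0)" by simp
  also note C[of 0]
  finally have "0 \<le> C" by simp
  from this C show ?thesis by (rule that)
qed

lemma rdecay_bound:
  assumes "rdecay f" "\<And>x. norm (g x) \<le> norm (f x)" shows "rdecay g"
  unfolding rdecay_def
proof
  fix p
  obtain C where "\<And>x. norm (f x) * (1 + norm x) ^ p \<le> C" using rdecayE[OF assms(1)] by metis
  then have "norm (g x) * (1 + norm x) ^ p \<le> C" for x
    using mult_right_mono[OF assms(2)[of x], of "(1 + norm x) ^ p"] by (meson add_nonneg_nonneg norm_ge_zero order_trans zero_le_one zero_le_power)
  then show "\<exists>C. \<forall>x. norm (g x) * (1 + norm x) ^ p \<le> C" by blast
qed

lemma rdecay_add:
  assumes "rdecay f" "rdecay g" shows "rdecay (\<lambda>x. f x + g x)"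
  unfolding rdecay_def
proof
  fix p
  obtain C where C: "\<And>x. norm (f x) * (1 + norm x) ^ p \<le> C" using rdecayE[OF assms(1)] by metis
  obtain D where D: "\<And>x. norm (g x) * (1 + norm x) ^ p \<le> D" using rdecayE[OF assms(2)] by metis
  have "norm (f x + g x) * (1 + norm x) ^ p \<le> C + D" for x
  proof -
    have "norm (f x + g x) * (1 + norm x) ^ p \<le> (norm (f x) + norm (g x)) * (1 + norm x) ^ p"
      by (intro mult_right_mono norm_triangle_ineq) simp
    also have "\<dots> \<le> C + D" using C[of x] D[of x] by (simp add: algebra_simps)
    finally show ?thesis .
  qed
  then show "\<exists>C. \<forall>x. norm (f x + g x) * (1 + norm x) ^ p \<le> C" by blast
qed

lemma rdecay_mult:
  fixes f g :: "'a::real_normed_vector \<Rightarrow> 'b::real_normed_div_algebra"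
  assumes "pgrow f" "rdecay g" shows "rdecay (\<lambda>x. f x * g x)"
  unfolding rdecay_def
proof
  fix p
  obtain C q where C: "C \<ge> 0" "\<And>x. norm (f x) \<le> C * (1 + norm x) ^ q" using pgrowE[OF assms(1)] by metis
  obtain D where D: "\<And>x. norm (g x) * (1 + norm x) ^ (q + p) \<le> D" using rdecayE[OF assms(2)] by metis
  have "norm (f x * g x) * (1 + norm x) ^ p \<le> C * D" for x
  proof -
    have "norm (f x * g x) * (1 + norm x) ^ p \<le> (C * (1 + norm x) ^ q * norm (g x)) * (1 + norm x) ^ p"
      unfolding norm_mult by (intro mult_right_mono C) auto
    also have "\<dots> = C * (norm (g x) * (1 + norm x) ^ (q + p))" by (simp add: power_add)
    also have "\<dots> \<le> C * D" by (intro mult_left_mono D C)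
    finally show ?thesis .
  qed
  then show "\<exists>C. \<forall>x. norm (f x * g x) * (1 + norm x) ^ p \<le> C" by blast
qed

lemma pgrow_const: "pgrow (\<lambda>x. c)"
  unfolding pgrow_def by (intro exI[of _ "norm c"] exI[of _ 0]) simp

lemma rdecay_cmult:
  fixes f :: "'a::real_normed_vector \<Rightarrow> 'b::real_normed_div_algebra"
  shows "rdecay f \<Longrightarrow> rdecay (\<lambda>x. c * f x)"
  by (intro rdecay_mult pgrow_const)

lemma rdecay_zero: "rdecay (\<lambda>x. 0)"
  by (auto simp: rdecay_def)

lemma pgrow_add:
  assumes "pgrow f" "pgrow g" shows "pgrow (\<lambda>x. f x + g x)"
proof -
  obtain C p where C: "C \<ge> 0" "\<And>x. norm (f x) \<le> C * (1 + norm x) ^ p" using pgrowE[OF assms(1)] by metis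
  obtain D q where D: "D \<ge> 0" "\<And>x. norm (g x) \<le> D * (1 + norm x) ^ q" using pgrowE[OF assms(2)] by metis
  have "norm (f x + g x) \<le> (C + D) * (1 + norm x) ^ (p + q)" for x
  proof -
    have "C * (1 + norm x) ^ p \<le> C * (1 + norm x) ^ (p + q)"
      by (intro mult_left_mono power_increasing C) auto
    moreover have "D * (1 + norm x) ^ q \<le> D * (1 + norm x) ^ (p + q)"
      by (intro mult_left_mono power_increasing D) auto
    ultimately show ?thesis
      using norm_triangle_ineq[of "f x" "g x"] C(2)[of x] D(2)[of x] by (simp add: algebra_simps)
  qed
  then show ?thesis unfolding pgrow_def by blast
qed

lemma pgrow_mult:
  fixes f g :: "'a::real_normed_vector \<Rightarrow> 'b::real_normed_div_algebra"
  assumes "pgrow f" "pgrow g" shows "pgrow (\<lambda>x. f x * g x)"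
proof -
  obtain C p where C: "C \<ge> 0" "\<And>x. norm (f x) \<le> C * (1 + norm x) ^ p" using pgrowE[OF assms(1)] by metis
  obtain D q where D: "D \<ge> 0" "\<And>x. norm (g x) \<le> D * (1 + norm x) ^ q" using pgrowE[OF assms(2)] by metis
  have "norm (f x * g x) \<le> (C * D) * (1 + norm x) ^ (p + q)" for x
  proof -
    have "norm (f x * g x) \<le> (C * (1 + norm x) ^ p) * (D * (1 + norm x) ^ q)"
      unfolding norm_mult by (intro mult_mono C D) (auto simp: C)
    then show ?thesis by (simp add: power_add algebra_simps)
  qed
  then show ?thesis unfolding pgrow_def by blast
qed

lemma pgrow_coord: "pgrow (\<lambda>x::real^'n::finite. complex_of_real (x $ i))"
  unfolding pgrow_def
proof (intro exI allI)
  fix x :: "real^'n"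
  show "norm (complex_of_real (x $ i)) \<le> 1 * (1 + norm x) ^ 1"
    using component_le_norm_cart[of x i] by simp
qed

lemma pgrow_bound: "pgrow f \<Longrightarrow> (\<And>x. norm (g x) \<le> norm (f x)) \<Longrightarrow> pgrow g"
  unfolding pgrow_def by (meson order_trans)

section \<open>Substitution and integrability for Lebesgue measure\<close>

lemma sum_Basis_cart:
  fixes g :: "real^'n::finite \<Rightarrow> 'b::comm_monoid_add"
  shows "(\<Sum>j\<in>Basis. g j) = (\<Sum>i\<in>UNIV. g (axis i 1))"
proof -
  have B: "(Basis :: (real^'n) set) = (\<lambda>i. axis i 1) ` UNIV"
    by (auto simp: Basis_vec_def)
  have "inj (\<lambda>i::'n. axis i (1::real))"
    by (auto simp: inj_def axis_eq_axis)
  then show ?thesis unfolding B by (simp add: sum.reindex)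
qed

lemma prod_Basis_cart:
  fixes g :: "real^'n::finite \<Rightarrow> 'b::comm_monoid_mult"
  shows "(\<Prod>j\<in>Basis. g j) = (\<Prod>i\<in>UNIV. g (axis i 1))"
proof -
  have B: "(Basis :: (real^'n) set) = (\<lambda>i. axis i 1) ` UNIV"
    by (auto simp: Basis_vec_def)
  have "inj (\<lambda>i::'n. axis i (1::real))"
    by (auto simp: inj_def axis_eq_axis)
  then show ?thesis unfolding B by (simp add: prod.reindex)
qed

lemma lborel_diag_aff:
  fixes r :: "'n::finite \<Rightarrow> real" and b :: "real^'n"
  assumes r: "\<And>i. r i \<noteq> 0"
  shows "lborel = density (distr lborel borel (diag_aff r b)) (\<lambda>_. ennreal (\<Prod>i\<in>UNIV. \<bar>r i\<bar>))"
proof -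
  define c where "c = (\<lambda>j::real^'n. \<Sum>i\<in>UNIV. r i * j $ i)"
  have c: "c (axis k 1) = r k" for k
    by (simp add: c_def axis_def if_distrib[of "\<lambda>x. r _ * x"] cong: if_cong)
  have "lborel = density (distr lborel borel (\<lambda>x. b + (\<Sum>j\<in>Basis. (c j * (x \<bullet> j)) *\<^sub>R j))) (\<lambda>_. \<Prod>j\<in>Basis. \<bar>c j\<bar>)"
    by (rule lborel_affine_euclidean) (auto simp: Basis_vec_def c r)
  also have "(\<lambda>x. b + (\<Sum>j\<in>Basis. (c j * (x \<bullet> j)) *\<^sub>R j)) = diag_aff r b"
  proof
    fix x
    have "(\<Sum>i\<in>UNIV. (r i * x $ i) *\<^sub>R axis i (1::real)) $ k = r k * x $ k" for k
      by (simp add: axis_def if_distrib[of "\<lambda>x. _ * x"] cong: if_cong)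
    then show "b + (\<Sum>j\<in>Basis. (c j * (x \<bullet> j)) *\<^sub>R j) = diag_aff r b x"
      by (simp add: sum_Basis_cart c inner_axis vec_eq_iff diag_aff_def)
  qed
  also have "(\<Prod>j\<in>Basis. \<bar>c j\<bar>) = (\<Prod>i\<in>UNIV. \<bar>r i\<bar>)"
    by (simp add: prod_Basis_cart c)
  finally show ?thesis .
qed

lemma measurable_diag_aff [measurable]: "diag_aff r b \<in> borel_measurable borel"
  by (intro borel_measurable_continuous_onI continuous_diag_aff)

lemma integral_diag_aff:
  fixes f :: "real^'n::finite \<Rightarrow> 'b::{banach, second_countable_topology}"
  assumes r: "\<And>i. r i > 0" and f [measurable]: "f \<in> borel_measurable borel"
  shows "(\<integral>x. f (diag_aff r b x) \<partial>lborel) = (1 / (\<Prod>i\<in>UNIV. r i)) *\<^sub>R (\<integral>x. f x \<partial>lborel)"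
proof -
  have p: "(\<Prod>i\<in>UNIV. r i) > 0" by (intro prod_pos) (simp add: r)
  have "(\<integral>x. f x \<partial>lborel) = (\<integral>x. f x \<partial>density (distr lborel borel (diag_aff r b)) (\<lambda>_. ennreal (\<Prod>i\<in>UNIV. \<bar>r i\<bar>)))"
    by (subst lborel_diag_aff[of r b]) (use r in \<open>auto simp: less_imp_neq[symmetric]\<close>)
  also have "\<dots> = (\<Prod>i\<in>UNIV. r i) *\<^sub>R (\<integral>x. f (diag_aff r b x) \<partial>lborel)"
    using r p by (subst integral_density) (auto simp: integral_distr abs_of_pos less_imp_le)
  finally show ?thesis using p by (simp del: prod_zero_iff)
qed

lemma integrable_diag_aff:
  fixes f :: "real^'n::finite \<Rightarrow> 'b::{banach, second_countable_topology}"
  assumes r: "\<And>i. r i > 0" and f: "integrable lborel f"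
  shows "integrable lborel (\<lambda>x. f (diag_aff r b x))"
proof -
  have p: "(\<Prod>i\<in>UNIV. r i) > 0" by (intro prod_pos) (simp add: r)
  have [measurable]: "f \<in> borel_measurable borel" using f by auto
  have "integrable (density (distr lborel borel (diag_aff r b)) (\<lambda>_. ennreal (\<Prod>i\<in>UNIV. \<bar>r i\<bar>))) f"
    using f by (subst (asm) lborel_diag_aff[of r b]) (use r in \<open>auto simp: less_imp_neq[symmetric]\<close>)
  then have "integrable lborel (\<lambda>x. (\<Prod>i\<in>UNIV. r i) *\<^sub>R f (diag_aff r b x))"
    using r p by (subst (asm) integrable_density) (auto simp: integrable_distr_eq abs_of_pos less_imp_le simp del: prod_zero_iff)
  from integrable_scaleR_right[of "1 / (\<Prod>i\<in>UNIV. r i)", OF this] show ?thesis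
    using p by (simp del: prod_zero_iff)
qed

lemma integral_shift:
  fixes f :: "real^'n::finite \<Rightarrow> 'b::{banach, second_countable_topology}"
  assumes "f \<in> borel_measurable borel"
  shows "(\<integral>x. f (x + b) \<partial>lborel) = (\<integral>x. f x \<partial>lborel)"
  using integral_diag_aff[of "\<lambda>_. 1" f b] assms by (simp add: diag_aff_shift)

lemma integrable_shift:
  fixes f :: "real^'n::finite \<Rightarrow> 'b::{banach, second_countable_topology}"
  assumes "integrable lborel f"
  shows "integrable lborel (\<lambda>x. f (x + b))"
  using integrable_diag_aff[of "\<lambda>_. 1" f b] assms by (simp add: diag_aff_shift)

lemma nn_integral_arctan: "(\<integral>\<^sup>+ x. ennreal (1 / (1 + x\<^sup>2)) \<partial>lborel) < \<infinity>"
proof -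
  have half: "(\<integral>\<^sup>+ x. ennreal (1 / (1 + x\<^sup>2)) * indicator {0..} x \<partial>lborel) = ennreal (pi / 2 - arctan 0)"
  proof (rule nn_integral_FTC_atLeast)
    show "DERIV arctan x :> 1 / (1 + x\<^sup>2)" for x
      using DERIV_arctan[of x] by (simp add: divide_inverse)
    show "(arctan \<longlongrightarrow> pi / 2) at_top" by (rule tendsto_arctan_at_top)
  qed (simp_all add: add_nonneg_nonneg)
  have refl: "(\<integral>\<^sup>+ x. ennreal (1 / (1 + x\<^sup>2)) * indicator {..0} x \<partial>lborel)
     = (\<integral>\<^sup>+ x. ennreal (1 / (1 + x\<^sup>2)) * indicator {0..} x \<partial>lborel)"
    by (subst nn_integral_real_affine[where c = "-1" and t = 0]) (auto simp: indicator_def intro!: nn_integral_cong)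
  have "(\<integral>\<^sup>+ x. ennreal (1 / (1 + x\<^sup>2)) \<partial>lborel) \<le>
      (\<integral>\<^sup>+ x. (ennreal (1 / (1 + x\<^sup>2)) * indicator {..0} x + ennreal (1 / (1 + x\<^sup>2)) * indicator {0..} x) \<partial>lborel)"
    by (intro nn_integral_mono) (auto simp: indicator_def)
  also have "\<dots> = ennreal (pi / 2) + ennreal (pi / 2)"
    by (subst nn_integral_add) (auto simp: refl half)
  also have "\<dots> < \<infinity>" by simp
  finally show ?thesis .
qed

text \<open>Comparison with a product of one-dimensional functions 1 / (1 + t^2): the square of 1 +
  |x| dominates 1 + x_i^2 for each coordinate, and one such square per coordinate gives the exponent
  2 * CARD('n).\<close>

lemma integrable_weight:
  "integrable lborel (\<lambda>x::real^'n::finite. 1 / (1 + norm x) ^ (2 * CARD('n)))"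
proof (rule integrableI_bounded)
  have "(\<integral>\<^sup>+ x. ennreal (norm (1 / (1 + norm x) ^ (2 * CARD('n)))) \<partial>(lborel :: (real^'n) measure))
      \<le> (\<integral>\<^sup>+ x. ennreal (\<Prod>b\<in>Basis. 1 / (1 + (x \<bullet> b)\<^sup>2)) \<partial>(lborel :: (real^'n) measure))"
  proof (intro nn_integral_mono ennreal_leI)
    fix x :: "real^'n"
    have "(\<Prod>i\<in>(UNIV::'n set). 1 / (1 + norm x)\<^sup>2) \<le> (\<Prod>i\<in>UNIV. 1 / (1 + (x $ i)\<^sup>2))"
    proof (intro prod_mono conjI)
      fix i
      have "(x $ i)\<^sup>2 \<le> (norm x)\<^sup>2"
        using component_le_norm_cart[of x i] by (metis abs_ge_zero power2_abs power_mono)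
      moreover have "(1 + norm x)\<^sup>2 = 1 + (norm x)\<^sup>2 + 2 * norm x" by (simp add: power2_eq_square algebra_simps)
      ultimately have "1 + (x $ i)\<^sup>2 \<le> (1 + norm x)\<^sup>2" using norm_ge_zero[of x] by linarith
      then show "1 / (1 + norm x)\<^sup>2 \<le> 1 / (1 + (x $ i)\<^sup>2)"
      proof (intro divide_left_mono mult_pos_pos)
        show "0 < (1 + norm x)\<^sup>2" using norm_ge_zero[of x] by (intro zero_less_power) linarith
      qed (auto simp: add_pos_nonneg)
    qed simp
    also have "(\<Prod>i\<in>(UNIV::'n set). 1 / (1 + norm x)\<^sup>2) = 1 / (1 + norm x) ^ (2 * CARD('n))"
      by (simp add: power_mult power_one_over power_divide)
    finally show "norm (1 / (1 + norm x) ^ (2 * CARD('n))) \<le> (\<Prod>b\<in>Basis. 1 / (1 + (x \<bullet> b)\<^sup>2))"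
      by (simp add: prod_Basis_cart inner_axis)
  qed
  also have "\<dots> = (\<Prod>b\<in>(Basis :: (real^'n) set). \<integral>\<^sup>+ t. ennreal (1 / (1 + t\<^sup>2)) \<partial>lborel)"
    by (subst prod_ennreal[symmetric], simp, subst nn_integral_lborel_prod[symmetric]) (auto simp: prod_ennreal)
  also have "\<dots> < \<infinity>"
    using nn_integral_arctan by (simp add: power_less_top_ennreal)
  finally show "(\<integral>\<^sup>+ x. ennreal (norm (1 / (1 + norm x) ^ (2 * CARD('n)))) \<partial>(lborel :: (real^'n) measure)) < \<infinity>" .
qed simp

lemma integrable_rdecay:
  fixes f :: "real^'n::finite \<Rightarrow> 'b::{banach, second_countable_topology}"
  assumes "continuous_on UNIV f" "rdecay f"
  shows "integrable lborel f"
proof -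
  obtain C where C: "\<And>x. norm (f x) * (1 + norm x) ^ (2 * CARD('n)) \<le> C"
    using rdecayE[OF assms(2)] by metis
  show ?thesis
  proof (rule Bochner_Integration.integrable_bound)
    show "integrable lborel (\<lambda>x::real^'n. C * (1 / (1 + norm x) ^ (2 * CARD('n))))"
      by (intro integrable_mult_right integrable_weight)
    show "f \<in> borel_measurable lborel"
      using borel_measurable_continuous_onI[OF assms(1)] by simp
    have "norm (f x) \<le> norm (C * (1 / (1 + norm x) ^ (2 * CARD('n))))" for x
    proof -
      have "norm (f x) \<le> C / (1 + norm x) ^ (2 * CARD('n))"
        using C[of x] by (subst pos_le_divide_eq) (auto simp: add_pos_nonneg)
      also have "\<dots> \<le> \<bar>C / (1 + norm x) ^ (2 * CARD('n))\<bar>" by (rule abs_ge_self)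
      finally show ?thesis by simp
    qed
    then show "AE x in lborel. norm (f x) \<le> norm (C * (1 / (1 + norm x) ^ (2 * CARD('n))))" by simp
  qed
qed

text \<open>Rests on 1 + |x| \<le> (1 + |x + y|) (1 + |y|). Uniformity over a ball of translations y
  supplies dominating functions for translates and constants independent of the centre of a
  kernel.\<close>

lemma rdecay_shift_uniform:
  assumes "rdecay f"
  obtains C where "C \<ge> 0" "\<And>x y. norm y \<le> r \<Longrightarrow> norm (f (x + y)) * (1 + norm x) ^ p \<le> C"
proof -
  obtain C where C: "C \<ge> 0" "\<And>x. norm (f x) * (1 + norm x) ^ p \<le> C" using rdecayE[OF assms] by metis
  have "norm (f (x + b)) * (1 + norm x) ^ p \<le> C * (1 + \<bar>r\<bar>) ^ p" if "norm b \<le> r" for x b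
  proof -
    have "1 + norm x \<le> 1 + norm (x + b) + norm b"
      using norm_triangle_ineq4[of "x + b" b] by simp
    also have "\<dots> \<le> (1 + norm (x + b)) * (1 + norm b)" by (simp add: algebra_simps)
    also have "\<dots> \<le> (1 + norm (x + b)) * (1 + \<bar>r\<bar>)" using that by (intro mult_left_mono) auto
    finally have "(1 + norm x) ^ p \<le> ((1 + norm (x + b)) * (1 + \<bar>r\<bar>)) ^ p"
      by (rule power_mono) simp
    then have "(1 + norm x) ^ p \<le> (1 + norm (x + b)) ^ p * (1 + \<bar>r\<bar>) ^ p"
      by (simp add: power_mult_distrib)
    then have "norm (f (x + b)) * (1 + norm x) ^ p \<le> norm (f (x + b)) * ((1 + norm (x + b)) ^ p * (1 + \<bar>r\<bar>) ^ p)"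
      by (intro mult_left_mono) auto
    also have "\<dots> \<le> C * (1 + \<bar>r\<bar>) ^ p"
      unfolding mult.assoc[symmetric] by (intro mult_right_mono C) simp
    finally show ?thesis .
  qed
  moreover have "0 \<le> C * (1 + \<bar>r\<bar>) ^ p" using C by simp
  ultimately show ?thesis using that by blast
qed

lemma rdecay_shift:
  assumes "rdecay f" shows "rdecay (\<lambda>x. f (x + b))"
  unfolding rdecay_def
proof
  fix p
  obtain C where "\<And>x y. norm y \<le> norm b \<Longrightarrow> norm (f (x + y)) * (1 + norm x) ^ p \<le> C"
    using rdecay_shift_uniform[OF assms] by metis
  then show "\<exists>C. \<forall>x. norm (f (x + b)) * (1 + norm x) ^ p \<le> C" by (intro exI[of _ C]) simp
qed

section \<open>Differentiation under the integral sign\<close>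

lemma has_vector_derivative_at_iff:
  "(f has_vector_derivative D) (at x) \<longleftrightarrow> ((\<lambda>h. (f (x + h) - f x) /\<^sub>R h - D) \<longlongrightarrow> 0) (at 0)"
proof -
  have "(f has_vector_derivative D) (at x) \<longleftrightarrow> ((\<lambda>h. norm (f (x + h) - f x - h *\<^sub>R D) / norm h) \<longlongrightarrow> 0) (at 0)"
    by (auto simp: has_vector_derivative_def has_derivative_at bounded_linear_scaleR_left)
  also have "\<dots> \<longleftrightarrow> ((\<lambda>h. norm ((f (x + h) - f x) /\<^sub>R h - D)) \<longlongrightarrow> 0) (at 0)"
  proof (rule filterlim_cong[OF refl refl])
    have "\<forall>\<^sub>F h in at 0. h \<noteq> (0::real)" by (simp add: eventually_at_filter)
    then show "\<forall>\<^sub>F h in at 0. norm (f (x + h) - f x - h *\<^sub>R D) / norm h = norm ((f (x + h) - f x) /\<^sub>R h - D)"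
    proof eventually_elim
      case (elim h)
      have "(f (x + h) - f x) /\<^sub>R h - D = (f (x + h) - f x - h *\<^sub>R D) /\<^sub>R h"
        using elim by (simp add: scaleR_diff_right)
      then show ?case by (simp add: divide_inverse mult.commute)
    qed
  qed
  also have "\<dots> \<longleftrightarrow> ((\<lambda>h. (f (x + h) - f x) /\<^sub>R h - D) \<longlongrightarrow> 0) (at 0)"
    by (rule tendsto_norm_zero_iff)
  finally show ?thesis .
qed

text \<open>Dominated convergence: by the mean value inequality the bound w on the derivative over
  the unit interval around t0 also bounds the difference quotients, so 2 * w dominates quotient
  minus derivative.\<close>

lemma has_vector_derivative_integral:
  fixes g :: "real \<Rightarrow> 'a \<Rightarrow> 'b::{banach, second_countable_topology}"
  assumes der: "\<And>t z. \<bar>t - t0\<bar> \<le> 1 \<Longrightarrow> ((\<lambda>t. g t z) has_vector_derivative g' t z) (at t)"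
    and int: "\<And>t. \<bar>t - t0\<bar> \<le> 1 \<Longrightarrow> integrable M (g t)"
    and bd: "\<And>t z. \<bar>t - t0\<bar> \<le> 1 \<Longrightarrow> norm (g' t z) \<le> w z"
    and w: "integrable M w" and meas [measurable]: "g' t0 \<in> borel_measurable M"
  shows "((\<lambda>t. \<integral>z. g t z \<partial>M) has_vector_derivative (\<integral>z. g' t0 z \<partial>M)) (at t0)"
proof -
  have int': "integrable M (g' t0)"
    by (rule Bochner_Integration.integrable_bound[OF w]) (use bd[of t0] in \<open>auto intro!: AE_I2 order_trans[OF _ abs_ge_self]\<close>)
  have mvt: "norm (g (t0 + h) z - g t0 z) \<le> w z * \<bar>h\<bar>" if "\<bar>h\<bar> \<le> 1" for h z
  proof -
    have "norm (g (t0 + h) z - g t0 z) \<le> w z * norm (t0 + h - t0)"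
    proof (rule differentiable_bound[of "cball t0 1" "\<lambda>t. g t z" "\<lambda>t x. x *\<^sub>R g' t z"])
      fix t assume "t \<in> cball t0 1"
      then have t: "\<bar>t - t0\<bar> \<le> 1" by (simp add: dist_real_def abs_minus_commute)
      show "((\<lambda>t. g t z) has_derivative (\<lambda>x. x *\<^sub>R g' t z)) (at t within cball t0 1)"
        using der[OF t, of z] by (simp add: has_vector_derivative_def has_derivative_at_withinI)
      show "onorm (\<lambda>x. x *\<^sub>R g' t z) \<le> w z"
        by (rule onorm_le) (use mult_left_mono[OF bd[OF t, of z]] in \<open>simp add: mult.commute\<close>)
    qed (use that in \<open>auto simp: dist_real_def\<close>)
    then show ?thesis by simp
  qed
  have "((\<lambda>h. \<integral>z. (g (t0 + h) z - g t0 z) /\<^sub>R h - g' t0 z \<partial>M) \<longlongrightarrow> (\<integral>z. 0 \<partial>M)) (at 0)"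
    unfolding tendsto_at_iff_sequentially o_def
  proof (intro allI impI)
    fix X :: "nat \<Rightarrow> real" assume X: "\<forall>i. X i \<in> UNIV - {0}" "X \<longlonglongrightarrow> 0"
    have "\<forall>\<^sub>F i in sequentially. dist (X i) 0 < 1" using X(2) by (rule tendstoD) simp
    \<comment> \<open>The hypotheses cover only increments of size at most 1; a shift of the
      sequence by N ensures this for all its terms.\<close>
    then obtain N where N: "\<And>i. i \<ge> N \<Longrightarrow> \<bar>X i\<bar> < 1"
      by (auto simp: eventually_sequentially)
    have "(\<lambda>i. \<integral>z. (g (t0 + X (i + N)) z - g t0 z) /\<^sub>R X (i + N) - g' t0 z \<partial>M) \<longlonglongrightarrow> (\<integral>z. 0 \<partial>M)"
    proof (rule integral_dominated_convergence[where w = "\<lambda>z. 2 * w z"])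
      show "integrable M (\<lambda>z. 2 * w z)" using w by simp
      have [measurable]: "g t0 \<in> borel_measurable M" using int[of t0] by auto
      have [measurable]: "g (t0 + X (i + N)) \<in> borel_measurable M" for i
        using int[of "t0 + X (i + N)"] N[of "i + N"] by (auto intro: less_imp_le)
      show "(\<lambda>z. (g (t0 + X (i + N)) z - g t0 z) /\<^sub>R X (i + N) - g' t0 z) \<in> borel_measurable M" for i
        by measurable
      show "AE z in M. norm ((g (t0 + X (i + N)) z - g t0 z) /\<^sub>R X (i + N) - g' t0 z) \<le> 2 * w z" for i
      proof (rule AE_I2)
        fix z
        have x: "\<bar>X (i + N)\<bar> \<le> 1" "X (i + N) \<noteq> 0" using N[of "i + N"] X(1) by (auto intro: less_imp_le)
        have "norm ((g (t0 + X (i + N)) z - g t0 z) /\<^sub>R X (i + N)) \<le> w z"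
        proof -
          have "norm ((g (t0 + X (i + N)) z - g t0 z) /\<^sub>R X (i + N)) = norm (g (t0 + X (i + N)) z - g t0 z) / \<bar>X (i + N)\<bar>"
            by (simp add: divide_inverse mult.commute)
          also have "\<dots> \<le> w z"
            using mvt[OF x(1), of z] x(2) by (simp add: pos_divide_le_eq)
          finally show ?thesis .
        qed
        moreover have "norm (g' t0 z) \<le> w z" using bd[of t0] by simp
        ultimately show "norm ((g (t0 + X (i + N)) z - g t0 z) /\<^sub>R X (i + N) - g' t0 z) \<le> 2 * w z"
          using norm_triangle_ineq4[of "(g (t0 + X (i + N)) z - g t0 z) /\<^sub>R X (i + N)" "g' t0 z"] by linarith
      qed
      show "AE z in M. (\<lambda>i. (g (t0 + X (i + N)) z - g t0 z) /\<^sub>R X (i + N) - g' t0 z) \<longlonglongrightarrow> 0"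
      proof (rule AE_I2)
        fix z
        have "((\<lambda>h. (g (t0 + h) z - g t0 z) /\<^sub>R h - g' t0 z) \<longlongrightarrow> 0) (at 0)"
          using der[of t0 z] by (simp add: has_vector_derivative_at_iff)
        from this[unfolded tendsto_at_iff_sequentially o_def, rule_format, OF X(1)[rule_format] X(2)]
        show "(\<lambda>i. (g (t0 + X (i + N)) z - g t0 z) /\<^sub>R X (i + N) - g' t0 z) \<longlonglongrightarrow> 0"
          by (rule LIMSEQ_ignore_initial_segment)
      qed
    qed simp_all
    then show "(\<lambda>i. \<integral>z. (g (t0 + X i) z - g t0 z) /\<^sub>R X i - g' t0 z \<partial>M) \<longlonglongrightarrow> (\<integral>z. 0 \<partial>M)"
      by (rule LIMSEQ_offset)
  qed
  then have lim: "((\<lambda>h. \<integral>z. (g (t0 + h) z - g t0 z) /\<^sub>R h - g' t0 z \<partial>M) \<longlongrightarrow> 0) (at 0)"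
    by simp
  have "\<forall>\<^sub>F h in at 0. dist h (0::real) < 1" unfolding eventually_at by (auto intro: exI[of _ 1])
  then have "\<forall>\<^sub>F h in at 0. (\<integral>z. (g (t0 + h) z - g t0 z) /\<^sub>R h - g' t0 z \<partial>M) =
        ((\<integral>z. g (t0 + h) z \<partial>M) - (\<integral>z. g t0 z \<partial>M)) /\<^sub>R h - (\<integral>z. g' t0 z \<partial>M)"
    by eventually_elim (auto simp: int int')
  from Lim_transform_eventually[OF lim this] show ?thesis
    by (simp add: has_vector_derivative_at_iff)
qed

section \<open>Schwartz functions\<close>

definition schwartz :: "(real^'n::finite \<Rightarrow> complex) \<Rightarrow> bool" where
  "schwartz f \<longleftrightarrow> smooth f \<and> (\<forall>l. rdecay (pderivs l f))"

lemma schwartz_smooth: "schwartz f \<Longrightarrow> smooth f"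
  by (simp add: schwartz_def)

lemma schwartz_cont: "schwartz f \<Longrightarrow> continuous_on UNIV f"
  by (simp add: schwartz_def smooth_cont)

lemma schwartz_rdecay: "schwartz f \<Longrightarrow> rdecay f"
  unfolding schwartz_def by (metis pderivs.simps(1))

lemma schwartz_pderivs: "schwartz f \<Longrightarrow> schwartz (pderivs l f)"
  by (simp add: schwartz_def smooth_pderivs pderivs_append)

lemma schwartz_partial: "schwartz f \<Longrightarrow> schwartz (partial i f)"
  using schwartz_pderivs[of f "[i]"] by simp

lemma schwartz_has_pd: "schwartz f \<Longrightarrow> has_pd i f (partial i f)"
  by (simp add: schwartz_def smooth_has_pd)

lemma schwartz_integrable: "schwartz f \<Longrightarrow> integrable lborel f"
  by (intro integrable_rdecay schwartz_cont schwartz_rdecay)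

lemma schwartz_coinduct:
  assumes f: "f \<in> W"
    and cont: "\<And>f. f \<in> W \<Longrightarrow> continuous_on UNIV f"
    and rd: "\<And>f. f \<in> W \<Longrightarrow> rdecay f"
    and step: "\<And>f i. f \<in> W \<Longrightarrow> \<exists>f'\<in>W. has_pd i f f'"
  shows "schwartz f"
  unfolding schwartz_def
proof (intro conjI allI)
  show "smooth f" by (rule smooth_coinduct(1)[of f W, OF f cont step])
  show "rdecay (pderivs l f)" for l
    by (rule rd) (rule smooth_coinduct(2)[of f W, OF f cont step])
qed

lemma schwartz_add:
  assumes "schwartz f" "schwartz g" shows "schwartz (\<lambda>x. f x + g x)"
proof (rule schwartz_coinduct[of _ "{(\<lambda>x. f x + g x) |f g. schwartz f \<and> schwartz g}"])
  show "(\<lambda>x. f x + g x) \<in> {(\<lambda>x. f x + g x) |f g. schwartz f \<and> schwartz g}" using assms by blast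
next
  fix h :: "real^'a \<Rightarrow> complex"
  assume "h \<in> {(\<lambda>x. f x + g x) |f g. schwartz f \<and> schwartz g}"
  then obtain f g where h: "h = (\<lambda>x. f x + g x)" "schwartz f" "schwartz g" by blast
  show "continuous_on UNIV h" unfolding h(1)
    by (rule continuous_on_add[OF schwartz_cont[OF h(2)] schwartz_cont[OF h(3)]])
  show "rdecay h" unfolding h(1)
    by (rule rdecay_add[OF schwartz_rdecay[OF h(2)] schwartz_rdecay[OF h(3)]])
  fix i
  have "has_pd i h (\<lambda>x. partial i f x + partial i g x)" unfolding h(1)
    by (rule has_pd_add[OF schwartz_has_pd[OF h(2)] schwartz_has_pd[OF h(3)]])
  then show "\<exists>h'\<in>{(\<lambda>x. f x + g x) |f g. schwartz f \<and> schwartz g}. has_pd i h h'"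
    using schwartz_partial[OF h(2)] schwartz_partial[OF h(3)] by blast
qed

lemma schwartz_zero: "schwartz (\<lambda>x. 0)"
proof (rule schwartz_coinduct[of _ "{\<lambda>x. 0}"])
  fix f :: "real^'a \<Rightarrow> complex" and i assume "f \<in> {\<lambda>x. 0}"
  then show "\<exists>f'\<in>{\<lambda>x. 0}. has_pd i f f'" using has_pd_const[of i 0] by simp
qed (auto intro: rdecay_zero)

lemma schwartz_cmult:
  assumes "schwartz f" shows "schwartz (\<lambda>x. c * f x)"
proof -
  have "rdecay (pderivs l (\<lambda>x. c * f x))" for l
    using assms by (auto simp: schwartz_def pderivs_cmult intro: rdecay_cmult)
  then show ?thesis using assms by (simp add: schwartz_def smooth_cmult)
qed

lemma schwartz_sum: "(\<And>k. k \<in> A \<Longrightarrow> schwartz (f k)) \<Longrightarrow> schwartz (\<lambda>x. \<Sum>k\<in>A. f k x)"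
  by (induction A rule: infinite_finite_induct) (auto intro!: schwartz_zero schwartz_add)

lemma schwartz_coord:
  assumes "schwartz f" shows "schwartz (\<lambda>x. of_real (x $ j) * f x)"
\<comment> \<open>Differentiating the factor x_j leaves a multiple of f, so the invariant class
  carries an additional Schwartz summand g.\<close>
proof (rule schwartz_coinduct[of _ "{(\<lambda>x. of_real (x $ j) * f x + g x) |f g. schwartz f \<and> schwartz g}"])
  have "(\<lambda>x. of_real (x $ j) * f x) = (\<lambda>x. of_real (x $ j) * f x + (\<lambda>x. 0) x)" by simp
  with assms schwartz_zero show "(\<lambda>x. of_real (x $ j) * f x) \<in> {(\<lambda>x. of_real (x $ j) * f x + g x) |f g. schwartz f \<and> schwartz g}"
    by (intro CollectI exI[of _ f] exI[of _ "\<lambda>x. 0"]) simp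
next
  fix h :: "real^'a \<Rightarrow> complex"
  assume "h \<in> {(\<lambda>x. of_real (x $ j) * f x + g x) |f g. schwartz f \<and> schwartz g}"
  then obtain f g where h: "h = (\<lambda>x. of_real (x $ j) * f x + g x)" "schwartz f" "schwartz g" by blast
  show "continuous_on UNIV h" unfolding h(1)
    by (intro continuous_on_add continuous_on_mult schwartz_cont h continuous_intros)
  show "rdecay h" unfolding h(1)
    by (rule rdecay_add[OF rdecay_mult[OF pgrow_coord schwartz_rdecay[OF h(2)]] schwartz_rdecay[OF h(3)]])
  fix i
  define g' where "g' = (\<lambda>x. (if i = j then 1 else 0) * f x + partial i g x)"
  have g': "schwartz g'" unfolding g'_def
    by (rule schwartz_add[OF schwartz_cmult[OF h(2)] schwartz_partial[OF h(3)]])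
  have "has_pd i h (\<lambda>x. (of_real (x $ j) * partial i f x + (if i = j then 1 else 0) * f x) + partial i g x)"
    unfolding h(1)
    by (rule has_pd_add[OF has_pd_mult[OF has_pd_coord schwartz_has_pd[OF h(2)]] schwartz_has_pd[OF h(3)]])
  then have "has_pd i h (\<lambda>x. of_real (x $ j) * partial i f x + g' x)"
    by (simp add: g'_def add.assoc)
  then show "\<exists>h'\<in>{(\<lambda>x. of_real (x $ j) * f x + g x) |f g. schwartz f \<and> schwartz g}. has_pd i h h'"
    using schwartz_partial[OF h(2)] g' by blast
qed

lemma schwartz_shift: "schwartz f \<Longrightarrow> schwartz (\<lambda>x. f (x - b))"
  using rdecay_shift[of "pderivs _ f" "- b"]
  by (auto simp: schwartz_def smooth_shift pderivs_shift)

lemma pderivs_zero_open: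
  assumes "open S" "\<And>x. x \<in> S \<Longrightarrow> f x = 0" "x \<in> S"
  shows "pderivs l f x = 0"
  using assms(3)
proof (induction l arbitrary: x)
  case (Cons i l)
  obtain e :: real where e: "e > 0" "ball x e \<subseteq> S" using assms(1) Cons.prems by (meson open_contains_ball)
  have "((\<lambda>t. pderivs l f (x + t *\<^sub>R axis i 1)) has_vector_derivative 0) (at 0)"
  proof (rule has_vector_derivative_transform_within_open[of "\<lambda>t::real. 0" 0 0 "ball 0 e"])
    fix t :: real assume "t \<in> ball 0 e"
    then have "x + t *\<^sub>R axis i 1 \<in> ball x e" by (auto simp: dist_norm norm_axis_1)
    then show "0 = pderivs l f (x + t *\<^sub>R axis i 1)" using Cons.IH e(2) by auto
  qed (use e in auto)
  then show ?case by (simp add: partial_def vector_derivative_at)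
qed (simp add: assms)

lemma schwartz_compact_support:
  assumes "smooth f" "\<And>x. norm x \<ge> r \<Longrightarrow> f x = 0"
  shows "schwartz f"
  unfolding schwartz_def
proof (intro conjI allI assms(1))
  fix l
  have out: "pderivs l f x = 0" if "norm x > r" for x
    by (rule pderivs_zero_open[of "{x. norm x > r}"]) (use assms(2) that in \<open>auto intro: open_Collect_less continuous_intros\<close>)
  show "rdecay (pderivs l f)" unfolding rdecay_def
  proof
    fix p
    have "continuous_on (cball 0 r) (\<lambda>x. norm (pderivs l f x) * (1 + norm x) ^ p)"
      using smooth_cont[OF smooth_pderivs[OF assms(1), of l]] by (auto intro!: continuous_intros elim: continuous_on_subset)
    then have "bounded ((\<lambda>x. norm (pderivs l f x) * (1 + norm x) ^ p) ` cball 0 r)"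
      by (intro compact_imp_bounded compact_continuous_image) auto
    then obtain C where C: "\<And>x. norm x \<le> r \<Longrightarrow> norm (pderivs l f x) * (1 + norm x) ^ p \<le> C"
      unfolding bounded_iff by (fastforce simp: abs_le_iff)
    have "norm (pderivs l f x) * (1 + norm x) ^ p \<le> max C 0" for x
      using C[of x] out[of x] by (cases "norm x \<le> r") auto
    then show "\<exists>C. \<forall>x. norm (pderivs l f x) * (1 + norm x) ^ p \<le> C" by blast
  qed
qed

lemma rdecay_shift_dominated:
  assumes "rdecay f"
  obtains w where "integrable lborel w" "\<And>x y. norm y \<le> r \<Longrightarrow> norm (f (x + y :: real^'n::finite)) \<le> w x"
proof -
  obtain C where C: "C \<ge> 0" "\<And>x y. norm y \<le> r \<Longrightarrow> norm (f (x + y)) * (1 + norm x) ^ (2 * CARD('n)) \<le> C"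
    using rdecay_shift_uniform[OF assms] by metis
  have "norm (f (x + y)) \<le> C * (1 / (1 + norm x) ^ (2 * CARD('n)))" if "norm y \<le> r" for x y
    using C(2)[OF that, of x] by (simp add: pos_le_divide_eq add_pos_nonneg)
  moreover have "integrable lborel (\<lambda>x::real^'n. C * (1 / (1 + norm x) ^ (2 * CARD('n))))"
    by (intro integrable_mult_right integrable_weight)
  ultimately show ?thesis using that by blast
qed

text \<open>By translation invariance the integral of f shifted along axis i is constant in the
  shift; its derivative, computed under the integral, is the integral of f'.\<close>

lemma integral_pd_zero:
  fixes f :: "real^'n::finite \<Rightarrow> complex"
  assumes f: "continuous_on UNIV f" "rdecay f" and f': "continuous_on UNIV f'" "rdecay f'"
    and pd: "has_pd i f f'"
  shows "(\<integral>x. f' x \<partial>lborel) = 0"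
proof -
  obtain w where w: "integrable lborel w" "\<And>x y. norm y \<le> 1 \<Longrightarrow> norm (f' (x + y)) \<le> w x"
    using rdecay_shift_dominated[OF f'(2)] by metis
  have "((\<lambda>t. \<integral>z. f (z + t *\<^sub>R axis i 1) \<partial>lborel) has_vector_derivative (\<integral>z. f' (z + 0 *\<^sub>R axis i 1) \<partial>lborel)) (at 0)"
  proof (rule has_vector_derivative_integral[OF _ _ _ w(1)])
    show "((\<lambda>t. f (z + t *\<^sub>R axis i 1)) has_vector_derivative f' (z + t *\<^sub>R axis i 1)) (at t)" for t z
      by (rule has_pd_at[OF pd])
    show "integrable lborel (\<lambda>z. f (z + t *\<^sub>R axis i 1))" for t
      by (intro integrable_shift integrable_rdecay f)
    show "norm (f' (z + t *\<^sub>R axis i 1)) \<le> w z" if "\<bar>t - 0\<bar> \<le> 1" for t z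
      by (rule w(2)) (use that in simp)
    show "(\<lambda>z. f' (z + 0 *\<^sub>R axis i 1)) \<in> borel_measurable lborel"
      using borel_measurable_continuous_onI[OF f'(1)] by simp
  qed
  moreover have "(\<integral>z. f (z + t *\<^sub>R axis i 1) \<partial>lborel) = (\<integral>z. f z \<partial>lborel)" for t
    by (rule integral_shift[OF borel_measurable_continuous_onI[OF f(1)]])
  ultimately have "((\<lambda>t::real. \<integral>z. f z \<partial>lborel) has_vector_derivative (\<integral>z. f' z \<partial>lborel)) (at 0)"
    by simp
  from vector_derivative_unique_at[OF this has_vector_derivative_const] show ?thesis .
qed

section \<open>Slowly growing functions and integration by parts\<close>

definition slowly_growing :: "(real^'n::finite \<Rightarrow> complex) \<Rightarrow> bool" where
  "slowly_growing f \<longleftrightarrow> smooth f \<and> (\<forall>l. pgrow (pderivs l f))"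

lemma slowly_growing_partial: "slowly_growing f \<Longrightarrow> slowly_growing (partial i f)"
  by (simp add: slowly_growing_def smooth_partial pderivs_snoc)

lemma slowly_growing_cont: "slowly_growing f \<Longrightarrow> continuous_on UNIV f"
  by (simp add: slowly_growing_def smooth_cont)

lemma slowly_growing_pgrow: "slowly_growing f \<Longrightarrow> pgrow f"
  unfolding slowly_growing_def by (metis pderivs.simps(1))

lemma slowly_growing_coinduct:
  assumes f: "f \<in> W"
    and cont: "\<And>f. f \<in> W \<Longrightarrow> continuous_on UNIV f"
    and gr: "\<And>f. f \<in> W \<Longrightarrow> pgrow f"
    and step: "\<And>f i. f \<in> W \<Longrightarrow> \<exists>f'\<in>W. has_pd i f f'"
  shows "slowly_growing f"
  unfolding slowly_growing_def
proof (intro conjI allI)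
  show "smooth f" by (rule smooth_coinduct(1)[of f W, OF f cont step])
  show "pgrow (pderivs l f)" for l
    by (rule gr) (rule smooth_coinduct(2)[of f W, OF f cont step])
qed

lemma integrable_slow_schwartz:
  assumes "slowly_growing q" "schwartz f"
  shows "integrable lborel (\<lambda>x. q x * f x)"
  using assms
  by (intro integrable_rdecay rdecay_mult continuous_on_mult schwartz_cont schwartz_rdecay slowly_growing_cont slowly_growing_pgrow)

lemma integral_by_parts_partial:
  assumes q: "slowly_growing q" and f: "schwartz f"
  shows "(\<integral>x. q x * partial i f x \<partial>lborel) = - (\<integral>x. partial i q x * f x \<partial>lborel)"
proof -
  have i1: "integrable lborel (\<lambda>x. q x * partial i f x)"
    by (intro integrable_slow_schwartz q schwartz_partial f)
  have i2: "integrable lborel (\<lambda>x. partial i q x * f x)"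
    by (intro integrable_slow_schwartz slowly_growing_partial q f)
  have "(\<integral>x. q x * partial i f x + partial i q x * f x \<partial>lborel) = 0"
  proof (rule integral_pd_zero)
    show "has_pd i (\<lambda>x. q x * f x) (\<lambda>x. q x * partial i f x + partial i q x * f x)"
      using q f by (intro has_pd_mult[OF smooth_has_pd smooth_has_pd]) (auto simp: slowly_growing_def schwartz_def)
    show "continuous_on UNIV (\<lambda>x. q x * f x)"
      by (intro continuous_on_mult schwartz_cont[OF f] slowly_growing_cont[OF q])
    show "rdecay (\<lambda>x. q x * f x)"
      by (intro rdecay_mult slowly_growing_pgrow[OF q] schwartz_rdecay[OF f])
    show "continuous_on UNIV (\<lambda>x. q x * partial i f x + partial i q x * f x)"
      by (intro continuous_on_add continuous_on_mult schwartz_cont[OF f] slowly_growing_cont[OF q]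
          schwartz_cont[OF schwartz_partial[OF f]] slowly_growing_cont[OF slowly_growing_partial[OF q]])
    show "rdecay (\<lambda>x. q x * partial i f x + partial i q x * f x)"
      by (intro rdecay_add rdecay_mult slowly_growing_pgrow[OF q] schwartz_rdecay[OF f]
          schwartz_rdecay[OF schwartz_partial[OF f]] slowly_growing_pgrow[OF slowly_growing_partial[OF q]])
  qed
  then show ?thesis
    using i1 i2 by (simp add: add_eq_0_iff)
qed

text \<open>The list is reversed because the outermost derivative of f is moved first and thus
  becomes the innermost one on q.\<close>

lemma integral_by_parts_pderivs:
  assumes "slowly_growing q" "schwartz f"
  shows "(\<integral>x. q x * pderivs l f x \<partial>lborel) = (-1) ^ length l * (\<integral>x. pderivs (rev l) q x * f x \<partial>lborel)"
  using assms
proof (induction l arbitrary: q)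
  case (Cons i l)
  have "(\<integral>x. q x * pderivs (i # l) f x \<partial>lborel) = - (\<integral>x. partial i q x * pderivs l f x \<partial>lborel)"
    by (simp add: integral_by_parts_partial Cons.prems schwartz_pderivs)
  also have "\<dots> = - ((-1) ^ length l * (\<integral>x. pderivs (rev l) (partial i q) x * f x \<partial>lborel))"
    by (subst Cons.IH) (auto intro: slowly_growing_partial Cons.prems)
  finally show ?case by (simp add: pderivs_snoc)
qed simp

section \<open>The Fourier transform\<close>

text \<open>Unnormalised and with positive sign. Only the exchange of differentiation and
  multiplication matters; the resulting constant reappears as the mass \<open>kappa\<close> of the
  kernel and is divided out.\<close>

definition fourier :: "(real^'n::finite \<Rightarrow> complex) \<Rightarrow> real^'n \<Rightarrow> complex" where
  "fourier f x = (\<integral>\<xi>. cis (x \<bullet> \<xi>) * f \<xi> \<partial>lborel)"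

lemma has_pd_cis: "has_pd i (\<lambda>\<xi>. cis (x \<bullet> \<xi>)) (\<lambda>\<xi>. (\<i> * of_real (x $ i)) * cis (x \<bullet> \<xi>))"
  unfolding has_pd_def
proof
  fix \<xi>
  have "((\<lambda>t. cis (x \<bullet> \<xi> + t * x $ i)) has_vector_derivative (x $ i) *\<^sub>R (\<i> * cis (x \<bullet> \<xi> + 0 * x $ i))) (at 0)"
    unfolding cis_conv_exp
    by (auto intro!: derivative_eq_intros has_vector_derivative_real_field simp: scaleR_conv_of_real)
  then show "((\<lambda>t. cis (x \<bullet> (\<xi> + t *\<^sub>R axis i 1))) has_vector_derivative \<i> * of_real (x $ i) * cis (x \<bullet> \<xi>)) (at 0)"
    by (simp add: inner_add_right inner_axis scaleR_conv_of_real[of _ "_::complex"] mult_ac)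
qed

lemma continuous_cis_inner: "continuous_on UNIV (\<lambda>\<xi>. cis (x \<bullet> \<xi>))"
  unfolding cis_conv_exp by (intro continuous_intros)

lemma slowly_growing_cis: "slowly_growing (\<lambda>\<xi>. cis (x \<bullet> \<xi>))"
proof (rule slowly_growing_coinduct[of _ "{(\<lambda>\<xi>. c * cis (x \<bullet> \<xi>)) |c. True}"])
  have "(\<lambda>\<xi>. cis (x \<bullet> \<xi>)) = (\<lambda>\<xi>. 1 * cis (x \<bullet> \<xi>))" by simp
  then show "(\<lambda>\<xi>. cis (x \<bullet> \<xi>)) \<in> {(\<lambda>\<xi>. c * cis (x \<bullet> \<xi>)) |c. True}" by blast
next
  fix f assume "f \<in> {(\<lambda>\<xi>. c * cis (x \<bullet> \<xi>)) |c. True}"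
  then obtain c where f: "f = (\<lambda>\<xi>. c * cis (x \<bullet> \<xi>))" by blast
  show "continuous_on UNIV f" unfolding f
    by (intro continuous_on_mult continuous_cis_inner continuous_intros)
  show "pgrow f" by (rule pgrow_bound[OF pgrow_const[of c]]) (simp add: f norm_mult)
  fix i
  have "has_pd i f (\<lambda>\<xi>. (c * (\<i> * of_real (x $ i))) * cis (x \<bullet> \<xi>))"
    using has_pd_cmult[OF has_pd_cis] by (simp add: f mult.assoc)
  then show "\<exists>f'\<in>{(\<lambda>\<xi>. c * cis (x \<bullet> \<xi>)) |c. True}. has_pd i f f'" by blast
qed

lemma pderivs_cis: "pderivs l (\<lambda>\<xi>. cis (x \<bullet> \<xi>)) = (\<lambda>\<xi>. (\<Prod>i\<leftarrow>l. \<i> * of_real (x $ i)) * cis (x \<bullet> \<xi>))"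
proof (induction l)
  case (Cons i l)
  show ?case
    using has_pd_partial[OF has_pd_cmult[OF has_pd_cis[of i x], of "\<Prod>i\<leftarrow>l. \<i> * of_real (x $ i)"]]
    by (simp add: Cons mult_ac)
qed simp

lemma integrable_cis_mult:
  assumes "schwartz f" shows "integrable lborel (\<lambda>\<xi>. cis (x \<bullet> \<xi>) * f \<xi>)"
  by (rule integrable_slow_schwartz[OF slowly_growing_cis assms])

lemma schwartz_coord_i: "schwartz f \<Longrightarrow> schwartz (\<lambda>\<xi>. \<i> * of_real (\<xi> $ i) * f \<xi>)"
  using schwartz_cmult[OF schwartz_coord[of f i], of \<i>] by (simp add: mult.assoc)

lemma fourier_add:
  assumes "schwartz f" "schwartz g"
  shows "fourier (\<lambda>\<xi>. f \<xi> + g \<xi>) x = fourier f x + fourier g x"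
  unfolding fourier_def by (simp add: distrib_left integrable_cis_mult assms)

lemma fourier_cmult: "fourier (\<lambda>\<xi>. c * f \<xi>) x = c * fourier f x"
  unfolding fourier_def by (simp add: mult.left_commute[of _ c])

lemma fourier_sum:
  assumes "\<And>k. k \<in> A \<Longrightarrow> schwartz (f k)"
  shows "fourier (\<lambda>\<xi>. \<Sum>k\<in>A. f k \<xi>) x = (\<Sum>k\<in>A. fourier (f k) x)"
  unfolding fourier_def sum_distrib_left
  by (rule Bochner_Integration.integral_sum) (rule integrable_cis_mult[OF assms])

lemma fourier_bound:
  assumes "schwartz f" shows "norm (fourier f x) \<le> (\<integral>\<xi>. norm (f \<xi>) \<partial>lborel)"
proof -
  have "norm (fourier f x) \<le> (\<integral>\<xi>. norm (cis (x \<bullet> \<xi>) * f \<xi>) \<partial>lborel)"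
    unfolding fourier_def by (rule integral_norm_bound)
  then show ?thesis by (simp add: norm_mult)
qed

lemma fourier_cont:
  assumes "schwartz f" shows "continuous_on UNIV (fourier f)"
  unfolding continuous_on_sequentially
proof (intro allI ballI impI, elim conjE)
  fix X :: "nat \<Rightarrow> real^'a" and x assume X: "X \<longlonglongrightarrow> x"
  show "(fourier f \<circ> X) \<longlonglongrightarrow> fourier f x"
    unfolding o_def fourier_def
  proof (rule integral_dominated_convergence[where w = "\<lambda>\<xi>. norm (f \<xi>)"])
    show "integrable lborel (\<lambda>\<xi>. norm (f \<xi>))" by (intro integrable_norm schwartz_integrable assms)
    show "(\<lambda>\<xi>. cis (y \<bullet> \<xi>) * f \<xi>) \<in> borel_measurable lborel" for y
      using integrable_cis_mult[OF assms, of y] by auto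
    then show "(\<lambda>\<xi>. cis (X n \<bullet> \<xi>) * f \<xi>) \<in> borel_measurable lborel" for n .
    show "AE \<xi> in lborel. (\<lambda>n. cis (X n \<bullet> \<xi>) * f \<xi>) \<longlonglongrightarrow> cis (x \<bullet> \<xi>) * f \<xi>"
      unfolding cis_conv_exp by (intro AE_I2 tendsto_intros X)
  qed (simp_all add: norm_mult)
qed

lemma fourier_has_pd:
  assumes "schwartz f"
  shows "has_pd i (fourier f) (fourier (\<lambda>\<xi>. \<i> * of_real (\<xi> $ i) * f \<xi>))"
  unfolding has_pd_def
proof
  fix x
  have 1: "((\<lambda>t. \<integral>\<xi>. cis ((x + t *\<^sub>R axis i 1) \<bullet> \<xi>) * f \<xi> \<partial>lborel) has_vector_derivative
    (\<integral>\<xi>. (\<i> * of_real (\<xi> $ i) * cis (\<xi> \<bullet> (x + 0 *\<^sub>R axis i 1))) * f \<xi> \<partial>lborel)) (at 0)"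
  proof (rule has_vector_derivative_integral[where w = "\<lambda>\<xi>. norm (\<i> * of_real (\<xi> $ i) * f \<xi>)"])
    fix t \<xi>
    have "((\<lambda>t. cis (\<xi> \<bullet> (x + t *\<^sub>R axis i 1)) * f \<xi>) has_vector_derivative
       (\<i> * of_real (\<xi> $ i) * cis (\<xi> \<bullet> (x + t *\<^sub>R axis i 1))) * f \<xi>) (at t)"
      by (rule has_vector_derivative_mult_left[OF has_pd_at[OF has_pd_cis]])
    then show "((\<lambda>t. cis ((x + t *\<^sub>R axis i 1) \<bullet> \<xi>) * f \<xi>) has_vector_derivative
       (\<i> * of_real (\<xi> $ i) * cis (\<xi> \<bullet> (x + t *\<^sub>R axis i 1))) * f \<xi>) (at t)"
      by (simp add: inner_commute)
  next
    show "integrable lborel (\<lambda>\<xi>. cis ((x + t *\<^sub>R axis i 1) \<bullet> \<xi>) * f \<xi>)" for t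
      by (rule integrable_cis_mult[OF assms])
    show "integrable lborel (\<lambda>\<xi>. norm (\<i> * of_real (\<xi> $ i) * f \<xi>))"
      by (intro integrable_norm schwartz_integrable schwartz_coord_i assms)
    have "(\<lambda>\<xi>. cis (x \<bullet> \<xi>) * (\<i> * of_real (\<xi> $ i) * f \<xi>)) \<in> borel_measurable lborel"
      using integrable_cis_mult[OF schwartz_coord_i[OF assms], of x i] by auto
    then show "(\<lambda>\<xi>. (\<i> * of_real (\<xi> $ i) * cis (\<xi> \<bullet> (x + 0 *\<^sub>R axis i 1))) * f \<xi>) \<in> borel_measurable lborel"
      by (simp add: mult_ac inner_commute)
  qed (simp add: norm_mult)
  have "(\<integral>\<xi>. (\<i> * of_real (\<xi> $ i) * cis (\<xi> \<bullet> (x + 0 *\<^sub>R axis i 1))) * f \<xi> \<partial>lborel) = fourier (\<lambda>\<xi>. \<i> * of_real (\<xi> $ i) * f \<xi>) x"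
    unfolding fourier_def by (simp add: mult_ac inner_commute)
  with 1 show "((\<lambda>t. fourier f (x + t *\<^sub>R axis i 1)) has_vector_derivative fourier (\<lambda>\<xi>. \<i> * of_real (\<xi> $ i) * f \<xi>) x) (at 0)"
    unfolding fourier_def[of f] by simp
qed

lemma fourier_partial:
  assumes "schwartz f"
  shows "fourier (partial i f) x = - (\<i> * of_real (x $ i)) * fourier f x"
proof -
  have "fourier (partial i f) x = - (\<integral>\<xi>. partial i (\<lambda>\<xi>. cis (x \<bullet> \<xi>)) \<xi> * f \<xi> \<partial>lborel)"
    unfolding fourier_def by (rule integral_by_parts_partial[OF slowly_growing_cis assms])
  then show ?thesis
    unfolding has_pd_partial[OF has_pd_cis] fourier_def by (simp add: mult.assoc)
qed

text \<open>Each further power of the weight costs one derivative of f: |x| is at most the sum of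
  the |x_i|, and |x_i| times the transform is the modulus of the transform of
  \<open>partial i f\<close>.\<close>

lemma fourier_rdecay:
  assumes "schwartz f" shows "rdecay (fourier f)"
  unfolding rdecay_def
proof
  fix p
  show "\<exists>C. \<forall>x. norm (fourier f x) * (1 + norm x) ^ p \<le> C"
    using assms
  proof (induction p arbitrary: f)
    case 0
    then show ?case using fourier_bound[OF 0] by auto
  next
    case (Suc p)
    obtain C where C: "\<And>x. norm (fourier f x) * (1 + norm x) ^ p \<le> C"
      using Suc.IH[OF Suc.prems] by blast
    have "\<forall>i. \<exists>C. \<forall>x. norm (fourier (partial i f) x) * (1 + norm x) ^ p \<le> C"
      using Suc.IH[OF schwartz_partial[OF Suc.prems]] by blast
    then obtain D where D: "\<And>i x. norm (fourier (partial i f) x) * (1 + norm x) ^ p \<le> D i"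
      by metis
    have "norm (fourier f x) * (1 + norm x) ^ Suc p \<le> C + (\<Sum>i\<in>UNIV. D i)" for x
    proof -
      have "norm x \<le> (\<Sum>i\<in>UNIV. \<bar>x $ i\<bar>)" by (rule norm_le_l1_cart)
      then have "(norm (fourier f x) * (1 + norm x) ^ p) * (1 + norm x)
          \<le> (norm (fourier f x) * (1 + norm x) ^ p) * (1 + (\<Sum>i\<in>UNIV. \<bar>x $ i\<bar>))"
        by (intro mult_left_mono) auto
      also have "\<dots> = norm (fourier f x) * (1 + norm x) ^ p +
          (\<Sum>i\<in>UNIV. norm (fourier (partial i f) x) * (1 + norm x) ^ p)"
        by (simp add: fourier_partial[OF Suc.prems] norm_mult algebra_simps sum_distrib_left sum_distrib_right)
      also have "\<dots> \<le> C + (\<Sum>i\<in>UNIV. D i)"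
        by (intro add_mono C sum_mono D)
      finally show ?thesis by (simp add: mult_ac)
    qed
    then show ?case by blast
  qed
qed

lemma schwartz_fourier:
  assumes "schwartz f" shows "schwartz (fourier f)"
proof (rule schwartz_coinduct[of _ "{fourier f |f. schwartz f}"])
  show "fourier f \<in> {fourier f |f. schwartz f}" using assms by blast
next
  fix h :: "real^'a \<Rightarrow> complex" assume "h \<in> {fourier f |f. schwartz f}"
  then obtain f where f: "h = fourier f" "schwartz f" by blast
  show "continuous_on UNIV h" "rdecay h" using f fourier_cont fourier_rdecay by auto
  show "\<exists>h'\<in>{fourier f |f. schwartz f}. has_pd i h h'" for i
    using fourier_has_pd[OF f(2)] schwartz_coord_i[OF f(2)] f(1) by blast
qed

lemma schwartz_coords:
  assumes "schwartz f"
  shows "schwartz (\<lambda>\<xi>. (\<Prod>i\<leftarrow>l. \<i> * of_real (\<xi> $ i)) * f \<xi>)"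
  by (induction l) (use assms in \<open>auto simp: mult.assoc dest: schwartz_coord_i\<close>)

lemma fourier_pderivs:
  assumes "schwartz f"
  shows "pderivs l (fourier f) = fourier (\<lambda>\<xi>. (\<Prod>i\<leftarrow>l. \<i> * of_real (\<xi> $ i)) * f \<xi>)"
proof (induction l)
  case (Cons i l)
  show ?case
    using has_pd_partial[OF fourier_has_pd[OF schwartz_coords[OF assms, of l], of i]]
    by (simp add: Cons mult.assoc)
qed simp

section \<open>Polynomials and composed functions\<close>

inductive_set cpoly :: "(real^'n::finite \<Rightarrow> complex) set" where
  const: "(\<lambda>x. c) \<in> cpoly"
| coord: "(\<lambda>x. of_real (x $ i)) \<in> cpoly"
| add: "f \<in> cpoly \<Longrightarrow> g \<in> cpoly \<Longrightarrow> (\<lambda>x. f x + g x) \<in> cpoly"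
| mult: "f \<in> cpoly \<Longrightarrow> g \<in> cpoly \<Longrightarrow> (\<lambda>x. f x * g x) \<in> cpoly"

lemma cpoly_cont: "f \<in> cpoly \<Longrightarrow> continuous_on UNIV f"
  by (induction rule: cpoly.induct) (auto intro!: continuous_intros)

lemma cpoly_pgrow: "f \<in> cpoly \<Longrightarrow> pgrow f"
  by (induction rule: cpoly.induct) (auto intro: pgrow_const pgrow_coord pgrow_add pgrow_mult)

lemma cpoly_has_pd: "f \<in> cpoly \<Longrightarrow> \<exists>f'\<in>cpoly. has_pd i f f'"
proof (induction rule: cpoly.induct)
  case (const c)
  show ?case using has_pd_const[of i c] cpoly.const[of 0] by blast
next
  case (coord j)
  show ?case using has_pd_coord[of i j] cpoly.const[of "if i = j then 1 else 0"] by blast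
next
  case (add f g)
  then obtain f' g' where "f' \<in> cpoly" "has_pd i f f'" "g' \<in> cpoly" "has_pd i g g'" by blast
  then show ?case by (intro bexI[of _ "\<lambda>x. f' x + g' x"] has_pd_add cpoly.add)
next
  case (mult f g)
  then obtain f' g' where h: "f' \<in> cpoly" "has_pd i f f'" "g' \<in> cpoly" "has_pd i g g'" by blast
  have "(\<lambda>x. f x * g' x + f' x * g x) \<in> cpoly" by (intro cpoly.add cpoly.mult h mult)
  with has_pd_mult[OF h(2,4)] show ?case by (rule bexI)
qed

lemma cpoly_slowly_growing: "f \<in> cpoly \<Longrightarrow> slowly_growing f"
  by (rule slowly_growing_coinduct[of f cpoly]) (auto intro: cpoly_cont cpoly_pgrow cpoly_has_pd)

lemma cpoly_sum: "(\<And>k. k \<in> A \<Longrightarrow> f k \<in> cpoly) \<Longrightarrow> (\<lambda>x. \<Sum>k\<in>A. f k x) \<in> cpoly"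
  by (induction A rule: infinite_finite_induct) (auto intro: cpoly.intros)

lemma cpoly_cnj: "f \<in> cpoly \<Longrightarrow> (\<lambda>x. cnj (f x)) \<in> cpoly"
  by (induction rule: cpoly.induct) (auto intro: cpoly.intros)

lemma cpoly_power: "f \<in> cpoly \<Longrightarrow> (\<lambda>x. f x ^ k) \<in> cpoly"
  by (induction k) (auto intro: cpoly.intros)

text \<open>\<theta> is meant to be a sequence in which each member is the derivative of the
  preceding one. Sums of polynomials times \<theta> j (M x) are then stable under differentiation.
  The instances are exponentials, the flat functions of the bump, and time integrals of
  exponentials.\<close>

inductive_set comp_span :: "(nat \<Rightarrow> real \<Rightarrow> real) \<Rightarrow> (real^'n::finite \<Rightarrow> real) \<Rightarrow> (real^'n \<Rightarrow> complex) set"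
  for \<theta> M where
  base: "q \<in> cpoly \<Longrightarrow> (\<lambda>x. q x * of_real (\<theta> j (M x))) \<in> comp_span \<theta> M"
| add: "f \<in> comp_span \<theta> M \<Longrightarrow> g \<in> comp_span \<theta> M \<Longrightarrow> (\<lambda>x. f x + g x) \<in> comp_span \<theta> M"

lemma has_pd_comp:
  assumes M: "has_pd i (\<lambda>x. of_real (M x)) M'" and \<theta>: "\<And>t. (\<theta> has_real_derivative \<theta>' t) (at t)"
  shows "has_pd i (\<lambda>x. of_real (\<theta> (M x))) (\<lambda>x. M' x * of_real (\<theta>' (M x)))"
  unfolding has_pd_def
proof
  fix x
  have 1: "((\<lambda>t. of_real (M (x + t *\<^sub>R axis i 1))) has_vector_derivative M' x) (at 0)"
    using M by (simp add: has_pd_def)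
  have "((\<lambda>t. Re (of_real (M (x + t *\<^sub>R axis i 1)))) has_vector_derivative Re (M' x)) (at 0)"
    by (rule bounded_linear.has_vector_derivative[OF bounded_linear_Re 1])
  then have 2: "((\<lambda>t. M (x + t *\<^sub>R axis i 1)) has_real_derivative Re (M' x)) (at 0)"
    by (simp add: has_real_derivative_iff_has_vector_derivative)
  have "((\<lambda>t. complex_of_real (M (x + t *\<^sub>R axis i 1))) has_vector_derivative of_real (Re (M' x))) (at 0)"
    by (rule has_vector_derivative_of_real[OF 2])
  \<comment> \<open>M' is typed as complex, but as the derivative of a real function it has real
    values, so nothing is lost by the passage to the real part.\<close>
  from vector_derivative_unique_at[OF this 1] have re: "of_real (Re (M' x)) = M' x" .
  have "((\<lambda>t. \<theta> (M (x + t *\<^sub>R axis i 1))) has_real_derivative \<theta>' (M (x + 0 *\<^sub>R axis i 1)) * Re (M' x)) (at 0)"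
    by (rule DERIV_chain2[OF \<theta> 2])
  then have "((\<lambda>t. complex_of_real (\<theta> (M (x + t *\<^sub>R axis i 1)))) has_vector_derivative of_real (\<theta>' (M (x + 0 *\<^sub>R axis i 1)) * Re (M' x))) (at 0)"
    by (rule has_vector_derivative_of_real)
  then show "((\<lambda>t. complex_of_real (\<theta> (M (x + t *\<^sub>R axis i 1)))) has_vector_derivative M' x * of_real (\<theta>' (M x))) (at 0)"
    by (simp add: re mult.commute)
qed

lemma comp_span_has_pd:
  assumes M: "(\<lambda>x. of_real (M x)) \<in> cpoly"
    and \<theta>: "\<And>j t. (\<theta> j has_real_derivative \<theta> (Suc j) t) (at t)"
    and f: "f \<in> comp_span \<theta> M"
  shows "\<exists>f'\<in>comp_span \<theta> M. has_pd i f f'"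
  using f
proof induction
  case (base q j)
  obtain q' where q': "q' \<in> cpoly" "has_pd i q q'" using cpoly_has_pd[OF base] by blast
  obtain M' where M': "M' \<in> cpoly" "has_pd i (\<lambda>x. of_real (M x)) M'" using cpoly_has_pd[OF M] by blast
  have "has_pd i (\<lambda>x. q x * of_real (\<theta> j (M x))) (\<lambda>x. q x * (M' x * of_real (\<theta> (Suc j) (M x))) + q' x * of_real (\<theta> j (M x)))"
    by (rule has_pd_mult[OF q'(2) has_pd_comp[OF M'(2) \<theta>]])
  moreover have "(\<lambda>x. (q x * M' x) * of_real (\<theta> (Suc j) (M x)) + q' x * of_real (\<theta> j (M x))) \<in> comp_span \<theta> M"
    by (rule comp_span.add[OF comp_span.base[OF cpoly.mult[OF base M'(1)]] comp_span.base[OF q'(1)]])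
  ultimately show ?case by (intro bexI) (simp_all add: mult.assoc)
next
  case (add f g)
  then obtain f' g' where "f' \<in> comp_span \<theta> M" "has_pd i f f'" "g' \<in> comp_span \<theta> M" "has_pd i g g'" by blast
  then show ?case by (intro bexI[of _ "\<lambda>x. f' x + g' x"] has_pd_add comp_span.add)
qed

lemma comp_span_cont:
  assumes M: "(\<lambda>x. of_real (M x)) \<in> cpoly"
    and \<theta>: "\<And>j t. (\<theta> j has_real_derivative \<theta> (Suc j) t) (at t)"
    and f: "f \<in> comp_span \<theta> M"
  shows "continuous_on UNIV f"
  using f
proof induction
  case (base q j)
  have "continuous_on UNIV (\<lambda>x. Re (of_real (M x)))" by (intro continuous_on_Re cpoly_cont[OF M])
  then have "continuous_on UNIV M" by simp
  moreover have "continuous_on UNIV (\<theta> j)" using \<theta> by (intro DERIV_continuous_on) auto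
  ultimately have "continuous_on UNIV (\<lambda>x. \<theta> j (M x))"
    using continuous_on_compose2[of UNIV "\<theta> j" UNIV M] by auto
  then show ?case by (intro continuous_on_mult cpoly_cont[OF base] continuous_on_of_real)
qed (intro continuous_on_add)

lemma smooth_comp:
  assumes "(\<lambda>x. of_real (M x)) \<in> cpoly" "\<And>j t. (\<theta> j has_real_derivative \<theta> (Suc j) t) (at t)" "q \<in> cpoly"
  shows "smooth (\<lambda>x. q x * of_real (\<theta> 0 (M x)))"
  by (rule smooth_coinduct(1)[of _ "comp_span \<theta> M"])
    (auto intro: comp_span.base[OF assms(3)] comp_span_cont[of M \<theta>, OF assms(1,2)] comp_span_has_pd[of M \<theta>, OF assms(1,2)])

lemma schwartz_comp:
  assumes "(\<lambda>x. of_real (M x)) \<in> cpoly" "\<And>j t. (\<theta> j has_real_derivative \<theta> (Suc j) t) (at t)" "q \<in> cpoly"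
    and rd: "\<And>j. rdecay (\<lambda>x. \<theta> j (M x))"
  shows "schwartz (\<lambda>x. q x * of_real (\<theta> 0 (M x)))"
proof (rule schwartz_coinduct[of _ "comp_span \<theta> M"])
  fix f assume "f \<in> comp_span \<theta> M"
  then show "rdecay f"
  proof induction
    case (base q j)
    have "rdecay (\<lambda>x. complex_of_real (\<theta> j (M x)))" by (rule rdecay_bound[OF rd[of j]]) simp
    then show ?case by (rule rdecay_mult[OF cpoly_pgrow[OF base]])
  qed (rule rdecay_add)
qed (auto intro: comp_span.base[OF assms(3)] comp_span_cont[of M \<theta>, OF assms(1,2)] comp_span_has_pd[of M \<theta>, OF assms(1,2)])

section \<open>A bump function\<close>

text \<open>The classical function exp (- 1 / t), extended by 0, with a polynomial factor in 1 / t
  that keeps the class stable under differentiation.\<close>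

definition flat :: "real poly \<Rightarrow> real \<Rightarrow> real" where
  "flat p t = (if t > 0 then poly p (1 / t) * exp (- (1 / t)) else 0)"

lemma poly_times_exp_tendsto_0: "((\<lambda>x::real. poly p x * exp (- x)) \<longlongrightarrow> 0) at_top"
proof -
  have "((\<lambda>x::real. \<Sum>i\<le>degree p. coeff p i * (x ^ i / exp x)) \<longlongrightarrow> (\<Sum>i\<le>degree p. coeff p i * 0)) at_top"
    by (intro tendsto_intros tendsto_power_div_exp_0)
  then show ?thesis
    by (simp add: poly_altdef exp_minus divide_inverse sum_distrib_right mult.assoc)
qed

text \<open>With x = 1 / t one has dx/dt = - x^2, so p(x) exp (- x) has the t-derivative x^2 (p(x) -
  p'(x)) exp (- x); this explains the new polynomial.\<close>

lemma flat_has_derivative: "(flat p has_real_derivative flat (monom 1 2 * (p - pderiv p)) t) (at t)"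
proof -
  consider "t > 0" | "t < 0" | "t = 0" by linarith
  then show ?thesis
  proof cases
    case 1
    have "((\<lambda>t. poly p (1 / t) * exp (- (1 / t))) has_real_derivative flat (monom 1 2 * (p - pderiv p)) t) (at t)"
      using 1 by (auto intro!: derivative_eq_intros DERIV_chain2[OF poly_DERIV] simp: flat_def poly_monom field_simps power2_eq_square)
    then show ?thesis
      by (rule has_field_derivative_transform_within_open[where S = "{0<..}"]) (use 1 in \<open>auto simp: flat_def\<close>)
  next
    case 2
    have "((\<lambda>t. 0) has_real_derivative flat (monom 1 2 * (p - pderiv p)) t) (at t)"
      using 2 by (simp add: flat_def)
    then show ?thesis
      by (rule has_field_derivative_transform_within_open[where S = "{..<0}"]) (use 2 in \<open>auto simp: flat_def\<close>)
  next
    case 3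
    \<comment> \<open>Division by h only multiplies p by one more power of 1 / h, and the
      exponential still wins.\<close>
    have r: "((\<lambda>h. flat p h / h) \<longlongrightarrow> 0) (at_right 0)"
    proof (rule Lim_transform_eventually)
      show "((\<lambda>h. poly (pCons 0 p) (inverse h) * exp (- inverse h)) \<longlongrightarrow> 0) (at_right 0)"
        by (rule filterlim_compose[OF poly_times_exp_tendsto_0 filterlim_inverse_at_top_right])
      show "\<forall>\<^sub>F h in at_right 0. poly (pCons 0 p) (inverse h) * exp (- inverse h) = flat p h / h"
        unfolding eventually_at_right_field by (auto simp: flat_def divide_inverse intro!: exI[of _ 1])
    qed
    have l: "((\<lambda>h. flat p h / h) \<longlongrightarrow> 0) (at_left 0)"
    proof (rule Lim_transform_eventually[OF tendsto_const])
      show "\<forall>\<^sub>F h in at_left 0. 0 = flat p h / h"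
        unfolding eventually_at_left_field by (auto simp: flat_def intro!: exI[of _ "-1"])
    qed
    have "((\<lambda>h. flat p h / h) \<longlongrightarrow> 0) (at 0)"
      using l r by (simp add: filterlim_split_at)
    then show ?thesis
      using 3 by (simp add: DERIV_def flat_def)
  qed
qed

fun flat_poly :: "nat \<Rightarrow> real poly" where
  "flat_poly 0 = 1"
| "flat_poly (Suc j) = monom 1 2 * (flat_poly j - pderiv (flat_poly j))"

text \<open>The factor exp 1 normalises the value at the origin to 1.\<close>

definition bump_real :: "real^'n::finite \<Rightarrow> real" where
  "bump_real x = exp 1 * flat 1 (1 - (norm x)\<^sup>2)"

lemma norm_sq_cpoly: "(\<lambda>x::real^'n::finite. complex_of_real (1 - (norm x)\<^sup>2)) \<in> cpoly"
proof -
  have "(\<lambda>x::real^'n. 1 + (-1) * (\<Sum>i\<in>UNIV. complex_of_real (x $ i) * complex_of_real (x $ i))) \<in> cpoly"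
    by (intro cpoly.add cpoly.mult cpoly.const cpoly.coord cpoly_sum)
  moreover have "(norm x)\<^sup>2 = (\<Sum>i\<in>UNIV. x $ i * x $ i)" for x :: "real^'n"
    by (simp add: power2_norm_eq_inner inner_vec_def)
  ultimately show ?thesis by simp
qed

lemma smooth_bump: "smooth (\<lambda>x::real^'n::finite. complex_of_real (bump_real x))"
proof -
  have "smooth (\<lambda>x::real^'n. complex_of_real (exp 1) * complex_of_real (flat (flat_poly 0) (1 - (norm x)\<^sup>2)))"
    by (rule smooth_comp[where \<theta> = "\<lambda>j. flat (flat_poly j)"])
      (use norm_sq_cpoly in \<open>auto intro: cpoly.const flat_has_derivative\<close>)
  then show ?thesis by (simp add: bump_real_def)
qed

lemma bump_outside: "norm x \<ge> 1 \<Longrightarrow> bump_real x = 0"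
  using power_mono[of 1 "norm x" 2] by (simp add: bump_real_def flat_def not_less)

lemma bump_formula: "norm x < 1 \<Longrightarrow> bump_real x = exp (1 - 1 / (1 - (norm x)\<^sup>2))"
  by (simp add: bump_real_def flat_def exp_add[symmetric] abs_square_less_1)

lemma bump_pos: "norm x < 1 \<Longrightarrow> bump_real x > 0"
  by (simp add: bump_formula)

lemma bump_nonneg: "bump_real x \<ge> 0"
  by (simp add: bump_real_def flat_def)

lemma bump_le_1: "bump_real x \<le> 1"
proof (cases "norm x < 1")
  case True
  then have "1 \<le> 1 / (1 - (norm x)\<^sup>2)" by (simp add: abs_square_less_1)
  then show ?thesis by (simp add: bump_formula[OF True])
qed (simp add: bump_outside)

text \<open>A linear bound valid everywhere: for norm x at least 1 / 2 it is trivial, as the bump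
  has values between 0 and 1. Applied to x / \<mu> it makes the complement of a wide cutoff small,
  at the price of one power of |x|.\<close>

lemma bump_near_1: "\<bar>1 - bump_real x\<bar> \<le> 2 * norm x"
proof (cases "norm x < 1 / 2")
  case True
  define q where "q = (norm x)\<^sup>2"
  have q: "0 \<le> q" "q \<le> norm x / 2" "q \<le> 1 / 4"
  proof -
    show "q \<le> norm x / 2" unfolding q_def power2_eq_square
      using mult_left_mono[of "norm x" "1/2" "norm x"] True by simp
    then show "q \<le> 1 / 4" using True by simp
  qed (simp add: q_def)
  have "1 + (1 - 1 / (1 - q)) \<le> exp (1 - 1 / (1 - q))" by (rule exp_ge_add_one_self)
  moreover have "1 / (1 - q) \<le> 1 + 2 * q"
  proof -
    have "1 \<le> (1 + 2 * q) * (1 - q)" using q(1,3) mult_left_mono[OF q(3) q(1)] by (simp add: algebra_simps)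
    then show ?thesis using q(3) by (simp add: pos_divide_le_eq)
  qed
  ultimately have "1 - bump_real x \<le> 2 * q" using True by (simp add: bump_formula q_def)
  then show ?thesis using bump_le_1[of x] q(2) by simp
next
  case False
  then show ?thesis using bump_nonneg[of x] bump_le_1[of x] by simp
qed

section \<open>Heat multipliers\<close>

lemma power_le_exp:
  fixes c x :: real
  assumes "c > 0"
  obtains C where "C \<ge> 0" "\<And>x. x \<ge> 0 \<Longrightarrow> (1 + x) ^ n * exp (- (c * x)) \<le> C"
proof
  \<comment> \<open>One factor exp (k (1 + x)) is spent on each of the n powers; the successor
    avoids a division by zero for n = 0.\<close>
  define k where "k = c / real (Suc n)"
  have k: "k > 0" using assms by (simp add: k_def)
  show "(1 / k) ^ n * exp c \<ge> 0" using k by simp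
  fix x :: real assume x: "x \<ge> 0"
  have "(k * (1 + x)) ^ n \<le> exp (k * (1 + x)) ^ n"
    using x k order_trans[OF _ exp_ge_add_one_self[of "k * (1 + x)"]] by (intro power_mono) auto
  also have "\<dots> = exp (real n * (k * (1 + x)))" by (simp add: exp_of_nat_mult)
  also have "\<dots> \<le> exp (real (Suc n) * (k * (1 + x)))"
    using x k by (subst exp_le_cancel_iff, intro mult_right_mono) auto
  also have "real (Suc n) * (k * (1 + x)) = c * (1 + x)" by (simp add: k_def)
  also have "exp (c * (1 + x)) = exp c * exp (c * x)" by (simp add: exp_add[symmetric] distrib_left)
  finally have "k ^ n * (1 + x) ^ n \<le> exp c * exp (c * x)"
    by (simp only: power_mult_distrib)
  then have "(1 + x) ^ n \<le> (1 / k) ^ n * exp c * exp (c * x)"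
    using k by (simp add: power_one_over field_simps)
  then show "(1 + x) ^ n * exp (- (c * x)) \<le> (1 / k) ^ n * exp c"
    by (simp add: exp_minus field_simps)
qed

text \<open>Growth at least like a power of |x|, written inversely so that exponential decay in M
  becomes rapid decay in x by mere substitution.\<close>

definition coercive :: "(real^'n::finite \<Rightarrow> real) \<Rightarrow> bool" where
  "coercive M \<longleftrightarrow> (\<forall>x. M x \<ge> 0) \<and> (\<exists>C k. \<forall>x. 1 + norm x \<le> C * (1 + M x) ^ k)"

lemma rdecay_coercive:
  assumes M: "coercive M" and c: "c > 0" and \<theta>: "\<And>r. r \<ge> 0 \<Longrightarrow> \<bar>\<theta> r\<bar> \<le> D * exp (- (c * r))"
  shows "rdecay (\<lambda>x. \<theta> (M x) :: real)"
  unfolding rdecay_def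
proof
  fix p
  obtain C k where C: "\<And>x. 1 + norm x \<le> C * (1 + M x) ^ k" and M0: "\<And>x. M x \<ge> 0"
    using M by (auto simp: coercive_def)
  obtain E where E: "E \<ge> 0" "\<And>r. r \<ge> 0 \<Longrightarrow> (1 + r) ^ (k * p) * exp (- (c * r)) \<le> E"
    using power_le_exp[OF c] by metis
  have "norm (\<theta> (M x)) * (1 + norm x) ^ p \<le> \<bar>D\<bar> * \<bar>C\<bar> ^ p * E" for x
  proof -
    have "(1 + norm x) ^ p \<le> (\<bar>C\<bar> * (1 + M x) ^ k) ^ p"
      using order_trans[OF C[of x] mult_right_mono[OF abs_ge_self[of C], of "(1 + M x) ^ k"]] M0[of x]
      by (intro power_mono) auto
    moreover have "norm (\<theta> (M x)) \<le> \<bar>D\<bar> * exp (- (c * M x))"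
      using order_trans[OF \<theta>[OF M0, of x] mult_right_mono[OF abs_ge_self[of D], of "exp (- (c * M x))"]] by simp
    ultimately have "norm (\<theta> (M x)) * (1 + norm x) ^ p \<le> (\<bar>D\<bar> * exp (- (c * M x))) * (\<bar>C\<bar> * (1 + M x) ^ k) ^ p"
      by (intro mult_mono) auto
    also have "\<dots> = \<bar>D\<bar> * \<bar>C\<bar> ^ p * ((1 + M x) ^ (k * p) * exp (- (c * M x)))"
      by (simp add: power_mult_distrib power_mult)
    also have "\<dots> \<le> \<bar>D\<bar> * \<bar>C\<bar> ^ p * E" by (intro mult_left_mono E M0) auto
    finally show ?thesis .
  qed
  then show "\<exists>C. \<forall>x. norm (\<theta> (M x)) * (1 + norm x) ^ p \<le> C" by blast
qed

lemma schwartz_heat: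
  assumes "(\<lambda>x. of_real (M x)) \<in> cpoly" "coercive M" "t > 0" "q \<in> cpoly"
  shows "schwartz (\<lambda>x. q x * of_real (exp (- (t * M x))))"
proof -
  have "schwartz (\<lambda>x. q x * of_real ((\<lambda>j r. (- t) ^ j * exp (- (t * r))) 0 (M x)))"
  proof (rule schwartz_comp[OF assms(1) _ assms(4)])
    show "((\<lambda>r. (- t) ^ j * exp (- (t * r))) has_real_derivative (- t) ^ Suc j * exp (- (t * r))) (at r)" for j r
      by (auto intro!: derivative_eq_intros)
    show "rdecay (\<lambda>x. (- t) ^ j * exp (- (t * M x)))" for j
      by (rule rdecay_coercive[OF assms(2,3), where D = "t ^ j" and \<theta> = "\<lambda>r. (- t) ^ j * exp (- (t * r))"])
        (use assms(3) in \<open>simp add: abs_mult power_abs\<close>)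
  qed
  then show ?thesis by simp
qed

text \<open>The j-th derivative in r of the integral of exp (- t r) over [a, b]. For j = 0 it is the
  quotient (exp (- a r) - exp (- b r)) / r in a form without singularity at r = 0.\<close>

definition heat_integral :: "real \<Rightarrow> real \<Rightarrow> nat \<Rightarrow> real \<Rightarrow> real" where
  "heat_integral a b j r = integral {a..b} (\<lambda>t. (- t) ^ j * exp (- (t * r)))"

lemma heat_integral_deriv:
  "(heat_integral a b j has_real_derivative heat_integral a b (Suc j) r) (at r)"
proof -
  have "((\<lambda>r. integral (cbox a b) (\<lambda>t. (- t) ^ j * exp (- (t * r)))) has_real_derivative
      integral (cbox a b) (\<lambda>t. (- t) ^ Suc j * exp (- (t * r)))) (at r within UNIV)"
  proof (rule leibniz_rule_field_derivative)
    show "((\<lambda>r. (- t) ^ j * exp (- (t * r))) has_real_derivative (- t) ^ Suc j * exp (- (t * r))) (at r within UNIV)" for t r :: real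
      by (auto intro!: derivative_eq_intros)
    show "(\<lambda>t. (- t) ^ j * exp (- (t * r))) integrable_on cbox a b" for r
      by (intro integrable_continuous continuous_intros)
    show "continuous_on (UNIV \<times> cbox a b) (\<lambda>(r, t). (- t) ^ Suc j * exp (- (t * r)))"
      by (auto intro!: continuous_intros simp: split_beta)
  qed auto
  then show ?thesis by (simp add: heat_integral_def[abs_def])
qed

lemma heat_integral_bound:
  assumes "0 < a" "a \<le> b" "r \<ge> 0"
  shows "\<bar>heat_integral a b j r\<bar> \<le> b ^ j * (b - a) * exp (- (a * r))"
proof -
  have "norm (integral (cbox a b) (\<lambda>t. (- t) ^ j * exp (- (t * r)))) \<le> (b ^ j * exp (- (a * r))) * measure lborel (cbox a b)"
  proof (rule Henstock_Kurzweil_Integration.integrable_bound)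
    fix t assume t: "t \<in> cbox a b"
    then show "norm ((- t) ^ j * exp (- (t * r))) \<le> b ^ j * exp (- (a * r))"
      using assms by (auto simp: abs_mult power_abs intro!: mult_mono power_mono mult_right_mono)
  next
    show "(\<lambda>t. (- t) ^ j * exp (- (t * r))) integrable_on cbox a b"
      by (intro integrable_continuous continuous_intros)
  qed (use assms in auto)
  then show ?thesis using assms by (simp add: heat_integral_def mult_ac)
qed

lemma heat_integral_mult:
  assumes "a \<le> b"
  shows "r * heat_integral a b 0 r = exp (- (a * r)) - exp (- (b * r))"
proof -
  have "((\<lambda>t. r * exp (- (t * r))) has_integral (- exp (- (b * r)) - - exp (- (a * r)))) {a..b}"
    by (rule fundamental_theorem_of_calculus[OF assms])
      (auto intro!: derivative_eq_intros simp: has_real_derivative_iff_has_vector_derivative[symmetric])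
  from integral_unique[OF this] show ?thesis
    by (simp add: heat_integral_def)
qed

lemma schwartz_heat_integral:
  assumes "(\<lambda>x. of_real (M x)) \<in> cpoly" "coercive M" "0 < a" "a \<le> b" "q \<in> cpoly"
  shows "schwartz (\<lambda>x. q x * of_real (heat_integral a b 0 (M x)))"
proof (rule schwartz_comp[of M "heat_integral a b", OF assms(1) heat_integral_deriv assms(5)])
  show "rdecay (\<lambda>x. heat_integral a b j (M x))" for j
    by (rule rdecay_coercive[OF assms(2,3), where D = "b ^ j * (b - a)"]) (use assms in \<open>auto intro: heat_integral_bound\<close>)
qed

section \<open>Fourier inversion in weak form\<close>

lemma integral_pos_continuous:
  fixes g :: "real^'n::finite \<Rightarrow> real"
  assumes "continuous_on UNIV g" "integrable lborel g" "\<And>x. g x \<ge> 0" "g x0 > 0"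
  shows "(\<integral>x. g x \<partial>lborel) > 0"
proof -
  have "(\<integral>x. g x \<partial>lborel) \<noteq> 0"
  proof
    assume "(\<integral>x. g x \<partial>lborel) = 0"
    then have "AE x in lborel. g x = 0"
      using integral_nonneg_eq_0_iff_AE[OF assms(2)] assms(3) by auto
    then have "AE x in lebesgue. x \<in> {x. g x = 0}"
      by (simp add: AE_completion)
    moreover have "closed {x. g x = 0}"
      by (intro closed_Collect_eq assms continuous_intros)
    ultimately have "x0 \<in> {x. g x = 0}" by (intro mem_closed_if_AE_lebesgue)
    then show False using assms(4) by simp
  qed
  moreover have "(\<integral>x. g x \<partial>lborel) \<ge> 0" using assms(3) by simp
  ultimately show ?thesis by simp
qed

text \<open>Fubini for the symmetric kernel cis (c (x \<bullet> \<xi>)). The parameter c is used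
  with the values 1 and -1, so that the conjugate transform is covered as well.\<close>

lemma fourier_duality:
  fixes f h :: "real^'n::finite \<Rightarrow> complex" and c :: real
  assumes f: "schwartz f" and h: "schwartz h"
  shows "(\<integral>x. h x * (\<integral>\<xi>. cis (c * (x \<bullet> \<xi>)) * f \<xi> \<partial>lborel) \<partial>lborel)
    = (\<integral>\<xi>. f \<xi> * (\<integral>x. cis (c * (x \<bullet> \<xi>)) * h x \<partial>lborel) \<partial>lborel)"
proof -
  have [measurable]: "f \<in> borel_measurable borel" "h \<in> borel_measurable borel"
    using f h by (auto intro: borel_measurable_continuous_onI schwartz_cont)
  have int: "integrable (lborel \<Otimes>\<^sub>M lborel) (\<lambda>(x, \<xi>). cis (c * (x \<bullet> \<xi>)) * f \<xi> * h x)"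
  proof (rule lborel_pair.Fubini_integrable)
    show "(\<lambda>(x, \<xi>). cis (c * (x \<bullet> \<xi>)) * f \<xi> * h x) \<in> borel_measurable (lborel \<Otimes>\<^sub>M lborel)"
      unfolding cis_conv_exp by measurable
    have "integrable lborel (\<lambda>x. norm (h x) * (\<integral>\<xi>. norm (f \<xi>) \<partial>lborel))"
      by (intro integrable_mult_left integrable_norm schwartz_integrable h)
    then show "integrable lborel (\<lambda>x. \<integral>\<xi>. norm (case (x, \<xi>) of (x, \<xi>) \<Rightarrow> cis (c * (x \<bullet> \<xi>)) * f \<xi> * h x) \<partial>lborel)"
      by (simp add: norm_mult mult.commute)
    show "AE x in lborel. integrable lborel (\<lambda>\<xi>. case (x, \<xi>) of (x, \<xi>) \<Rightarrow> cis (c * (x \<bullet> \<xi>)) * f \<xi> * h x)"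
    proof (rule AE_I2)
      fix x
      show "integrable lborel (\<lambda>\<xi>. case (x, \<xi>) of (x, \<xi>) \<Rightarrow> cis (c * (x \<bullet> \<xi>)) * f \<xi> * h x)"
        using integrable_mult_left[OF integrable_cis_mult[OF f, of "c *\<^sub>R x"], of "h x"] by simp
    qed
  qed
  have "(\<integral>x. h x * (\<integral>\<xi>. cis (c * (x \<bullet> \<xi>)) * f \<xi> \<partial>lborel) \<partial>lborel)
      = (\<integral>x. (\<integral>\<xi>. cis (c * (x \<bullet> \<xi>)) * f \<xi> * h x \<partial>lborel) \<partial>lborel)"
    by (simp add: mult.commute)
  also have "\<dots> = (\<integral>\<xi>. (\<integral>x. cis (c * (x \<bullet> \<xi>)) * f \<xi> * h x \<partial>lborel) \<partial>lborel)"
    by (rule lborel_pair.Fubini_integral[symmetric, OF int])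
  also have "\<dots> = (\<integral>\<xi>. (\<integral>x. f \<xi> * (cis (c * (x \<bullet> \<xi>)) * h x) \<partial>lborel) \<partial>lborel)"
    by (simp add: mult_ac)
  finally show ?thesis by simp
qed

lemma inner_diag: "x \<bullet> diag_aff r 0 \<xi> = diag_aff r 0 x \<bullet> (\<xi>::real^'n::finite)"
  by (simp add: inner_vec_def diag_aff_def mult_ac)

lemma diag_aff_inverse: "(\<And>i. r i > 0) \<Longrightarrow> diag_aff r 0 (diag_aff (\<lambda>i. 1 / r i) 0 x) = x"
  by (simp add: diag_aff_def vec_eq_iff less_imp_neq[symmetric])

lemma fourier_diag:
  assumes r: "\<And>i. r i > 0" and f: "schwartz f"
  shows "fourier (\<lambda>\<xi>. f (diag_aff r 0 \<xi>)) x = of_real (1 / (\<Prod>i\<in>UNIV. r i)) * fourier f (diag_aff (\<lambda>i. 1 / r i) 0 x)"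
proof -
  have m: "(\<lambda>\<xi>. cis (diag_aff (\<lambda>i. 1 / r i) 0 x \<bullet> \<xi>) * f \<xi>) \<in> borel_measurable borel"
    using integrable_cis_mult[OF f, of "diag_aff (\<lambda>i. 1 / r i) 0 x"] by auto
  have "fourier (\<lambda>\<xi>. f (diag_aff r 0 \<xi>)) x = (\<integral>\<xi>. cis (diag_aff (\<lambda>i. 1 / r i) 0 x \<bullet> diag_aff r 0 \<xi>) * f (diag_aff r 0 \<xi>) \<partial>lborel)"
    unfolding fourier_def inner_diag diag_aff_inverse[OF r] ..
  also have "\<dots> = (1 / (\<Prod>i\<in>UNIV. r i)) *\<^sub>R fourier f (diag_aff (\<lambda>i. 1 / r i) 0 x)"
    unfolding fourier_def by (rule integral_diag_aff[OF r m])
  finally show ?thesis by (simp add: scaleR_conv_of_real)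
qed

lemma schwartz_diag:
  assumes r: "\<And>i. r i > 0" and f: "schwartz f"
  shows "schwartz (\<lambda>\<xi>. f (diag_aff r 0 \<xi>))"
proof -
  have dil: "\<exists>C>0. \<forall>x::real^'a. 1 + norm x \<le> C * (1 + norm (diag_aff r 0 x))"
  proof (intro exI conjI allI)
    let ?C = "1 + (\<Sum>i\<in>UNIV. 1 / r i)"
    have s: "(\<Sum>i\<in>UNIV. 1 / r i) \<ge> 0" using r by (intro sum_nonneg) (simp add: less_imp_le)
    then show "?C > 0" by simp
    fix x :: "real^'a"
    have "norm x \<le> (\<Sum>i\<in>UNIV. \<bar>x $ i\<bar>)" by (rule norm_le_l1_cart)
    also have "\<dots> \<le> (\<Sum>i\<in>UNIV. 1 / r i * norm (diag_aff r 0 x))"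
    proof (rule sum_mono)
      fix i
      have "r i * \<bar>x $ i\<bar> \<le> norm (diag_aff r 0 x)"
        using component_le_norm_cart[of "diag_aff r 0 x" i] r[of i] by (simp add: diag_aff_def abs_mult)
      then show "\<bar>x $ i\<bar> \<le> 1 / r i * norm (diag_aff r 0 x)"
        using r[of i] by (simp add: field_simps)
    qed
    finally have "norm x \<le> (\<Sum>i\<in>UNIV. 1 / r i) * norm (diag_aff r 0 x)" by (simp add: sum_distrib_right)
    then show "1 + norm x \<le> ?C * (1 + norm (diag_aff r 0 x))"
    proof -
      assume a: "norm x \<le> (\<Sum>i\<in>UNIV. 1 / r i) * norm (diag_aff r 0 x)"
      have "?C * (1 + norm (diag_aff r 0 x)) = 1 + (\<Sum>i\<in>UNIV. 1 / r i) + norm (diag_aff r 0 x)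
          + (\<Sum>i\<in>UNIV. 1 / r i) * norm (diag_aff r 0 x)"
        by (simp add: algebra_simps)
      with a s norm_ge_zero[of "diag_aff r 0 x"] show ?thesis by linarith
    qed
  qed
  then obtain C where C: "C > 0" "\<And>x::real^'a. 1 + norm x \<le> C * (1 + norm (diag_aff r 0 x))" by blast
  have rd: "rdecay (\<lambda>x. g (diag_aff r 0 x))" if g: "rdecay g" for g :: "real^'a \<Rightarrow> complex"
    unfolding rdecay_def
  proof
    fix p
    obtain D where D: "\<And>x. norm (g x) * (1 + norm x) ^ p \<le> D" using rdecayE[OF g] by metis
    have "norm (g (diag_aff r 0 x)) * (1 + norm x) ^ p \<le> C ^ p * D" for x
    proof -
      have "(1 + norm x) ^ p \<le> (C * (1 + norm (diag_aff r 0 x))) ^ p" by (intro power_mono C) simp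
      then have "norm (g (diag_aff r 0 x)) * (1 + norm x) ^ p \<le> norm (g (diag_aff r 0 x)) * (C * (1 + norm (diag_aff r 0 x))) ^ p"
        by (intro mult_left_mono) auto
      also have "\<dots> = C ^ p * (norm (g (diag_aff r 0 x)) * (1 + norm (diag_aff r 0 x)) ^ p)"
        by (simp add: power_mult_distrib)
      also have "\<dots> \<le> C ^ p * D" using C by (intro mult_left_mono D) auto
      finally show ?thesis .
    qed
    then show "\<exists>C. \<forall>x. norm (g (diag_aff r 0 x)) * (1 + norm x) ^ p \<le> C" by blast
  qed
  have "rdecay (pderivs l (\<lambda>\<xi>. f (diag_aff r 0 \<xi>)))" for l
    unfolding pderivs_diag_aff[OF schwartz_smooth[OF f]]
    using f by (intro rdecay_cmult rd) (simp add: schwartz_def)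
  then show ?thesis using f by (simp add: schwartz_def smooth_diag_aff)
qed

lemma integral_scale_limit:
  fixes f g :: "real^'n::finite \<Rightarrow> complex"
  assumes "schwartz f" "schwartz g"
  shows "(\<lambda>k. \<integral>x. f x * g (diag_aff (\<lambda>_. 1 / real (Suc k)) 0 x) \<partial>lborel) \<longlonglongrightarrow> (\<integral>x. f x * g 0 \<partial>lborel)"
proof -
  obtain C where C: "C \<ge> 0" "\<And>x. norm (g x) * (1 + norm x) ^ 0 \<le> C"
    using rdecayE[OF schwartz_rdecay[OF assms(2)]] by metis
  have [measurable]: "f \<in> borel_measurable borel" "g \<in> borel_measurable borel"
    using assms by (auto intro: borel_measurable_continuous_onI schwartz_cont)
  show ?thesis
  proof (rule integral_dominated_convergence[where w = "\<lambda>x. norm (f x) * C"])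
    show "integrable lborel (\<lambda>x. norm (f x) * C)"
      by (intro integrable_mult_left integrable_norm schwartz_integrable assms)
    show "AE x in lborel. (\<lambda>k. f x * g (diag_aff (\<lambda>_. 1 / real (Suc k)) 0 x)) \<longlonglongrightarrow> f x * g 0"
    proof (rule AE_I2)
      fix x :: "real^'n"
      have "(\<lambda>k. (1 / real (Suc k)) *\<^sub>R x) \<longlonglongrightarrow> 0 *\<^sub>R x"
        using tendsto_scaleR[OF LIMSEQ_inverse_real_of_nat tendsto_const, of x] by (simp add: divide_inverse)
      then have "(\<lambda>k. diag_aff (\<lambda>_. 1 / real (Suc k)) 0 x) \<longlonglongrightarrow> 0" by (simp add: diag_aff_scale)
      moreover have "isCont g 0" using schwartz_cont[OF assms(2)] by (simp add: continuous_on_eq_continuous_at)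
      ultimately show "(\<lambda>k. f x * g (diag_aff (\<lambda>_. 1 / real (Suc k)) 0 x)) \<longlonglongrightarrow> f x * g 0"
        by (intro tendsto_mult[OF tendsto_const]) (rule isCont_tendsto_compose)
    qed
    show "AE x in lborel. norm (f x * g (diag_aff (\<lambda>_. 1 / real (Suc k)) 0 x)) \<le> norm (f x) * C" for k
      using C(2) by (intro AE_I2) (simp add: norm_mult mult_left_mono)
  qed measurable
qed

text \<open>Inversion at the origin up to its constant: the ratio of the integral of the transform
  to the value at 0 is the same for all f. Duality is applied to f and a dilation of h; the dilation
  is moved over to f, and as its factor tends to 0 the dilated functions become the constants h 0
  and f 0.\<close>

lemma fourier_exchange:
  fixes f h :: "real^'n::finite \<Rightarrow> complex"
  assumes f: "schwartz f" and h: "schwartz h"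
  shows "h 0 * (\<integral>x. fourier f x \<partial>lborel) = f 0 * (\<integral>x. fourier h x \<partial>lborel)"
proof -
  have eq: "(\<integral>x. fourier f x * h (diag_aff (\<lambda>_. 1 / real (Suc k)) 0 x) \<partial>lborel)
      = (\<integral>x. fourier h x * f (diag_aff (\<lambda>_. 1 / real (Suc k)) 0 x) \<partial>lborel)" for k
  proof -
    define r where "r = (\<lambda>_::'n. 1 / real (Suc k))"
    have r: "r i > 0" for i by (simp add: r_def)
    have r': "(1 / r i) > 0" for i by (simp add: r_def)
    have sh: "schwartz (\<lambda>x. h (diag_aff r 0 x))" by (rule schwartz_diag[OF r h])
    have "(\<integral>x. fourier f x * h (diag_aff r 0 x) \<partial>lborel) = (\<integral>x. h (diag_aff r 0 x) * (\<integral>\<xi>. cis (1 * (x \<bullet> \<xi>)) * f \<xi> \<partial>lborel) \<partial>lborel)"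
      by (simp add: fourier_def mult.commute)
    also have "\<dots> = (\<integral>\<xi>. f \<xi> * (\<integral>x. cis (1 * (x \<bullet> \<xi>)) * h (diag_aff r 0 x) \<partial>lborel) \<partial>lborel)"
      by (rule fourier_duality[OF f sh])
    also have "\<dots> = (\<integral>\<xi>. f \<xi> * fourier (\<lambda>x. h (diag_aff r 0 x)) \<xi> \<partial>lborel)"
      by (simp add: fourier_def inner_commute)
    also have "\<dots> = (\<integral>\<xi>. of_real (1 / (\<Prod>i\<in>UNIV. r i)) * ((\<lambda>\<eta>. f (diag_aff r 0 \<eta>) * fourier h \<eta>) (diag_aff (\<lambda>i. 1 / r i) 0 \<xi>)) \<partial>lborel)"
      by (simp add: fourier_diag[OF r h] diag_aff_inverse[OF r] mult_ac)
    also have "\<dots> = of_real (1 / (\<Prod>i\<in>UNIV. r i)) * ((1 / (\<Prod>i\<in>UNIV. 1 / r i)) *\<^sub>R (\<integral>\<eta>. f (diag_aff r 0 \<eta>) * fourier h \<eta> \<partial>lborel))"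
    proof (subst integral_mult_right_zero, subst integral_diag_aff)
      show "1 / r i > 0" for i by (rule r')
      show "(\<lambda>\<eta>. f (diag_aff r 0 \<eta>) * fourier h \<eta>) \<in> borel_measurable borel"
        by (intro borel_measurable_continuous_onI continuous_on_mult continuous_on_diag_comp schwartz_cont f schwartz_fourier h)
    qed simp
    also have "\<dots> = (\<integral>\<eta>. f (diag_aff r 0 \<eta>) * fourier h \<eta> \<partial>lborel)"
      using r by (simp add: scaleR_conv_of_real prod_dividef less_imp_neq[symmetric])
    finally show ?thesis by (simp add: r_def mult.commute)
  qed
  have 1: "(\<lambda>k. \<integral>x. fourier f x * h (diag_aff (\<lambda>_. 1 / real (Suc k)) 0 x) \<partial>lborel) \<longlonglongrightarrow> (\<integral>x. fourier f x * h 0 \<partial>lborel)"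
    by (rule integral_scale_limit[OF schwartz_fourier[OF f] h])
  have 2: "(\<lambda>k. \<integral>x. fourier h x * f (diag_aff (\<lambda>_. 1 / real (Suc k)) 0 x) \<partial>lborel) \<longlonglongrightarrow> (\<integral>x. fourier h x * f 0 \<partial>lborel)"
    by (rule integral_scale_limit[OF schwartz_fourier[OF h] f])
  from LIMSEQ_unique[OF 1[unfolded eq] 2] show ?thesis by (simp add: mult.commute)
qed

lemma fourier_translate:
  assumes "schwartz f"
  shows "fourier (\<lambda>\<xi>. f (\<xi> - b)) x = cis (x \<bullet> b) * fourier f x"
proof -
  have m: "(\<lambda>\<xi>. cis (x \<bullet> \<xi>) * f (\<xi> - b)) \<in> borel_measurable borel"
    using integrable_cis_mult[OF schwartz_shift[OF assms], of x b] by auto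
  have "fourier (\<lambda>\<xi>. f (\<xi> - b)) x = (\<integral>\<xi>. cis (x \<bullet> (\<xi> + b)) * f (\<xi> + b - b) \<partial>lborel)"
    unfolding fourier_def by (rule integral_shift[OF m, symmetric])
  also have "\<dots> = (\<integral>\<xi>. cis (x \<bullet> b) * (cis (x \<bullet> \<xi>) * f \<xi>) \<partial>lborel)"
    by (simp add: inner_add_right cis_mult[symmetric] mult_ac)
  finally show ?thesis by (simp add: fourier_def)
qed

text \<open>If the integral vanished, \<open>fourier_exchange\<close> applied to the translates of f
  would make the conjugate transform of \<open>fourier f\<close> vanish everywhere. Duality would
  then give the integral of |fourier f|^2 the value 0, although the transform at 0 is the positive
  integral of g.\<close>

lemma integral_fourier_nonzero:
  fixes g :: "real^'n::finite \<Rightarrow> real"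
  assumes f: "schwartz (\<lambda>x. complex_of_real (g x))" and g: "\<And>x. g x > 0"
  shows "(\<integral>x. fourier (\<lambda>x. complex_of_real (g x)) x \<partial>lborel) \<noteq> 0"
proof
  define f where "f = (\<lambda>x. complex_of_real (g x))"
  have f: "schwartz f" using f by (simp add: f_def)
  have F: "schwartz (fourier f)" by (rule schwartz_fourier[OF f])
  assume "(\<integral>x. fourier (\<lambda>x. complex_of_real (g x)) x \<partial>lborel) = 0"
  then have 0: "(\<integral>x. fourier f x \<partial>lborel) = 0" by (simp add: f_def)
  have ff: "(\<integral>x. cis (- 1 * (x \<bullet> \<xi>)) * fourier f x \<partial>lborel) = 0" for \<xi>
  proof -
    have "f 0 * (\<integral>x. fourier (\<lambda>\<xi>'. f (\<xi>' - - \<xi>)) x \<partial>lborel) = f (0 - - \<xi>) * (\<integral>x. fourier f x \<partial>lborel)"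
      using fourier_exchange[OF schwartz_shift[OF f, of "- \<xi>"] f] .
    then show ?thesis
      unfolding 0 fourier_translate[OF f] using g[of 0] by (simp add: f_def)
  qed
  have cnj: "(\<integral>\<xi>. cis (- 1 * (x \<bullet> \<xi>)) * f \<xi> \<partial>lborel) = cnj (fourier f x)" for x
  proof -
    have "cnj (fourier f x) = (\<integral>\<xi>. cnj (cis (x \<bullet> \<xi>) * f \<xi>) \<partial>lborel)"
      unfolding fourier_def by (rule Bochner_Integration.integral_cnj[symmetric])
    also have "\<dots> = (\<integral>\<xi>. cis (- 1 * (x \<bullet> \<xi>)) * f \<xi> \<partial>lborel)"
      by (intro Bochner_Integration.integral_cong) (simp_all add: cis_cnj f_def)
    finally show ?thesis by simp
  qed
  have "(\<integral>x. fourier f x * cnj (fourier f x) \<partial>lborel) = 0"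
    unfolding cnj[symmetric] fourier_duality[OF f F] ff by simp
  then have "complex_of_real (\<integral>x. (norm (fourier f x))\<^sup>2 \<partial>lborel) = 0"
    by (simp only: integral_complex_of_real[symmetric] complex_norm_square)
  moreover have "(\<integral>x. (norm (fourier f x))\<^sup>2 \<partial>lborel) > 0"
  proof (rule integral_pos_continuous[of _ 0])
    show "continuous_on UNIV (\<lambda>x. (norm (fourier f x))\<^sup>2)" by (intro continuous_intros schwartz_cont F)
    have "rdecay (\<lambda>x. fourier f x * fourier f x)"
      by (rule rdecay_mult[OF pgrow_bound[OF pgrow_const] schwartz_rdecay[OF F]]) (rule order_trans[OF fourier_bound[OF f] abs_ge_self[THEN order_trans[OF _ eq_refl[OF real_norm_def[symmetric]]]]])
    then have "rdecay (\<lambda>x. (norm (fourier f x))\<^sup>2)"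
      by (rule rdecay_bound) (simp add: norm_mult power2_eq_square)
    then show "integrable lborel (\<lambda>x. (norm (fourier f x))\<^sup>2)"
      by (intro integrable_rdecay continuous_intros schwartz_cont F)
    have "(\<integral>x. g x \<partial>lborel) > 0"
    proof (rule integral_pos_continuous[of _ 0])
      have "continuous_on UNIV (\<lambda>x. Re (f x))" by (intro continuous_on_Re schwartz_cont f)
      then show "continuous_on UNIV g" by (simp add: f_def)
      have "integrable lborel (\<lambda>x. Re (f x))" by (intro integrable_Re schwartz_integrable f)
      then show "integrable lborel g" by (simp add: f_def)
    qed (use g in \<open>auto intro: less_imp_le\<close>)
    then have "fourier f 0 \<noteq> 0" unfolding fourier_def f_def by (simp add: integral_complex_of_real)
    then show "0 < (norm (fourier f 0))\<^sup>2" by simp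
  qed simp
  ultimately show False by simp
qed

section \<open>Anisotropic scaling\<close>

text \<open>The shares a / (a + b) and b / (a + b) lie in [0, 1], where t \<le> t powr p, and they
  add up to 1.\<close>

lemma powr_subadd:
  fixes a b p :: real
  assumes "0 < p" "p \<le> 1" "0 \<le> a" "0 \<le> b"
  shows "(a + b) powr p \<le> a powr p + b powr p"
proof (cases "a + b = 0")
  case True
  then show ?thesis using assms by simp
next
  case False
  then have pos: "a + b > 0" using assms by simp
  have frac: "t \<le> t powr p" if "0 \<le> t" "t \<le> 1" for t :: real
    using powr_mono'[of p 1 t] that assms by (cases "t = 0") auto
  have "1 = a / (a + b) + b / (a + b)" using pos by (simp add: add_divide_distrib[symmetric])
  also have "\<dots> \<le> (a / (a + b)) powr p + (b / (a + b)) powr p"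
    using pos assms by (intro add_mono frac) auto
  also have "\<dots> = (a powr p + b powr p) / (a + b) powr p"
    using pos assms by (simp add: powr_divide add_divide_distrib)
  finally show ?thesis using pos by (simp add: pos_le_divide_eq)
qed

definition dil :: "('n::finite \<Rightarrow> nat) \<Rightarrow> real \<Rightarrow> real^'n \<Rightarrow> real^'n" where
  "dil s r = diag_aff (\<lambda>i. r ^ s i) 0"

definition hdim :: "('n::finite \<Rightarrow> nat) \<Rightarrow> nat" where
  "hdim s = (\<Sum>i\<in>UNIV. s i)"

definition ldeg :: "('n::finite \<Rightarrow> nat) \<Rightarrow> 'n list \<Rightarrow> nat" where
  "ldeg s l = (\<Sum>i\<leftarrow>l. s i)"

lemma dil_component [simp]: "dil s r x $ i = r ^ s i * x $ i"
  by (simp add: dil_def diag_aff_def)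

lemma prod_dil: "(\<Prod>i\<in>UNIV. r ^ s i) = r ^ hdim s"
  by (simp add: hdim_def power_sum)

lemma prod_list_dil: "(\<Prod>i\<leftarrow>l. r ^ s i) = (r::'b::comm_monoid_mult) ^ ldeg s l"
  by (induction l) (simp_all add: ldeg_def power_add)

lemma dil_inverse: "r > 0 \<Longrightarrow> dil s r (dil s (1 / r) x) = x"
  by (simp add: vec_eq_iff power_one_over)

lemma dil_inverse': "r > 0 \<Longrightarrow> dil s (1 / r) (dil s r x) = x"
  by (simp add: vec_eq_iff power_one_over)

lemma dil_diff: "dil s r (x - y) = dil s r x - dil s r y"
  by (simp add: vec_eq_iff algebra_simps)

lemma dil_zero [simp]: "dil s r 0 = 0"
  by (simp add: vec_eq_iff)

lemma aniso_dist_eq: "aniso_dist s x y = aniso_dist s 0 (y - x)"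
  by (simp add: aniso_dist_def abs_minus_commute)

lemma aniso_dist_nonneg [simp]: "aniso_dist s x y \<ge> 0"
  by (simp add: aniso_dist_def sum_nonneg)

lemma aniso_dist_refl [simp]: "aniso_dist s x x = 0"
  by (simp add: aniso_dist_def)

locale scaling =
  fixes s :: "'n::finite \<Rightarrow> nat"
  assumes s_ge_1: "s i \<ge> 1"
begin

abbreviation anorm :: "real^'n \<Rightarrow> real" where
  "anorm \<equiv> aniso_dist s 0"

lemma anorm_def: "anorm z = (\<Sum>i\<in>UNIV. \<bar>z $ i\<bar> powr (1 / real (s i)))"
  by (simp add: aniso_dist_def)

lemma anorm_dil:
  assumes "r > 0" shows "anorm (dil s r z) = r * anorm z"
proof -
  have "\<bar>dil s r z $ i\<bar> powr (1 / real (s i)) = r * \<bar>z $ i\<bar> powr (1 / real (s i))" for i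
  proof -
    have "(r ^ s i) powr (1 / real (s i)) = r"
      using assms s_ge_1[of i] by (simp add: powr_realpow[symmetric] powr_powr)
    then show ?thesis using assms by (simp add: abs_mult powr_mult)
  qed
  then show ?thesis by (simp add: anorm_def sum_distrib_left)
qed

lemma anorm_triangle: "anorm (x + y) \<le> anorm x + anorm y"
  unfolding anorm_def sum.distrib[symmetric]
proof (rule sum_mono)
  fix i
  have p: "0 < 1 / real (s i)" "1 / real (s i) \<le> 1" using s_ge_1[of i] by auto
  have "\<bar>(x + y) $ i\<bar> powr (1 / real (s i)) \<le> (\<bar>x $ i\<bar> + \<bar>y $ i\<bar>) powr (1 / real (s i))"
    using p by (intro powr_mono2) auto
  also have "\<dots> \<le> \<bar>x $ i\<bar> powr (1 / real (s i)) + \<bar>y $ i\<bar> powr (1 / real (s i))"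
    by (rule powr_subadd[OF p]) auto
  finally show "\<bar>(x + y) $ i\<bar> powr (1 / real (s i)) \<le> \<bar>x $ i\<bar> powr (1 / real (s i)) + \<bar>y $ i\<bar> powr (1 / real (s i))" .
qed

lemma component_le_anorm: "\<bar>z $ i\<bar> \<le> anorm z ^ s i"
proof -
  have "\<bar>z $ i\<bar> powr (1 / real (s i)) \<le> anorm z"
    unfolding anorm_def by (rule member_le_sum) auto
  then have "(\<bar>z $ i\<bar> powr (1 / real (s i))) powr real (s i) \<le> anorm z powr real (s i)"
    by (intro powr_mono2) auto
  then show ?thesis
    using s_ge_1[of i] by (cases "anorm z = 0") (auto simp: powr_powr powr_realpow less_le)
qed

lemma anorm_le: "anorm z \<le> real CARD('n) * (1 + norm z)"
proof -
  have "\<bar>z $ i\<bar> powr (1 / real (s i)) \<le> 1 + norm z" for i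
  proof -
    have "\<bar>z $ i\<bar> powr (1 / real (s i)) \<le> (1 + norm z) powr (1 / real (s i))"
      using component_le_norm_cart[of z i] by (intro powr_mono2) auto
    also have "\<dots> \<le> (1 + norm z) powr 1"
      using s_ge_1[of i] by (intro powr_mono) auto
    finally show ?thesis by simp
  qed
  then have "anorm z \<le> (\<Sum>i\<in>(UNIV::'n set). 1 + norm z)" unfolding anorm_def by (rule sum_mono)
  then show ?thesis by simp
qed

lemma continuous_anorm: "continuous_on UNIV anorm"
  unfolding anorm_def[abs_def]
proof (intro continuous_on_sum)
  fix i
  show "continuous_on UNIV (\<lambda>z::real^'n. \<bar>z $ i\<bar> powr (1 / real (s i)))"
    using s_ge_1[of i] by (intro continuous_on_powr' continuous_intros) auto
qed

lemma anorm_pos: "z \<noteq> 0 \<Longrightarrow> anorm z > 0"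
proof -
  assume "z \<noteq> 0"
  then obtain i where "z $ i \<noteq> 0" by (auto simp: vec_eq_iff)
  then have "anorm z \<noteq> 0" using component_le_anorm[of z i] s_ge_1[of i] by (auto simp: power_0_left)
  then show ?thesis by (simp add: less_le)
qed

lemma pgrow_anorm_powr:
  assumes "p \<ge> 0" "c \<ge> 0"
  shows "pgrow (\<lambda>z. (c + anorm z) powr p)"
  unfolding pgrow_def
proof (intro exI allI)
  fix z
  let ?K = "1 + \<bar>c\<bar> + real CARD('n)"
  have "\<bar>c + anorm z\<bar> \<le> ?K * (1 + norm z)"
  proof -
    have "\<bar>c + anorm z\<bar> \<le> \<bar>c\<bar> * 1 + real CARD('n) * (1 + norm z)"
      using anorm_le[of z] abs_triangle_ineq[of c "anorm z"] aniso_dist_nonneg[of s 0 z] by linarith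
    also have "\<dots> \<le> \<bar>c\<bar> * (1 + norm z) + real CARD('n) * (1 + norm z)"
      by (intro add_mono mult_left_mono) auto
    also have "\<dots> \<le> ?K * (1 + norm z)" by (simp add: algebra_simps)
    finally show ?thesis .
  qed
  moreover have "(c + anorm z) powr p \<le> \<bar>c + anorm z\<bar> powr p"
    using assms by simp
  ultimately have "norm ((c + anorm z) powr p) \<le> (?K * (1 + norm z)) powr p"
    using powr_mono2[OF assms(1), of "\<bar>c + anorm z\<bar>" "?K * (1 + norm z)"] by simp
  also have "\<dots> \<le> (?K * (1 + norm z)) powr real (nat \<lceil>p\<rceil>)"
  proof (rule powr_mono)
    have "1 * 1 \<le> ?K * (1 + norm z)" by (intro mult_mono) auto
    then show "1 \<le> ?K * (1 + norm z)" by simp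
  qed linarith
  also have "\<dots> = (?K * (1 + norm z)) ^ nat \<lceil>p\<rceil>"
    by (intro powr_realpow mult_pos_pos add_pos_nonneg) auto
  finally show "norm ((c + anorm z) powr p) \<le> ?K ^ nat \<lceil>p\<rceil> * (1 + norm z) ^ nat \<lceil>p\<rceil>"
    by (simp add: power_mult_distrib)
qed

lemma continuous_anorm_powr:
  assumes "p > 0" "c \<ge> 0" shows "continuous_on UNIV (\<lambda>z. (c + anorm z) powr p)"
  using assms by (intro continuous_on_powr' continuous_intros continuous_anorm) auto

lemma ldeg_count: "ldeg s l = (\<Sum>i\<in>UNIV. s i * count_list l i)"
  unfolding ldeg_def by (subst sum_list_map_eq_sum_count2[of l UNIV]) (auto simp: mult.commute)

lemma length_le_ldeg: "length l \<le> ldeg s l"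
proof (induction l)
  case (Cons i l)
  then show ?case using s_ge_1[of i] by (simp add: ldeg_def)
qed (simp add: ldeg_def)

end

section \<open>Multi-indices as lists of directions\<close>

lemma ex_count_list: "\<exists>l. \<forall>i::'n::finite. count_list l i = \<beta> i"
proof -
  obtain l where "mset l = Abs_multiset \<beta>" using ex_mset by blast
  moreover have "count (Abs_multiset \<beta>) = \<beta>" by (rule count_Abs_multiset) simp
  ultimately show ?thesis by (metis count_mset)
qed

text \<open>The very choice made inside \<open>pdiff\<close>, named so that only its counts enter
  later arguments and \<open>pdiff\<close> becomes \<open>pderivs\<close> of a fixed list.\<close>

definition mlist :: "('n::finite \<Rightarrow> nat) \<Rightarrow> 'n list" where
  "mlist \<beta> = (SOME l. \<forall>i. count_list l i = \<beta> i)"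

lemma count_mlist [simp]: "count_list (mlist \<beta>) i = \<beta> i"
  unfolding mlist_def using someI_ex[OF ex_count_list[of \<beta>]] by blast

lemma pdiff_mlist: "pdiff \<beta> f = pderivs (mlist \<beta>) f"
  by (simp add: pdiff_def mlist_def)

lemma length_mlist: "length (mlist \<beta>) = sum \<beta> UNIV"
proof -
  have "length (mlist \<beta>) = (\<Sum>i\<leftarrow>mlist \<beta>. 1)" by (simp add: sum_list_triv)
  also have "\<dots> = sum \<beta> UNIV" by (subst sum_list_map_eq_sum_count2[of _ UNIV]) auto
  finally show ?thesis .
qed

lemma (in scaling) ldeg_mlist: "ldeg s (mlist \<beta>) = aniso_deg s \<beta>"
  by (simp add: ldeg_count aniso_deg_def)

lemma (in scaling) finite_aniso_deg: "finite {\<gamma>. aniso_deg s \<gamma> \<le> k}"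
proof (rule finite_subset)
  show "{\<gamma>. aniso_deg s \<gamma> \<le> k} \<subseteq> (\<Pi>\<^sub>E i\<in>UNIV. {..k})"
  proof (clarsimp simp: PiE_def)
    fix \<gamma> :: "'n \<Rightarrow> nat" and i assume "aniso_deg s \<gamma> \<le> k"
    moreover have "s i * \<gamma> i \<le> aniso_deg s \<gamma>"
      unfolding aniso_deg_def by (rule member_le_sum) auto
    moreover have "1 * \<gamma> i \<le> s i * \<gamma> i" by (rule mult_right_mono[OF s_ge_1]) simp
    ultimately show "\<gamma> i \<le> k" by linarith
  qed
qed (auto intro: finite_PiE)

section \<open>The symbol of the operator\<close>

definition opl_coeff :: "(('n::finite \<Rightarrow> nat) \<Rightarrow> complex) \<Rightarrow> ('n \<Rightarrow> nat) \<Rightarrow> complex" where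
  "opl_coeff a \<gamma> = a \<gamma> * (-1) ^ sum \<gamma> UNIV"

text \<open>The multiplier of the transposed operator under \<open>fourier\<close>. Through the
  signs in \<open>opl_coeff\<close> it is the symbol of the original operator at - \<xi>.\<close>

definition symbol :: "('n::finite \<Rightarrow> nat) \<Rightarrow> nat \<Rightarrow> (('n \<Rightarrow> nat) \<Rightarrow> complex) \<Rightarrow> real^'n \<Rightarrow> complex" where
  "symbol s m a \<xi> = (\<Sum>\<gamma>\<in>{\<gamma>. aniso_deg s \<gamma> = m}. opl_coeff a \<gamma> * (\<Prod>i\<leftarrow>mlist \<gamma>. \<i> * of_real (\<xi> $ i)))"

lemma opL_t_pderivs:
  "opL_t s m a f x = (\<Sum>\<gamma>\<in>{\<gamma>. aniso_deg s \<gamma> = m}. opl_coeff a \<gamma> * pderivs (mlist \<gamma>) f x)"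
  by (simp add: opL_t_def opl_coeff_def pdiff_mlist)

lemma opL_t_add:
  "smooth f \<Longrightarrow> smooth g \<Longrightarrow> opL_t s m a (\<lambda>x. f x + g x) = (\<lambda>x. opL_t s m a f x + opL_t s m a g x)"
  by (simp add: opL_t_pderivs fun_eq_iff pderivs_add sum.distrib distrib_left)

lemma opL_t_cmult:
  "smooth f \<Longrightarrow> opL_t s m a (\<lambda>x. c * f x) = (\<lambda>x. c * opL_t s m a f x)"
  by (simp add: opL_t_pderivs fun_eq_iff pderivs_cmult sum_distrib_left mult_ac)

lemma opL_t_shift:
  "smooth f \<Longrightarrow> opL_t s m a (\<lambda>x. f (x - b)) = (\<lambda>x. opL_t s m a f (x - b))"
  by (simp add: opL_t_pderivs fun_eq_iff pderivs_shift)

lemma schwartz_opL_t: "schwartz f \<Longrightarrow> schwartz (opL_t s m a f)"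
  unfolding opL_t_pderivs[abs_def] by (intro schwartz_sum schwartz_cmult schwartz_pderivs)

lemma prod_list_cpoly: "(\<lambda>\<xi>. \<Prod>i\<leftarrow>l. \<i> * of_real (\<xi> $ i)) \<in> cpoly"
proof (induction l)
  case (Cons i l)
  show ?case
    using cpoly.mult[OF cpoly.mult[OF cpoly.const[of \<i>] cpoly.coord[of i]] Cons] by simp
qed (simp add: cpoly.const)

lemma symbol_cpoly: "symbol s m a \<in> cpoly"
  unfolding symbol_def[abs_def] by (intro cpoly_sum cpoly.mult cpoly.const prod_list_cpoly)

lemma opL_t_fourier:
  assumes "schwartz f"
  shows "opL_t s m a (fourier f) = fourier (\<lambda>\<xi>. symbol s m a \<xi> * f \<xi>)"
proof
  fix x
  have "fourier (\<lambda>\<xi>. symbol s m a \<xi> * f \<xi>) x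
      = fourier (\<lambda>\<xi>. \<Sum>\<gamma>\<in>{\<gamma>. aniso_deg s \<gamma> = m}. opl_coeff a \<gamma> * ((\<Prod>i\<leftarrow>mlist \<gamma>. \<i> * of_real (\<xi> $ i)) * f \<xi>)) x"
    by (simp add: symbol_def sum_distrib_right mult.assoc)
  also have "\<dots> = (\<Sum>\<gamma>\<in>{\<gamma>. aniso_deg s \<gamma> = m}. fourier (\<lambda>\<xi>. opl_coeff a \<gamma> * ((\<Prod>i\<leftarrow>mlist \<gamma>. \<i> * of_real (\<xi> $ i)) * f \<xi>)) x)"
    by (intro fourier_sum schwartz_cmult schwartz_coords assms)
  also have "\<dots> = opL_t s m a (fourier f) x"
    by (simp add: opL_t_pderivs fourier_cmult fourier_pderivs[OF assms])
  finally show "opL_t s m a (fourier f) x = fourier (\<lambda>\<xi>. symbol s m a \<xi> * f \<xi>) x" ..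
qed

lemma prod_list_dil_coords:
  "(\<Prod>i\<leftarrow>l. \<i> * of_real (dil s r \<xi> $ i)) = of_real (r ^ ldeg s l) * (\<Prod>i\<leftarrow>l. \<i> * complex_of_real (\<xi> $ i))"
  by (induction l) (simp_all add: ldeg_def power_add mult_ac)

lemma (in scaling) symbol_dil: "symbol s m a (dil s r \<xi>) = of_real (r ^ m) * symbol s m a \<xi>"
  unfolding symbol_def prod_list_dil_coords ldeg_mlist sum_distrib_left
  by (intro sum.cong) auto

text \<open>The weak form of L applied to a plane wave. The frequency is - \<zeta> because the signs
  from integration by parts cancel against those of the conjugated wave, leaving exactly
  \<open>symbol\<close> at \<zeta>.\<close>

lemma integral_cis_opL_t:
  assumes "schwartz \<phi>"
  shows "(\<integral>x. cis ((- \<zeta>) \<bullet> x) * opL_t s m a \<phi> x \<partial>lborel) = symbol s m a \<zeta> * (\<integral>x. cis ((- \<zeta>) \<bullet> x) * \<phi> x \<partial>lborel)"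
proof -
  have prod: "(\<Prod>i\<leftarrow>rev l. \<i> * complex_of_real ((- \<zeta>) $ i)) = (-1) ^ length l * (\<Prod>i\<leftarrow>l. \<i> * of_real (\<zeta> $ i))" for l
    by (induction l) auto
  have ibp: "(\<integral>x. cis ((- \<zeta>) \<bullet> x) * pderivs l \<phi> x \<partial>lborel) = (\<Prod>i\<leftarrow>l. \<i> * of_real (\<zeta> $ i)) * (\<integral>x. cis ((- \<zeta>) \<bullet> x) * \<phi> x \<partial>lborel)" for l
  proof -
    have "(\<integral>x. cis ((- \<zeta>) \<bullet> x) * pderivs l \<phi> x \<partial>lborel) =
       (-1) ^ length l * ((-1) ^ length l * (\<Prod>i\<leftarrow>l. \<i> * of_real (\<zeta> $ i)) * (\<integral>x. cis ((- \<zeta>) \<bullet> x) * \<phi> x \<partial>lborel))"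
      unfolding integral_by_parts_pderivs[OF slowly_growing_cis assms] pderivs_cis prod by (simp add: mult.assoc)
    then show ?thesis by (simp add: mult.assoc[symmetric] power_mult_distrib[symmetric])
  qed
  have "(\<integral>x. cis ((- \<zeta>) \<bullet> x) * opL_t s m a \<phi> x \<partial>lborel)
      = (\<integral>x. (\<Sum>\<gamma>\<in>{\<gamma>. aniso_deg s \<gamma> = m}. opl_coeff a \<gamma> * (cis ((- \<zeta>) \<bullet> x) * pderivs (mlist \<gamma>) \<phi> x)) \<partial>lborel)"
    by (simp add: opL_t_pderivs sum_distrib_left mult.left_commute)
  also have "\<dots> = (\<Sum>\<gamma>\<in>{\<gamma>. aniso_deg s \<gamma> = m}. opl_coeff a \<gamma> * (\<integral>x. cis ((- \<zeta>) \<bullet> x) * pderivs (mlist \<gamma>) \<phi> x \<partial>lborel))"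
  proof (subst Bochner_Integration.integral_sum)
    show "integrable lborel (\<lambda>x. opl_coeff a \<gamma> * (cis ((- \<zeta>) \<bullet> x) * pderivs (mlist \<gamma>) \<phi> x))" for \<gamma>
      by (intro integrable_mult_right integrable_cis_mult schwartz_pderivs assms)
  qed simp
  finally show ?thesis
    unfolding ibp symbol_def sum_distrib_right by (simp add: mult.assoc)
qed

section \<open>Ellipticity forces the symbol not to vanish\<close>

lemma test_fun_schwartz:
  assumes "test_fun D \<phi>" shows "schwartz \<phi>"
proof -
  have "bounded (closure {x. \<phi> x \<noteq> 0})" using assms by (simp add: test_fun_def compact_imp_bounded)
  then obtain r where r: "\<And>x. x \<in> closure {x. \<phi> x \<noteq> 0} \<Longrightarrow> norm x \<le> r"
    by (auto simp: bounded_iff)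
  have "\<phi> x = 0" if "norm x \<ge> r + 1" for x
    using r[OF subsetD[OF closure_subset], of x] that by (cases "\<phi> x = 0") auto
  then show ?thesis
    using assms by (intro schwartz_compact_support[of _ "r + 1"]) (auto simp: test_fun_def)
qed

lemma bounded_schwartz_integrable:
  fixes u :: "real^'n::finite \<Rightarrow> complex"
  assumes "continuous_on UNIV u" "\<And>x. norm (u x) \<le> B" "schwartz \<phi>"
  shows "integrable lborel (\<lambda>x. u x * \<phi> x)"
proof (intro integrable_rdecay continuous_on_mult[OF assms(1) schwartz_cont[OF assms(3)]] rdecay_mult[OF _ schwartz_rdecay[OF assms(3)]])
  show "pgrow u" unfolding pgrow_def by (rule exI[of _ B], rule exI[of _ 0]) (simp add: assms)
qed

lemma fun_distr_eq:
  "integrable lborel (\<lambda>y. f y * \<phi> y) \<Longrightarrow> fun_distr f \<phi> = (\<integral>y. f y * \<phi> y \<partial>lborel)"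
  unfolding fun_distr_def by (rule integral_lborel)

lemma is_distribution_fun_distr:
  fixes u :: "real^'n::finite \<Rightarrow> complex"
  assumes u: "continuous_on UNIV u" "\<And>x. norm (u x) \<le> B"
  shows "is_distribution UNIV (fun_distr u)"
  unfolding is_distribution_def
proof (intro conjI allI impI)
  have int: "integrable lborel (\<lambda>y. u y * \<phi> y)" if "test_fun UNIV \<phi>" for \<phi>
    by (rule bounded_schwartz_integrable[OF u test_fun_schwartz[OF that]])
  show "fun_distr u (\<lambda>x. \<phi> x + \<psi> x) = fun_distr u \<phi> + fun_distr u \<psi>"
    if "test_fun UNIV \<phi>" "test_fun UNIV \<psi>" for \<phi> \<psi>
  proof -
    have "fun_distr u (\<lambda>x. \<phi> x + \<psi> x) = (\<integral>y. u y * (\<phi> y + \<psi> y) \<partial>lborel)"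
      by (rule fun_distr_eq) (simp add: distrib_left int that)
    then show ?thesis by (simp add: distrib_left int that fun_distr_eq)
  qed
  show "fun_distr u (\<lambda>x. c * \<phi> x) = c * fun_distr u \<phi>" if "test_fun UNIV \<phi>" for c \<phi>
  proof -
    have "fun_distr u (\<lambda>x. c * \<phi> x) = (\<integral>y. c * (u y * \<phi> y) \<partial>lborel)"
      using int[OF that] by (subst fun_distr_eq) (auto simp: mult.left_commute[of _ c])
    then show ?thesis by (simp add: int that fun_distr_eq)
  qed
  fix K :: "(real^'n) set" assume K: "compact K \<and> K \<subseteq> UNIV"
  have B: "0 \<le> B" using u(2)[of 0] norm_ge_zero order_trans by blast
  have finK: "emeasure lborel K < \<infinity>"
    using emeasure_compact_finite[of K] K by simp
  have Kb: "K \<in> sets borel" using K by (simp add: borel_compact)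
  show "\<exists>C N. \<forall>\<phi>. test_fun UNIV \<phi> \<and> closure {x. \<phi> x \<noteq> 0} \<subseteq> K \<longrightarrow>
      norm (fun_distr u \<phi>) \<le> C * (\<Sum>\<beta>\<in>{\<beta>::'n\<Rightarrow>nat. sum \<beta> UNIV \<le> N}. Sup (range (\<lambda>x. norm (pdiff \<beta> \<phi> x))))"
  \<comment> \<open>A bounded function has order 0 as a distribution: the only multi-index in the
    sum is 0, and its term is the supremum of |\<phi>|.\<close>
  proof (rule exI[of _ "B * measure lborel K"], rule exI[of _ 0], intro allI impI, elim conjE)
    fix \<phi> :: "real^'n \<Rightarrow> complex" assume \<phi>: "test_fun UNIV \<phi>" "closure {x. \<phi> x \<noteq> 0} \<subseteq> K"
    have z: "{\<beta>::'n\<Rightarrow>nat. sum \<beta> UNIV \<le> 0} = {\<lambda>_. 0}" by (auto simp: fun_eq_iff)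
    have l0: "mlist (\<lambda>_::'n. 0) = []" using length_mlist[of "\<lambda>_::'n. 0"] by simp
    define S where "S = Sup (range (\<lambda>x. norm (\<phi> x)))"
    obtain C where C: "\<And>x. norm (\<phi> x) * (1 + norm x) ^ 0 \<le> C"
      using rdecayE[OF schwartz_rdecay[OF test_fun_schwartz[OF \<phi>(1)]]] by metis
    have S: "norm (\<phi> x) \<le> S" for x
      unfolding S_def by (rule cSup_upper) (use C in \<open>auto simp: bdd_above_def\<close>)
    have "norm (fun_distr u \<phi>) \<le> (\<integral>y. norm (u y * \<phi> y) \<partial>lborel)"
      unfolding fun_distr_eq[OF int[OF \<phi>(1)]] by (rule integral_norm_bound)
    also have "\<dots> \<le> (\<integral>y. (B * S) * indicator K y \<partial>lborel)"
    proof (rule integral_mono)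
      show "integrable lborel (\<lambda>y. norm (u y * \<phi> y))" using int[OF \<phi>(1)] by (rule integrable_norm)
      show "integrable lborel (\<lambda>y. (B * S) * indicator K y)"
        using Kb finK by (intro integrable_mult_right) (auto intro: integrable_real_indicator)
      fix y
      show "norm (u y * \<phi> y) \<le> (B * S) * indicator K y"
      proof (cases "y \<in> K")
        case True
        then show ?thesis using u(2)[of y] S[of y] B by (auto simp: norm_mult intro!: mult_mono)
      next
        case False
        then have "\<phi> y = 0" using \<phi>(2) closure_subset[of "{x. \<phi> x \<noteq> 0}"] by auto
        then show ?thesis using False by simp
      qed
    qed
    also have "\<dots> = B * measure lborel K * S" using Kb by simp
    finally show "norm (fun_distr u \<phi>) \<le> B * measure lborel K * (\<Sum>\<beta>\<in>{\<beta>::'n\<Rightarrow>nat. sum \<beta> UNIV \<le> 0}. Sup (range (\<lambda>x. norm (pdiff \<beta> \<phi> x))))"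
      unfolding z by (simp add: pdiff_mlist l0 S_def)
  qed
qed

lemma smooth_bump_scaled: "smooth (\<lambda>x. complex_of_real (bump_real (c *\<^sub>R (x - b))))"
  using smooth_shift[OF smooth_diag_aff[OF smooth_bump, of "\<lambda>_. c" 0], of b] by (simp add: diag_aff_scale)

lemma test_fun_bump:
  assumes "e > 0"
  shows "test_fun UNIV (\<lambda>x. complex_of_real (bump_real ((1 / e) *\<^sub>R (x - b))))"
proof -
  have "{x. complex_of_real (bump_real ((1 / e) *\<^sub>R (x - b))) \<noteq> 0} \<subseteq> cball b e"
  proof
    fix x assume "x \<in> {x. complex_of_real (bump_real ((1 / e) *\<^sub>R (x - b))) \<noteq> 0}"
    then have "norm ((1 / e) *\<^sub>R (x - b)) < 1" using bump_outside[of "(1 / e) *\<^sub>R (x - b)"] by (auto simp: not_le[symmetric])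
    then show "x \<in> cball b e" using assms by (simp add: dist_norm norm_minus_commute)
  qed
  then have "closure {x. complex_of_real (bump_real ((1 / e) *\<^sub>R (x - b))) \<noteq> 0} \<subseteq> cball b e"
    by (intro closure_minimal) auto
  then have "compact (closure {x. complex_of_real (bump_real ((1 / e) *\<^sub>R (x - b))) \<noteq> 0})"
    by (intro compact_closure[THEN iffD2]) (meson bounded_cball bounded_subset closure_subset subset_trans)
  then show ?thesis by (simp add: test_fun_def smooth_bump_scaled)
qed

text \<open>If h x is nonzero, the real part of cnj (h x) * h is positive on a small ball around x;
  a bump supported there pairs with h to a nonzero number.\<close>

lemma fun_distr_unique:
  fixes h :: "real^'n::finite \<Rightarrow> complex"
  assumes h: "continuous_on UNIV h" and z: "\<And>\<phi>. test_fun UNIV \<phi> \<Longrightarrow> fun_distr h \<phi> = 0"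
  shows "h x = 0"
proof (rule ccontr)
  assume nz: "h x \<noteq> 0"
  define k where "k = (\<lambda>y. Re (cnj (h x) * h y))"
  have k: "continuous_on UNIV k" unfolding k_def by (intro continuous_intros h)
  have kx: "k x > 0" using nz by (simp add: k_def complex_mult_cnj complex_eq_iff sum_power2_gt_zero_iff mult.commute power2_eq_square[symmetric])
  have "open {y. k y > 0}" using open_Collect_less[of "\<lambda>_. 0" k] k by auto
  then obtain e where e: "e > 0" "ball x e \<subseteq> {y. k y > 0}" using kx by (auto elim!: openE)
  define b where "b = (\<lambda>y. bump_real ((1 / e) *\<^sub>R (y - x)))"
  have b: "test_fun UNIV (\<lambda>y. complex_of_real (b y))" unfolding b_def by (rule test_fun_bump[OF e(1)])
  have bc: "continuous_on UNIV b"
    using continuous_on_Re[OF schwartz_cont[OF test_fun_schwartz[OF b]]] by simp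
  have bz: "b y = 0" if "y \<notin> ball x e" for y
    unfolding b_def using that e(1) by (intro bump_outside) (simp add: dist_norm norm_minus_commute)
  have int: "integrable lborel (\<lambda>y. h y * complex_of_real (b y))"
  proof (intro integrable_rdecay continuous_on_mult h schwartz_cont[OF test_fun_schwartz[OF b]])
    have cb: "continuous_on (cball x e) h" using h continuous_on_subset by blast
    have "bounded (h ` cball x e)"
      by (intro compact_imp_bounded compact_continuous_image cb) auto
    then obtain B where B: "\<And>y. y \<in> cball x e \<Longrightarrow> norm (h y) \<le> B" unfolding bounded_iff by blast
    have "rdecay (\<lambda>y. complex_of_real B * complex_of_real (b y))"
      by (rule rdecay_cmult[OF schwartz_rdecay[OF test_fun_schwartz[OF b]]])
    then show "rdecay (\<lambda>y. h y * complex_of_real (b y))"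
    proof (rule rdecay_bound)
      fix y
      show "norm (h y * complex_of_real (b y)) \<le> norm (complex_of_real B * complex_of_real (b y))"
      proof (cases "y \<in> ball x e")
        case True
        then have "norm (h y) \<le> \<bar>B\<bar>" using B[of y] by auto
        then show ?thesis by (simp add: norm_mult mult_right_mono)
      qed (simp add: bz)
    qed
  qed
  have kb: "Re (cnj (h x) * (h y * complex_of_real (b y))) = k y * b y" for y
    by (simp add: k_def algebra_simps)
  have "(\<integral>y. h y * complex_of_real (b y) \<partial>lborel) = 0"
    using z[OF b] fun_distr_eq[OF int] by simp
  then have "(\<integral>y. cnj (h x) * (h y * complex_of_real (b y)) \<partial>lborel) = 0"
    by simp
  then have "Re (\<integral>y. cnj (h x) * (h y * complex_of_real (b y)) \<partial>lborel) = 0" by (simp only: zero_complex.sel)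
  moreover have "Re (\<integral>y. cnj (h x) * (h y * complex_of_real (b y)) \<partial>lborel) = (\<integral>y. k y * b y \<partial>lborel)"
    unfolding kb[symmetric] by (rule integral_Re[symmetric]) (intro integrable_mult_right int)
  moreover have "(\<integral>y. k y * b y \<partial>lborel) > 0"
  proof (rule integral_pos_continuous[of _ x])
    show "continuous_on UNIV (\<lambda>y. k y * b y)" by (intro continuous_on_mult k bc)
    have "integrable lborel (\<lambda>y. Re (cnj (h x) * (h y * complex_of_real (b y))))"
      by (intro integrable_Re integrable_mult_right int)
    then show "integrable lborel (\<lambda>y. k y * b y)" unfolding kb .
    show "k y * b y \<ge> 0" for y
    proof (cases "y \<in> ball x e")
      case True
      then have "k y > 0" using e(2) by auto
      then show ?thesis using bump_nonneg[of "(1 / e) *\<^sub>R (y - x)"] unfolding b_def by (intro mult_nonneg_nonneg) auto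
    qed (simp add: bz)
    show "k x * b x > 0" using kx bump_pos[of "0::real^'n"] by (simp add: b_def)
  qed
  ultimately show False by simp
qed

text \<open>Every single wave is annihilated by \<open>integral_cis_opL_t\<close>; the weights (1 /
  2) ^ k give the absolute convergence needed to integrate termwise.\<close>

lemma opL_t_zero_summation:
  fixes \<zeta> :: "nat \<Rightarrow> real^'n::finite"
  assumes z: "\<And>k. symbol s m a (\<zeta> k) = 0" and \<phi>: "schwartz \<phi>"
  shows "(\<integral>x. (\<Sum>k. (1 / 2) ^ k * cis ((- \<zeta> k) \<bullet> x)) * opL_t s m a \<phi> x \<partial>lborel) = 0"
proof -
  have L: "schwartz (opL_t s m a \<phi>)" by (rule schwartz_opL_t[OF \<phi>])
  have sumg: "summable (\<lambda>k. norm ((1 / 2) ^ k * cis ((- \<zeta> k) \<bullet> x)))" for x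
    by (simp add: norm_mult norm_power norm_divide summable_geometric)
  have "(\<integral>x. (\<Sum>k. (1 / 2) ^ k * cis ((- \<zeta> k) \<bullet> x)) * opL_t s m a \<phi> x \<partial>lborel)
      = (\<integral>x. (\<Sum>k. (1 / 2) ^ k * cis ((- \<zeta> k) \<bullet> x) * opL_t s m a \<phi> x) \<partial>lborel)"
    by (simp only: suminf_mult2[OF summable_norm_cancel[OF sumg]])
  also have "\<dots> = (\<Sum>k. \<integral>x. (1 / 2) ^ k * cis ((- \<zeta> k) \<bullet> x) * opL_t s m a \<phi> x \<partial>lborel)"
  proof (rule integral_suminf)
    show int: "integrable lborel (\<lambda>x. (1 / 2) ^ k * cis ((- \<zeta> k) \<bullet> x) * opL_t s m a \<phi> x)" for k
      unfolding mult.assoc by (intro integrable_mult_right integrable_cis_mult L)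
    show "AE x in lborel. summable (\<lambda>k. norm ((1 / 2) ^ k * cis ((- \<zeta> k) \<bullet> x) * opL_t s m a \<phi> x))"
      by (simp add: norm_mult norm_power norm_divide summable_geometric summable_mult2)
    show "summable (\<lambda>k. \<integral>x. norm ((1 / 2) ^ k * cis ((- \<zeta> k) \<bullet> x) * opL_t s m a \<phi> x) \<partial>lborel)"
      by (simp add: norm_mult norm_power norm_divide summable_geometric summable_mult2)
  qed
  also have "\<dots> = (\<Sum>k. (1 / 2) ^ k * (\<integral>x. cis ((- \<zeta> k) \<bullet> x) * opL_t s m a \<phi> x \<partial>lborel))"
    by (simp add: mult.assoc)
  also have "\<dots> = 0" unfolding integral_cis_opL_t[OF \<phi>] z by simp
  finally show ?thesis .
qed

text \<open>All terms of the lacunary series have nonnegative real part after subtracting from the value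
  at the origin, so no cancellation can occur in the difference quotients.\<close>

lemma lacunary_not_differentiable:
  fixes \<omega> :: "nat \<Rightarrow> real"
  assumes c: "c > 0" and \<omega>: "\<And>k. \<bar>\<omega> k\<bar> \<ge> c * 4 ^ k"
  shows "\<not> (\<lambda>t. \<Sum>k. (1 / 2) ^ k * cis (\<omega> k * t)) differentiable (at 0)"
proof
  define v where "v = (\<lambda>t. \<Sum>k. (1 / 2) ^ k * cis (\<omega> k * t))"
  assume "(\<lambda>t. \<Sum>k. (1 / 2) ^ k * cis (\<omega> k * t)) differentiable (at 0)"
  then obtain D where "(v has_vector_derivative D) (at 0)"
    unfolding v_def[symmetric] by (auto simp: vector_derivative_works)
  then have "((\<lambda>h. (v (0 + h) - v 0) /\<^sub>R h - D) \<longlongrightarrow> 0) (at 0)"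
    unfolding has_vector_derivative_at_iff .
  then have "\<forall>\<^sub>F h in at 0. dist ((v (0 + h) - v 0) /\<^sub>R h - D) 0 < 1"
    by (rule tendstoD) simp
  then obtain e where e: "e > 0" "\<And>h. h \<noteq> 0 \<Longrightarrow> \<bar>h\<bar> < e \<Longrightarrow> norm ((v h - v 0) /\<^sub>R h - D) < 1"
    by (auto simp: eventually_at)
  have sumg: "summable (\<lambda>k. (1 / 2) ^ k * cis (\<omega> k * t))" for t
    by (rule summable_norm_cancel) (simp add: norm_mult norm_power norm_divide summable_geometric)
  \<comment> \<open>At t = pi / \<omega> j the j-th term is at its antipode and contributes 2 * (1 /
    2) ^ j; the other terms can only add to this.\<close>
  have low: "2 * (1 / 2) ^ j \<le> norm (v (pi / \<omega> j) - v 0)" for j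
  proof -
    have "c * 4 ^ j > 0" using c by simp
    then have w: "\<omega> j \<noteq> 0" using \<omega>[of j] by auto
    have "v 0 - v t = (\<Sum>k. (1 / 2) ^ k * cis (\<omega> k * 0) - (1 / 2) ^ k * cis (\<omega> k * t))" for t
      unfolding v_def by (rule suminf_diff[OF sumg sumg])
    then have "Re (v 0 - v t) = (\<Sum>k. Re ((1 / 2) ^ k * cis (\<omega> k * 0) - (1 / 2) ^ k * cis (\<omega> k * t)))" for t
      using bounded_linear.suminf[OF bounded_linear_Re summable_diff[OF sumg[of 0] sumg[of t]]] by simp
    then have re: "Re (v 0 - v t) = (\<Sum>k. (1 / 2) ^ k * (1 - cos (\<omega> k * t)))" for t
    proof -
      have "Re ((1 / 2) ^ k * cis (\<omega> k * 0) - (1 / 2) ^ k * cis (\<omega> k * t)) = (1 / 2) ^ k * (1 - cos (\<omega> k * t))" for k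
      proof -
        have "Re (complex_of_real r * cis x - complex_of_real r * cis y) = r * (cos x - cos y)" for r x y
          by (simp add: algebra_simps)
        from this[of "(1 / 2) ^ k" "\<omega> k * 0" "\<omega> k * t"] show ?thesis by simp
      qed
      then show ?thesis using \<open>\<And>t. Re (v 0 - v t) = _ t\<close> by simp
    qed
    have "(\<Sum>k\<in>{j}. (1 / 2) ^ k * (1 - cos (\<omega> k * (pi / \<omega> j)))) \<le> (\<Sum>k. (1 / 2) ^ k * (1 - cos (\<omega> k * (pi / \<omega> j))))"
    proof (rule sum_le_suminf)
      have "summable (\<lambda>k. (1 / 2) ^ k * 2 :: real)" by (intro summable_mult2 summable_geometric) simp
      then show "summable (\<lambda>k. (1 / 2) ^ k * (1 - cos (\<omega> k * (pi / \<omega> j))))"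
      proof (rule summable_comparison_test'[of _ 0])
        fix k
        have "\<bar>1 - cos (\<omega> k * (pi / \<omega> j))\<bar> \<le> 2"
          using cos_le_one[of "\<omega> k * (pi / \<omega> j)"] cos_ge_minus_one[of "\<omega> k * (pi / \<omega> j)"] by linarith
        then show "norm ((1 / 2) ^ k * (1 - cos (\<omega> k * (pi / \<omega> j)))) \<le> (1 / 2) ^ k * 2"
          by (simp add: abs_mult mult_left_mono)
      qed
    qed auto
    then have "2 * (1 / 2) ^ j \<le> Re (v 0 - v (pi / \<omega> j))" unfolding re using w by simp
    also have "\<dots> \<le> norm (v 0 - v (pi / \<omega> j))" by (rule complex_Re_le_cmod)
    finally show ?thesis by (simp add: norm_minus_commute)
  qed
  have pow: "\<exists>j. x < (2::real) ^ j" for x by (rule real_arch_pow) simp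
  \<comment> \<open>The first bound puts pi / \<omega> j inside the neighbourhood of radius e. The
    second makes the quotient, at least 2 c 2^j / pi, exceed the bound |D| + 1.\<close>
  obtain j where j: "max (pi / (c * e)) ((norm D + 1) * pi / c) < 2 ^ j" using pow by blast
  define t where "t = pi / \<omega> j"
  have w: "\<bar>\<omega> j\<bar> > 0" using \<omega>[of j] c by (smt (verit) mult_pos_pos zero_less_power)
  have t: "\<bar>t\<bar> \<le> pi / (c * 4 ^ j)" "t \<noteq> 0"
    unfolding t_def using \<omega>[of j] c w by (auto simp: abs_divide intro!: divide_left_mono mult_pos_pos)
  have "(2::real) ^ j \<le> 4 ^ j" by (intro power_mono) auto
  then have "pi / (c * 4 ^ j) \<le> pi / (c * 2 ^ j)" using c by (intro divide_left_mono mult_left_mono mult_pos_pos) auto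
  also have "\<dots> < e" using j c e(1) by (simp add: field_simps)
  finally have te: "\<bar>t\<bar> < e" using t(1) by simp
  have "norm ((v t - v 0) /\<^sub>R t) \<le> norm ((v t - v 0) /\<^sub>R t - D) + norm D"
    using norm_triangle_ineq[of "(v t - v 0) /\<^sub>R t - D" D] by simp
  then have "norm ((v t - v 0) /\<^sub>R t) \<le> norm D + 1" using e(2)[OF t(2) te] by simp
  then have "norm (v t - v 0) \<le> (norm D + 1) * \<bar>t\<bar>" using t(2) by (simp add: divide_inverse[symmetric] mult.commute[of "inverse _"] pos_divide_le_eq)
  also have "\<dots> \<le> (norm D + 1) * (pi / (c * 4 ^ j))" by (intro mult_left_mono t) auto
  finally have "2 * (1 / 2) ^ j \<le> (norm D + 1) * (pi / (c * 4 ^ j))" using low[of j] by (simp add: t_def)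
  then have "2 * (1 / 2) ^ j * 4 ^ j \<le> (norm D + 1) * pi / c" using c by (simp add: field_simps)
  moreover have "(1 / 2 :: real) ^ j * 4 ^ j = 2 ^ j" by (simp add: power_mult_distrib[symmetric])
  ultimately have "2 * 2 ^ j \<le> (norm D + 1) * pi / c" by (simp add: mult.assoc)
  moreover have "(2::real) ^ j > 0" by simp
  moreover have "(norm D + 1) * pi / c < 2 ^ j" using j by simp
  ultimately show False by linarith
qed

lemma (in scaling) elliptic_symbol_nonzero:
  assumes ell: "elliptic s m a" and \<xi>: "\<xi> \<noteq> 0"
  shows "symbol s m a \<xi> \<noteq> 0"
proof
  assume z: "symbol s m a \<xi> = 0"
  \<comment> \<open>Ratio 4 against weights (1 / 2) ^ k: the weights are summable, so u is
    continuous, while weight times frequency grows like 2 ^ k.\<close>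
  define \<zeta> where "\<zeta> = (\<lambda>k. dil s (4 ^ k) \<xi>)"
  have sz: "symbol s m a (\<zeta> k) = 0" for k by (simp add: \<zeta>_def symbol_dil z)
  define u where "u = (\<lambda>x. \<Sum>k. (1 / 2) ^ k * cis ((- \<zeta> k) \<bullet> x))"
  have nrm: "norm ((1 / 2) ^ k * cis ((- \<zeta> k) \<bullet> x)) = (1 / 2) ^ k" for k x
    by (simp add: norm_mult norm_power norm_divide)
  have geo: "summable (\<lambda>k. (1 / 2 :: real) ^ k)" by (rule summable_geometric) simp
  have bound: "norm (u x) \<le> 2" for x
  proof -
    have "norm (u x) \<le> (\<Sum>k. norm ((1 / 2) ^ k * cis ((- \<zeta> k) \<bullet> x)))"
      unfolding u_def by (rule summable_norm) (simp only: nrm geo)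
    also have "\<dots> = 2" unfolding nrm by (subst suminf_geometric) auto
    finally show ?thesis .
  qed
  have cont: "continuous_on UNIV u"
  proof -
    have "uniform_limit UNIV (\<lambda>n x. \<Sum>k<n. (1 / 2) ^ k * cis ((- \<zeta> k) \<bullet> x)) u sequentially"
      unfolding u_def by (rule Weierstrass_m_test[OF _ geo]) (simp only: nrm order_refl)
    then show ?thesis
      by (rule uniform_limit_theorem[rotated])
        (intro always_eventually allI continuous_on_sum continuous_on_mult continuous_cis_inner continuous_on_const trivial_limit_sequentially)+
  qed
  have "is_distribution UNIV (fun_distr u)" by (rule is_distribution_fun_distr[OF cont bound])
  moreover have "distr_smooth UNIV (opL_distr s m a (fun_distr u))"
    unfolding distr_smooth_def
  proof (intro exI[of _ "\<lambda>_. 0"] conjI allI impI smooth_const)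
    fix \<phi> :: "real^'n \<Rightarrow> complex" assume \<phi>: "test_fun UNIV \<phi>"
    have "opL_distr s m a (fun_distr u) \<phi> = (\<integral>x. u x * opL_t s m a \<phi> x \<partial>lborel)"
      unfolding opL_distr_def
      by (intro fun_distr_eq bounded_schwartz_integrable[OF cont bound] schwartz_opL_t test_fun_schwartz[OF \<phi>])
    also have "\<dots> = 0" unfolding u_def by (rule opL_t_zero_summation[OF sz test_fun_schwartz[OF \<phi>]])
    finally show "opL_distr s m a (fun_distr u) \<phi> = integral UNIV (\<lambda>y. 0 * \<phi> y)" by simp
  qed
  ultimately have "distr_smooth UNIV (fun_distr u)" using ell unfolding elliptic_def by blast
  then obtain g where g: "smooth g" "\<And>\<phi>. test_fun UNIV \<phi> \<Longrightarrow> fun_distr u \<phi> = fun_distr g \<phi>"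
    unfolding distr_smooth_def fun_distr_def by blast
  \<comment> \<open>Both u and g are continuous and define the same distribution, so they agree at
    every point and not just almost everywhere.\<close>
  have "u x - g x = 0" for x
  proof (rule fun_distr_unique[where h = "\<lambda>x. u x - g x"])
    show "continuous_on UNIV (\<lambda>x. u x - g x)" by (intro continuous_on_diff cont smooth_cont[OF g(1)])
    fix \<phi> :: "real^'n \<Rightarrow> complex" assume \<phi>: "test_fun UNIV \<phi>"
    have iu: "integrable lborel (\<lambda>y. u y * \<phi> y)" by (rule bounded_schwartz_integrable[OF cont bound test_fun_schwartz[OF \<phi>]])
    have cpt: "compact (closure {x. \<phi> x \<noteq> 0})" using \<phi> by (simp add: test_fun_def)
    have ig: "integrable lborel (\<lambda>y. g y * \<phi> y)"
    proof -
      have "continuous_on (closure {x. \<phi> x \<noteq> 0}) (\<lambda>y. g y * \<phi> y)"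
        by (rule continuous_on_subset[OF continuous_on_mult[OF smooth_cont[OF g(1)] schwartz_cont[OF test_fun_schwartz[OF \<phi>]]]]) simp
      then have "integrable lborel (\<lambda>y. indicator (closure {x. \<phi> x \<noteq> 0}) y *\<^sub>R (g y * \<phi> y))"
        using borel_integrable_compact[OF cpt] by (simp add: set_integrable_def)
      moreover have "indicator (closure {x. \<phi> x \<noteq> 0}) y *\<^sub>R (g y * \<phi> y) = g y * \<phi> y" for y
        using closure_subset[of "{x. \<phi> x \<noteq> 0}"] by (auto simp: indicator_def)
      ultimately show ?thesis by simp
    qed
    have "fun_distr (\<lambda>x. u x - g x) \<phi> = (\<integral>y. u y * \<phi> y - g y * \<phi> y \<partial>lborel)"
      by (subst fun_distr_eq) (auto simp: left_diff_distrib iu ig)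
    also have "\<dots> = fun_distr u \<phi> - fun_distr g \<phi>" by (simp add: iu ig fun_distr_eq)
    finally show "fun_distr (\<lambda>x. u x - g x) \<phi> = 0" using g(2)[OF \<phi>] by simp
  qed
  then have ug: "u = g" by (simp add: fun_eq_iff)
  \<comment> \<open>Along an axis in which \<xi> has a nonzero component the frequencies are \<xi> i
    times (4 ^ k) ^ s i up to sign, hence at least \<bar>\<xi> i\<bar> 4 ^ k in modulus as s i \<ge>
    1.\<close>
  obtain i where i: "\<xi> $ i \<noteq> 0" using \<xi> by (auto simp: vec_eq_iff)
  have "(\<lambda>t. pderivs [] g (0 + t *\<^sub>R axis i 1)) differentiable (at 0)"
    using g(1) unfolding smooth_on_def by blast
  then have "(\<lambda>t. u (t *\<^sub>R axis i 1)) differentiable (at 0)" by (simp add: ug)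
  moreover have "u (t *\<^sub>R axis i 1) = (\<Sum>k. (1 / 2) ^ k * cis ((- \<zeta> k $ i) * t))" for t
    unfolding u_def by (simp add: inner_axis mult.commute)
  ultimately have "(\<lambda>t. \<Sum>k. (1 / 2) ^ k * cis ((- \<zeta> k $ i) * t)) differentiable (at 0)" by simp
  moreover have "\<bar>- \<zeta> k $ i\<bar> \<ge> \<bar>\<xi> $ i\<bar> * 4 ^ k" for k
  proof -
    have "(4::real) ^ k \<le> (4 ^ k) ^ s i" using s_ge_1[of i] by (intro self_le_power) auto
    then show ?thesis by (simp add: \<zeta>_def abs_mult mult.commute mult_left_mono)
  qed
  ultimately show False using lacunary_not_differentiable[of "\<bar>\<xi> $ i\<bar>" "\<lambda>k. - \<zeta> k $ i"] i by simp
qed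

section \<open>Admissible functions and controlled kernels\<close>

lemma rescale_eq:
  assumes "lam > 0"
  shows "rescale s \<phi> x lam y = of_real (1 / lam ^ hdim s) * \<phi> (dil s (1 / lam) (y - x))"
proof -
  have p: "lam powr (- real k) = 1 / lam ^ k" for k
    using assms by (simp add: powr_minus powr_realpow divide_inverse)
  have "(\<chi> i. lam powr (- real (s i)) * (y $ i - x $ i)) = dil s (1 / lam) (y - x)"
    by (simp add: vec_eq_iff p power_one_over)
  then show ?thesis unfolding rescale_def by (simp add: p hdim_def[symmetric] del: of_nat_sum)
qed

text \<open>There are finitely many lists of length at most n, so one constant serves all
  derivatives; uniformity in y is required because \<open>controlled\<close> has one constant for a
  whole ball of centres.\<close>

lemma schwartz_uniform_bound:
  assumes "schwartz \<psi>"
  obtains C where "C \<ge> 0" "\<And>l x y. length l \<le> n \<Longrightarrow> norm y \<le> r \<Longrightarrow> norm (pderivs l \<psi> (x - y)) * (1 + norm x) ^ p \<le> C"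
proof -
  have "\<exists>C. C \<ge> 0 \<and> (\<forall>x y. norm y \<le> r \<longrightarrow> norm (pderivs l \<psi> (x + y)) * (1 + norm x) ^ p \<le> C)" for l
  proof -
    have "rdecay (pderivs l \<psi>)" using assms by (simp add: schwartz_def)
    then obtain C where "C \<ge> 0" "\<And>x y. norm y \<le> r \<Longrightarrow> norm (pderivs l \<psi> (x + y)) * (1 + norm x) ^ p \<le> C"
      using rdecay_shift_uniform[of "pderivs l \<psi>" r p] by metis
    then show ?thesis by blast
  qed
  then obtain D where D: "\<And>l. D l \<ge> 0" "\<And>l x y. norm y \<le> r \<Longrightarrow> norm (pderivs l \<psi> (x + y)) * (1 + norm x) ^ p \<le> D l"
    by metis
  have fin: "finite {l::'a list. length l \<le> n}" using finite_lists_length_le[of "UNIV :: 'a set" n] by simp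
  show ?thesis
  proof (rule that[of "\<Sum>l\<in>{l. length l \<le> n}. D l"])
    show "0 \<le> (\<Sum>l\<in>{l. length l \<le> n}. D l)" by (intro sum_nonneg D)
    fix l :: "'a list" and x y :: "real^'a" assume l: "length l \<le> n" and y: "norm y \<le> r"
    have "norm (pderivs l \<psi> (x + - y)) * (1 + norm x) ^ p \<le> D l" by (rule D(2)) (simp add: y)
    also have "D l \<le> (\<Sum>l\<in>{l. length l \<le> n}. D l)" by (rule member_le_sum) (use l fin D in auto)
    finally show "norm (pderivs l \<psi> (x - y)) * (1 + norm x) ^ p \<le> (\<Sum>l\<in>{l. length l \<le> n}. D l)" by simp
  qed
qed

text \<open>From here on ellipticity is present only as nonvanishing of the symbol away from
  0.\<close>

locale elliptic_germ = scaling s for s :: "'n::finite \<Rightarrow> nat" +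
  fixes m :: nat and a :: "('n \<Rightarrow> nat) \<Rightarrow> complex" and \<eta> :: real
  assumes symbol_nz: "\<xi> \<noteq> 0 \<Longrightarrow> symbol s m a \<xi> \<noteq> 0"
    and eta_pos: "0 < \<eta>" and eta_less: "\<eta> < real m" and eta_nat: "\<eta> \<notin> \<nat>"
begin

abbreviation Lt :: "(real^'n \<Rightarrow> complex) \<Rightarrow> real^'n \<Rightarrow> complex" where
  "Lt \<equiv> opL_t s m a"

text \<open>u models a germ member recentred at its base point 0 and rescaled. N stands for the germ
  norm, and A for the seminorm of the image germ, tested at 0 on all scales.\<close>

definition adm :: "(real^'n \<Rightarrow> complex) \<Rightarrow> real \<Rightarrow> real \<Rightarrow> bool" where
  "adm u N A \<longleftrightarrow> continuous_on UNIV u \<and> N \<ge> 0 \<and> A \<ge> 0 \<and> (\<forall>z. norm (u z) \<le> N * anorm z powr \<eta>) \<and>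
     (\<forall>\<phi>\<in>testB s (\<eta> - real m). \<forall>lam>0.
        norm (\<integral>z. u z * Lt (rescale s \<phi> 0 lam) z \<partial>lborel) \<le> A * lam powr (\<eta> - real m))"

text \<open>The error \<open>\<delta> * N\<close> is affordable because the germ norm is finite: it is absorbed at the
  very end.\<close>

definition controlled :: "real \<Rightarrow> (real^'n \<Rightarrow> complex) \<Rightarrow> bool" where
  "controlled r \<Phi> \<longleftrightarrow> (\<forall>\<delta>>0. \<exists>C\<ge>0. \<forall>u N A y. adm u N A \<longrightarrow> norm y \<le> r \<longrightarrow>
     norm (\<integral>z. u z * \<Phi> (z - y) \<partial>lborel) \<le> C * A + \<delta> * N)"

lemma weight_cont: "continuous_on UNIV (\<lambda>z. anorm z powr \<eta>)"
  using continuous_anorm_powr[of \<eta> 0] eta_pos by simp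

lemma weight_pgrow: "pgrow (\<lambda>z. anorm z powr \<eta>)"
  using pgrow_anorm_powr[of \<eta> 0] eta_pos by simp

lemma adm_pgrow:
  assumes "adm u N A" shows "pgrow u"
proof -
  have "pgrow (\<lambda>z. N * anorm z powr \<eta>)" by (intro pgrow_mult pgrow_const weight_pgrow)
  then show ?thesis by (rule pgrow_bound) (use assms in \<open>auto simp: adm_def abs_mult\<close>)
qed

lemma integrable_pgrow_schwartz:
  fixes u :: "real^'n \<Rightarrow> complex"
  assumes "continuous_on UNIV u" "pgrow u" "schwartz \<Phi>"
  shows "integrable lborel (\<lambda>z. u z * \<Phi> (z - y))"
  by (intro integrable_rdecay continuous_on_mult[OF assms(1) schwartz_cont[OF schwartz_shift[OF assms(3)]]]
      rdecay_mult[OF assms(2) schwartz_rdecay[OF schwartz_shift[OF assms(3)]]])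

lemma integrable_weight_schwartz:
  fixes w :: "real^'n \<Rightarrow> real"
  assumes "continuous_on UNIV w" "pgrow w" "schwartz \<Phi>"
  shows "integrable lborel (\<lambda>z. w z * norm (\<Phi> (z - y)))"
proof (intro integrable_rdecay continuous_on_mult[OF assms(1)] rdecay_mult[OF assms(2)])
  show "continuous_on UNIV (\<lambda>z. norm (\<Phi> (z - y)))"
    by (intro continuous_on_norm schwartz_cont[OF schwartz_shift[OF assms(3)]])
  show "rdecay (\<lambda>z. norm (\<Phi> (z - y)))"
    by (rule rdecay_bound[OF schwartz_rdecay[OF schwartz_shift[OF assms(3), of y]]]) simp
qed

lemma adm_integrable: "adm u N A \<Longrightarrow> schwartz \<Phi> \<Longrightarrow> integrable lborel (\<lambda>z. u z * \<Phi> (z - y))"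
  by (rule integrable_pgrow_schwartz) (auto simp: adm_pgrow, simp add: adm_def)

lemma adm_bound:
  assumes "adm u N A" "schwartz \<Phi>"
  shows "norm (\<integral>z. u z * \<Phi> (z - y) \<partial>lborel) \<le> N * (\<integral>z. anorm z powr \<eta> * norm (\<Phi> (z - y)) \<partial>lborel)"
proof -
  have "norm (\<integral>z. u z * \<Phi> (z - y) \<partial>lborel) \<le> (\<integral>z. norm (u z * \<Phi> (z - y)) \<partial>lborel)"
    by (rule integral_norm_bound)
  also have "\<dots> \<le> (\<integral>z. N * (anorm z powr \<eta> * norm (\<Phi> (z - y))) \<partial>lborel)"
  proof (rule integral_mono)
    show "integrable lborel (\<lambda>z. norm (u z * \<Phi> (z - y)))"
      by (rule integrable_norm[OF adm_integrable[OF assms]])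
    show "integrable lborel (\<lambda>z. N * (anorm z powr \<eta> * norm (\<Phi> (z - y))))"
      by (intro integrable_mult_right integrable_weight_schwartz weight_cont weight_pgrow assms)
    fix z
    have "norm (u z) \<le> N * anorm z powr \<eta>" using assms(1) by (simp add: adm_def)
    then have "norm (u z) * norm (\<Phi> (z - y)) \<le> (N * anorm z powr \<eta>) * norm (\<Phi> (z - y))"
      by (rule mult_right_mono) simp
    then show "norm (u z * \<Phi> (z - y)) \<le> N * (anorm z powr \<eta> * norm (\<Phi> (z - y)))"
      by (simp add: norm_mult mult.assoc)
  qed
  finally show ?thesis by simp
qed

text \<open>Half of \<delta> is granted to the controlled part and half to a remainder that is small
  in the weighted L1 norm, uniformly in the centre y.\<close>

lemma controlled_approx:
  assumes "\<And>\<epsilon>. \<epsilon> > 0 \<Longrightarrow> \<exists>\<Phi>1 \<Phi>2. schwartz \<Phi>1 \<and> schwartz \<Phi>2 \<and> \<Phi> = (\<lambda>z. \<Phi>1 z + \<Phi>2 z) \<and> controlled r \<Phi>1 \<and>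
     (\<forall>y. norm y \<le> r \<longrightarrow> (\<integral>z. anorm z powr \<eta> * norm (\<Phi>2 (z - y)) \<partial>lborel) \<le> \<epsilon>)"
  shows "controlled r \<Phi>"
  unfolding controlled_def
proof (intro allI impI)
  fix \<delta> :: real assume "\<delta> > 0"
  then have d2: "\<delta> / 2 > 0" by simp
  obtain \<Phi>1 \<Phi>2 where h: "schwartz \<Phi>1" "schwartz \<Phi>2" "\<Phi> = (\<lambda>z. \<Phi>1 z + \<Phi>2 z)" "controlled r \<Phi>1"
    "\<And>y. norm y \<le> r \<Longrightarrow> (\<integral>z. anorm z powr \<eta> * norm (\<Phi>2 (z - y)) \<partial>lborel) \<le> \<delta> / 2"
    using assms[OF d2] by blast
  obtain C where C: "C \<ge> 0" "\<And>u N A y. adm u N A \<Longrightarrow> norm y \<le> r \<Longrightarrow>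
     norm (\<integral>z. u z * \<Phi>1 (z - y) \<partial>lborel) \<le> C * A + \<delta> / 2 * N"
    using h(4) d2 unfolding controlled_def by meson
  have "norm (\<integral>z. u z * \<Phi> (z - y) \<partial>lborel) \<le> C * A + \<delta> * N" if u: "adm u N A" and y: "norm y \<le> r" for u N A y
  proof -
    have "(\<integral>z. u z * \<Phi> (z - y) \<partial>lborel) = (\<integral>z. u z * \<Phi>1 (z - y) \<partial>lborel) + (\<integral>z. u z * \<Phi>2 (z - y) \<partial>lborel)"
      unfolding h(3) by (simp add: distrib_left adm_integrable[OF u] h)
    then have "norm (\<integral>z. u z * \<Phi> (z - y) \<partial>lborel) \<le> norm (\<integral>z. u z * \<Phi>1 (z - y) \<partial>lborel) + norm (\<integral>z. u z * \<Phi>2 (z - y) \<partial>lborel)"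
      by (simp add: norm_triangle_ineq)
    also have "\<dots> \<le> (C * A + \<delta> / 2 * N) + N * (\<delta> / 2)"
    proof (intro add_mono C(2)[OF u y] order_trans[OF adm_bound[OF u h(2)]] mult_left_mono h(5)[OF y])
      show "0 \<le> N" using u by (simp add: adm_def)
    qed
    also have "\<dots> = C * A + \<delta> * N" by (simp add: algebra_simps)
    finally show ?thesis .
  qed
  with C(1) show "\<exists>C\<ge>0. \<forall>u N A y. adm u N A \<longrightarrow> norm y \<le> r \<longrightarrow>
     norm (\<integral>z. u z * \<Phi> (z - y) \<partial>lborel) \<le> C * A + \<delta> * N" by blast
qed

text \<open>A dilation and a scalar bring f into the class of normalised test functions; the
  constant C undoes both, and depends on f only through R and K.\<close>

lemma test_function_bound:
  assumes R: "R \<ge> 0" and K: "K \<ge> 0"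
  shows "\<exists>C\<ge>0. \<forall>f u N A. smooth f \<longrightarrow> (\<forall>x. norm x \<ge> R \<longrightarrow> f x = 0) \<longrightarrow>
     (\<forall>l x. length l \<le> nat \<lceil>\<bar>\<eta> - real m\<bar>\<rceil> \<longrightarrow> norm (pderivs l f x) \<le> K) \<longrightarrow> adm u N A \<longrightarrow>
     norm (\<integral>z. u z * Lt f z \<partial>lborel) \<le> C * A"
proof -
  define k where "k = nat \<lceil>\<bar>\<eta> - real m\<bar>\<rceil>"
  \<comment> \<open>By \<open>anorm_le\<close> the support of f has \<open>anorm\<close> at most
    CARD('n) * (1 + R). The additional 1 leaves room to the unit sphere, so that also the closure of
    the rescaled support lies in the open ball; it also gives lam \<ge> 1.\<close>
  define lam where "lam = real CARD('n) * (1 + R) + 1"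
  have "0 \<le> real CARD('n) * (1 + R)" using R by simp
  then have lam: "lam \<ge> 1" "lam > 0" by (auto simp: lam_def)
  \<comment> \<open>A derivative of degree at most k of the dilated f gains at most lam ^ k; the
    summand 1 keeps c positive when K = 0.\<close>
  define c where "c = lam ^ k * K + 1"
  have c: "c > 0" using lam K by (auto simp: c_def intro!: add_nonneg_pos)
  define C where "C = c * lam ^ hdim s * lam powr (\<eta> - real m)"
  have "C \<ge> 0" using c lam by (simp add: C_def)
  moreover have "norm (\<integral>z. u z * Lt f z \<partial>lborel) \<le> C * A"
    if f: "smooth f" "\<And>x. norm x \<ge> R \<Longrightarrow> f x = 0"
      "\<And>l x. length l \<le> nat \<lceil>\<bar>\<eta> - real m\<bar>\<rceil> \<Longrightarrow> norm (pderivs l f x) \<le> K" and u: "adm u N A" for f u N A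
  proof -
    define \<phi> where "\<phi> = (\<lambda>w. of_real (1 / c) * f (dil s lam w))"
    have sf: "smooth (\<lambda>w. f (dil s lam w))" unfolding dil_def by (rule smooth_diag_aff[OF f(1)])
    have s\<phi>: "smooth \<phi>" unfolding \<phi>_def by (rule smooth_cmult[OF sf])
    define q where "q = real CARD('n) * (1 + R) / lam"
    have q: "q < 1" using lam by (simp add: q_def lam_def)
    have sub: "{w. \<phi> w \<noteq> 0} \<subseteq> {w. anorm w \<le> q}"
    proof clarify
      fix w assume "\<phi> w \<noteq> 0"
      then have "norm (dil s lam w) < R" using f(2)[of "dil s lam w"] by (auto simp: \<phi>_def not_le[symmetric])
      then have "real CARD('n) * (1 + norm (dil s lam w)) \<le> real CARD('n) * (1 + R)" by (intro mult_left_mono) auto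
      then have "lam * anorm w \<le> real CARD('n) * (1 + R)"
        using anorm_le[of "dil s lam w"] anorm_dil[OF lam(2), of w] by linarith
      then show "anorm w \<le> q" using lam by (simp add: q_def pos_le_divide_eq mult.commute)
    qed
    have "closed {w. anorm w \<le> q}" by (intro closed_Collect_le continuous_anorm continuous_intros)
    with sub have cl: "closure {w. \<phi> w \<noteq> 0} \<subseteq> {w. anorm w \<le> q}" by (rule closure_minimal)
    have bd: "bounded {w. anorm w \<le> q}"
    proof (rule boundedI)
      fix w assume "w \<in> {w. anorm w \<le> q}"
      then have w: "anorm w \<le> 1" using q by simp
      have "norm w \<le> (\<Sum>i\<in>UNIV. \<bar>w $ i\<bar>)" by (rule norm_le_l1_cart)
      also have "\<dots> \<le> (\<Sum>i\<in>(UNIV::'n set). 1)"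
        by (intro sum_mono order_trans[OF component_le_anorm] power_le_one w aniso_dist_nonneg)
      finally show "norm w \<le> real CARD('n)" by simp
    qed
    have "\<phi> \<in> testB s (\<eta> - real m)"
      unfolding testB_def
    proof (intro CollectI conjI allI impI s\<phi>)
      show "compact (closure {x. \<phi> x \<noteq> 0})"
        using bounded_subset[OF bd cl] by (simp add: compact_eq_bounded_closed)
      show "closure {x. \<phi> x \<noteq> 0} \<subseteq> aniso_ball s 0 1"
        using cl q by (auto simp: aniso_ball_def)
      fix \<beta> y assume \<beta>: "aniso_deg s \<beta> \<le> nat \<lceil>\<bar>\<eta> - real m\<bar>\<rceil>"
      define l where "l = mlist \<beta>"
      have l: "ldeg s l \<le> k" "length l \<le> k"
        using \<beta> length_le_ldeg[of l] ldeg_mlist[of \<beta>] by (auto simp: k_def l_def)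
      have "pderivs l \<phi> y = of_real (1 / c) * (of_real (lam ^ ldeg s l) * pderivs l f (dil s lam y))"
        unfolding \<phi>_def using pderivs_cmult[OF sf, of l "of_real (1 / c)"] pderivs_diag_aff[OF f(1), of l "\<lambda>i. lam ^ s i" 0]
        by (simp add: dil_def prod_list_dil)
      then have "norm (pderivs l \<phi> y) = (1 / c) * (lam ^ ldeg s l * norm (pderivs l f (dil s lam y)))"
        using c lam by (simp add: norm_mult norm_power norm_divide)
      also have "\<dots> \<le> (1 / c) * (lam ^ k * K)"
        using c lam l by (intro mult_left_mono mult_mono power_increasing f(3)) (auto simp: k_def)
      also have "\<dots> \<le> 1" using c by (simp add: c_def)
      finally show "norm (pdiff \<beta> \<phi> y) \<le> 1" by (simp add: pdiff_mlist l_def)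
    qed
    then have "norm (\<integral>z. u z * Lt (rescale s \<phi> 0 lam) z \<partial>lborel) \<le> A * lam powr (\<eta> - real m)"
      using u lam(2) by (auto simp: adm_def)
    moreover have "Lt (rescale s \<phi> 0 lam) z = of_real (1 / (c * lam ^ hdim s)) * Lt f z" for z
    proof -
      have "rescale s \<phi> 0 lam = (\<lambda>y. of_real (1 / (c * lam ^ hdim s)) * f y)"
        by (auto simp: rescale_eq[OF lam(2)] \<phi>_def dil_inverse[OF lam(2)])
      then show ?thesis by (simp only: opL_t_cmult[OF f(1)])
    qed
    ultimately have "norm (\<integral>z. of_real (1 / (c * lam ^ hdim s)) * (u z * Lt f z) \<partial>lborel) \<le> A * lam powr (\<eta> - real m)"
      by (simp add: mult.left_commute)
    then have "(1 / (c * lam ^ hdim s)) * norm (\<integral>z. u z * Lt f z \<partial>lborel) \<le> A * lam powr (\<eta> - real m)"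
      using c lam by (simp add: norm_mult norm_divide norm_power)
    then have "norm (\<integral>z. u z * Lt f z \<partial>lborel) \<le> A * lam powr (\<eta> - real m) * (c * lam ^ hdim s)"
      using c lam by (simp add: pos_divide_le_eq)
    then show ?thesis by (simp add: C_def mult_ac)
  qed
  ultimately show ?thesis by (intro exI[of _ C]) auto
qed

lemma pderivs_const: "l \<noteq> [] \<Longrightarrow> pderivs l (\<lambda>x::real^'n. c) = (\<lambda>x. 0)"
proof (induction l)
  case (Cons i l)
  then show ?case
    using has_pd_partial[OF has_pd_const[of i c]] has_pd_partial[OF has_pd_const[of i 0]] by (cases "l = []") auto
qed simp

text \<open>Every derivative of the dilated cutoff brings a factor 1 / \<mu>. The undifferentiated
  complement gains this factor only at the price of a weight 1 + |z|, through
  \<open>bump_near_1\<close>.\<close>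

lemma cutoff_complement_bound:
  obtains E where "E \<ge> 0" "\<And>\<mu> l z. \<mu> \<ge> 1 \<Longrightarrow> length l \<le> n \<Longrightarrow>
     norm (pderivs l (\<lambda>x::real^'n. 1 + (-1) * of_real (bump_real ((1 / \<mu>) *\<^sub>R x))) z) \<le> E * (1 + norm z) / \<mu>"
proof -
  define cut where "cut = (\<lambda>x::real^'n. complex_of_real (bump_real x))"
  have scut: "smooth cut" unfolding cut_def by (rule smooth_bump)
  have "schwartz cut" by (rule schwartz_compact_support[OF scut, of 1]) (simp add: cut_def bump_outside)
  then obtain B where B: "B \<ge> 0" "\<And>l x y. length l \<le> n \<Longrightarrow> norm y \<le> 0 \<Longrightarrow> norm (pderivs l cut (x - y)) * (1 + norm x) ^ 0 \<le> B"
    using schwartz_uniform_bound[of cut n 0 0] by metis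
  show ?thesis
  proof (rule that[of "2 + B"])
    fix \<mu> :: real and l :: "'n list" and z :: "real^'n" assume \<mu>: "\<mu> \<ge> 1" and l: "length l \<le> n"
    have ss: "smooth (\<lambda>x. cut (diag_aff (\<lambda>_. 1 / \<mu>) 0 x))" by (rule smooth_diag_aff[OF scut])
    show "norm (pderivs l (\<lambda>x. 1 + (-1) * of_real (bump_real ((1 / \<mu>) *\<^sub>R x))) z) \<le> (2 + B) * (1 + norm z) / \<mu>"
    proof (cases "l = []")
      case True
      have "norm (1 + (-1) * complex_of_real (bump_real ((1 / \<mu>) *\<^sub>R z))) = \<bar>1 - bump_real ((1 / \<mu>) *\<^sub>R z)\<bar>"
        by (metis (no_types) diff_conv_add_uminus mult_minus1 norm_of_real of_real_1 of_real_diff)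
      also have "\<dots> \<le> 2 * norm ((1 / \<mu>) *\<^sub>R z)" by (rule bump_near_1)
      also have "\<dots> = 2 * norm z / \<mu>" using \<mu> by simp
      also have "\<dots> \<le> (2 + B) * (1 + norm z) / \<mu>"
        using \<mu> B(1) by (intro divide_right_mono mult_mono) auto
      finally show ?thesis by (simp add: True)
    next
      case False
      have "pderivs l (\<lambda>x. 1 + (-1) * cut (diag_aff (\<lambda>_. 1 / \<mu>) 0 x)) z = (-1) * (of_real (\<Prod>i\<leftarrow>l. 1 / \<mu>) * pderivs l cut (diag_aff (\<lambda>_. 1 / \<mu>) 0 z))"
        by (simp only: pderivs_add[OF smooth_const smooth_cmult[OF ss]] pderivs_cmult[OF ss] pderivs_diag_aff[OF scut] pderivs_const[OF False]) simp
      then have "norm (pderivs l (\<lambda>x. 1 + (-1) * of_real (bump_real ((1 / \<mu>) *\<^sub>R x))) z)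
          = (1 / \<mu>) ^ length l * norm (pderivs l cut (diag_aff (\<lambda>_. 1 / \<mu>) 0 z))"
        using \<mu> by (simp add: cut_def diag_aff_scale norm_mult map_replicate_const prod_list_replicate norm_power norm_divide)
      also have "\<dots> \<le> (1 / \<mu>) ^ 1 * B"
      proof (rule mult_mono)
        show "(1 / \<mu>) ^ length l \<le> (1 / \<mu>) ^ 1"
          using \<mu> False by (intro power_decreasing) (auto simp: Suc_le_eq)
        show "norm (pderivs l cut (diag_aff (\<lambda>_. 1 / \<mu>) 0 z)) \<le> B" using B(2)[OF l, of 0] by simp
      qed (use \<mu> in auto)
      also have "\<dots> \<le> (2 + B) * (1 + norm z) / \<mu>"
      proof -
        have "B * 1 \<le> (2 + B) * (1 + norm z)" using B(1) by (intro mult_mono) auto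
        then show ?thesis using \<mu> by (simp add: divide_right_mono)
      qed
      finally show ?thesis .
    qed
  qed (use B in simp)
qed

lemma weight_decay_bound:
  obtains W q where "W \<ge> 0" "\<And>z::real^'n. anorm z powr \<eta> \<le> W * (1 + norm z) ^ q"
proof -
  obtain W q where "W \<ge> 0" "\<And>z. norm (anorm z powr \<eta>) \<le> W * (1 + norm z) ^ q"
    using pgrowE[OF weight_pgrow] by metis
  then show ?thesis using that[of W q] by simp
qed

text \<open>The seminorm sees compactly supported functions only, so \<psi> is cut off at radius
  \<mu>. The part inside is paid by A with a constant depending on \<mu>; the tail is paid by N with
  a factor of order 1 / \<mu>, which is what the error term permits.\<close>

lemma controlled_Lt:
  assumes \<psi>: "schwartz \<psi>"
  shows "controlled r (Lt \<psi>)"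
  unfolding controlled_def
proof (intro allI impI)
  fix \<delta> :: real assume \<delta>: "\<delta> > 0"
  \<comment> \<open>Large enough both for the derivatives in the operator, whose length is at most
    m, and for those in the norm of the test class.\<close>
  define n where "n = max m (nat \<lceil>\<bar>\<eta> - real m\<bar>\<rceil>)"
  obtain W q where W: "W \<ge> 0" "\<And>z::real^'n. anorm z powr \<eta> \<le> W * (1 + norm z) ^ q"
    using weight_decay_bound by metis
  define d where "d = 2 * CARD('n)"
  \<comment> \<open>The weight q is for the growth of \<open>anorm\<close> to the power \<eta>, 1
    for the growth of the cutoff complement, and d for integrability.\<close>
  obtain C where C: "C \<ge> 0" "\<And>l x y. length l \<le> n \<Longrightarrow> norm y \<le> r \<Longrightarrow> norm (pderivs l \<psi> (x - y)) * (1 + norm x) ^ (q + 1 + d) \<le> C"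
    using schwartz_uniform_bound[OF \<psi>] by metis
  obtain E where E: "E \<ge> 0" "\<And>\<mu> l z. \<mu> \<ge> 1 \<Longrightarrow> length l \<le> n \<Longrightarrow>
     norm (pderivs l (\<lambda>x::real^'n. 1 + (-1) * of_real (bump_real ((1 / \<mu>) *\<^sub>R x))) z) \<le> E * (1 + norm z) / \<mu>"
    using cutoff_complement_bound by metis
  define G where "G = (\<Sum>\<gamma>\<in>{\<gamma>. aniso_deg s \<gamma> = m}. norm (opl_coeff a \<gamma>))"
  have G: "G \<ge> 0" by (simp add: G_def sum_nonneg)
  define J where "J = (\<integral>z. 1 / (1 + norm (z::real^'n)) ^ d \<partial>lborel)"
  have J: "J \<ge> 0" by (simp add: J_def)
  define T where "T = W * (G * (2 ^ n * C * E))"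
  have T: "T \<ge> 0" using W C E G by (simp add: T_def)
  \<comment> \<open>T * J / \<mu> is the factor of N in the tail.\<close>
  define \<mu> where "\<mu> = max 1 (T * J / \<delta>)"
  have \<mu>: "\<mu> \<ge> 1" "T * J / \<mu> \<le> \<delta>"
  proof -
    show "\<mu> \<ge> 1" by (simp add: \<mu>_def)
    have "T * J / \<delta> \<le> \<mu>" by (simp add: \<mu>_def)
    then show "T * J / \<mu> \<le> \<delta>" using \<delta> \<open>\<mu> \<ge> 1\<close> by (simp add: field_simps)
  qed
  define cut where "cut = (\<lambda>x::real^'n. complex_of_real (bump_real ((1 / \<mu>) *\<^sub>R x)))"
  define e where "e = (\<lambda>x::real^'n. 1 + (-1) * cut x)"
  have scut: "smooth cut" unfolding cut_def using smooth_bump_scaled[of "1 / \<mu>" 0] by simp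
  have se: "smooth e" unfolding e_def by (intro smooth_add smooth_const smooth_cmult scut)
  have zcut: "cut x = 0" if "norm x \<ge> \<mu>" for x
    unfolding cut_def using that \<mu>(1) by (simp add: bump_outside)
  have "schwartz cut" by (rule schwartz_compact_support[OF scut zcut])
  then obtain B where B: "B \<ge> 0" "\<And>l x y. length l \<le> n \<Longrightarrow> norm y \<le> 0 \<Longrightarrow> norm (pderivs l cut (x - y)) * (1 + norm x) ^ 0 \<le> B"
    using schwartz_uniform_bound[of cut n 0 0] by metis
  have \<mu>0: "\<mu> \<ge> 0" and K0: "2 ^ n * B * C \<ge> 0" using \<mu> B C by auto
  \<comment> \<open>This constant is fixed before u and y: for every y in the ball the truncated
    function vanishes beyond radius \<mu> and its derivatives are bounded by 2 ^ n * B * C.\<close>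
  obtain C' where C': "C' \<ge> 0" "\<forall>f u N A. smooth f \<longrightarrow> (\<forall>x. norm x \<ge> \<mu> \<longrightarrow> f x = 0) \<longrightarrow>
     (\<forall>l x. length l \<le> nat \<lceil>\<bar>\<eta> - real m\<bar>\<rceil> \<longrightarrow> norm (pderivs l f x) \<le> 2 ^ n * B * C) \<longrightarrow> adm u N A \<longrightarrow>
     norm (\<integral>z. u z * Lt f z \<partial>lborel) \<le> C' * A"
    using test_function_bound[OF \<mu>0 K0] by auto
  have "norm (\<integral>z. u z * Lt \<psi> (z - y) \<partial>lborel) \<le> C' * A + \<delta> * N" if u: "adm u N A" and y: "norm y \<le> r" for u N A y
  proof -
    define \<psi>y where "\<psi>y = (\<lambda>z. \<psi> (z - y))"
    have S: "schwartz \<psi>y" unfolding \<psi>y_def by (rule schwartz_shift[OF \<psi>])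
    have s: "smooth \<psi>y" by (rule schwartz_smooth[OF S])
    have nb: "norm (pderivs l \<psi>y x) * (1 + norm x) ^ (q + 1 + d) \<le> C" if "length l \<le> n" for l x
      unfolding \<psi>y_def pderivs_shift[OF schwartz_smooth[OF \<psi>]] by (rule C(2)[OF that y])
    have nb1: "norm (pderivs l \<psi>y x) \<le> C" if "length l \<le> n" for l x
    proof -
      have "norm (pderivs l \<psi>y x) * 1 \<le> norm (pderivs l \<psi>y x) * (1 + norm x) ^ (q + 1 + d)"
        by (intro mult_left_mono one_le_power) auto
      with nb[OF that, of x] show ?thesis by simp
    qed
    have sf: "smooth (\<lambda>z. cut z * \<psi>y z)" by (rule smooth_mult[OF scut s])
    have sg: "smooth (\<lambda>z. e z * \<psi>y z)" by (rule smooth_mult[OF se s])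
    have "schwartz (\<lambda>z. cut z * \<psi>y z)" by (rule schwartz_compact_support[OF sf, of \<mu>]) (simp add: zcut)
    have ee: "(\<lambda>z. e z * \<psi>y z) = (\<lambda>z. \<psi>y z + (-1) * (cut z * \<psi>y z))"
      by (rule ext) (simp add: e_def algebra_simps)
    have Sg: "schwartz (\<lambda>z. e z * \<psi>y z)"
      unfolding ee by (rule schwartz_add[OF S schwartz_cmult[OF \<open>schwartz (\<lambda>z. cut z * \<psi>y z)\<close>, of "-1"]])
    have split: "Lt \<psi> (z - y) = Lt (\<lambda>z. cut z * \<psi>y z) z + Lt (\<lambda>z. e z * \<psi>y z) z" for z
    proof -
      have "\<psi>y = (\<lambda>z. cut z * \<psi>y z + e z * \<psi>y z)" by (rule ext) (simp add: e_def algebra_simps)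
      then have "Lt \<psi>y = Lt (\<lambda>z. cut z * \<psi>y z + e z * \<psi>y z)" by (rule arg_cong)
      moreover have "Lt \<psi>y z = Lt \<psi> (z - y)" unfolding \<psi>y_def opL_t_shift[OF schwartz_smooth[OF \<psi>]] ..
      ultimately show ?thesis by (simp add: opL_t_add[OF sf sg])
    qed
    have i1: "integrable lborel (\<lambda>z. u z * Lt (\<lambda>z. cut z * \<psi>y z) z)"
      using adm_integrable[OF u schwartz_opL_t[OF \<open>schwartz (\<lambda>z. cut z * \<psi>y z)\<close>], where y = 0] by simp
    have i2: "integrable lborel (\<lambda>z. u z * Lt (\<lambda>z. e z * \<psi>y z) z)"
      using adm_integrable[OF u schwartz_opL_t[OF Sg], where y = 0] by simp
    have "norm (\<integral>z. u z * Lt (\<lambda>z. cut z * \<psi>y z) z \<partial>lborel) \<le> C' * A"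
    proof (rule C'(2)[rule_format, OF sf _ _ u])
      fix l :: "'n list" and x assume l: "length l \<le> nat \<lceil>\<bar>\<eta> - real m\<bar>\<rceil>"
      have B': "norm (pderivs l cut x) \<le> B" if "length l \<le> n" for l using B(2)[OF that, of 0 x] by simp
      show "norm (pderivs l (\<lambda>z. cut z * \<psi>y z) x) \<le> 2 ^ n * B * C"
        by (rule pderivs_mult_bound[OF scut s B' nb1]) (use l in \<open>auto simp: n_def\<close>)
    qed (simp add: zcut)
    moreover have "norm (\<integral>z. u z * Lt (\<lambda>z. e z * \<psi>y z) z \<partial>lborel) \<le> \<delta> * N"
    proof -
      have N: "N \<ge> 0" using u by (simp add: adm_def)
      have pt: "anorm z powr \<eta> * norm (Lt (\<lambda>z. e z * \<psi>y z) z) \<le> (T / \<mu>) * (1 / (1 + norm z) ^ d)" for z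
      proof -
        define h where "h = 1 + norm z"
        have h: "h > 0" by (simp add: h_def add_pos_nonneg)
        have "norm (pderivs l (\<lambda>z. e z * \<psi>y z) z) \<le> 2 ^ n * (E * h / \<mu>) * (C / h ^ (q + 1 + d))" if "length l \<le> n" for l
        proof (rule pderivs_mult_bound[OF se s])
          show "norm (pderivs l e z) \<le> E * h / \<mu>" if "length l \<le> n" for l
            using E(2)[OF \<mu>(1) that, of z] by (simp add: e_def cut_def h_def)
          show "norm (pderivs l \<psi>y z) \<le> C / h ^ (q + 1 + d)" if "length l \<le> n" for l
            using nb[OF that, of z] h by (simp add: h_def[symmetric] pos_le_divide_eq)
        qed (rule that)
        moreover have "2 ^ n * (E * h / \<mu>) * (C / h ^ (q + 1 + d)) = (2 ^ n * C * E / \<mu>) * (1 / h ^ (q + d))"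
          using h by (simp add: power_add field_simps)
        ultimately have pb: "norm (pderivs l (\<lambda>z. e z * \<psi>y z) z) \<le> (2 ^ n * C * E / \<mu>) * (1 / h ^ (q + d))" if "length l \<le> n" for l
          using that by simp
        have lm: "length (mlist \<gamma>) \<le> n" if "aniso_deg s \<gamma> = m" for \<gamma>
          using length_le_ldeg[of "mlist \<gamma>"] that by (simp add: ldeg_mlist n_def)
        have "norm (Lt (\<lambda>z. e z * \<psi>y z) z) \<le> (\<Sum>\<gamma>\<in>{\<gamma>. aniso_deg s \<gamma> = m}. norm (opl_coeff a \<gamma>) * ((2 ^ n * C * E / \<mu>) * (1 / h ^ (q + d))))"
          unfolding opL_t_pderivs
        proof (intro order_trans[OF norm_sum] sum_mono)
          fix \<gamma> assume "\<gamma> \<in> {\<gamma>. aniso_deg s \<gamma> = m}"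
          then have "length (mlist \<gamma>) \<le> n" using lm by simp
          from mult_left_mono[OF pb[OF this] norm_ge_zero, of "opl_coeff a \<gamma>"]
          show "norm (opl_coeff a \<gamma> * pderivs (mlist \<gamma>) (\<lambda>z. e z * \<psi>y z) z) \<le> norm (opl_coeff a \<gamma>) * ((2 ^ n * C * E / \<mu>) * (1 / h ^ (q + d)))"
            by (simp only: norm_mult)
        qed
        also have "\<dots> = G * ((2 ^ n * C * E / \<mu>) * (1 / h ^ (q + d)))" unfolding G_def by (rule sum_distrib_right[symmetric])
        finally have "anorm z powr \<eta> * norm (Lt (\<lambda>z. e z * \<psi>y z) z) \<le> (W * h ^ q) * (G * ((2 ^ n * C * E / \<mu>) * (1 / h ^ (q + d))))"
          using W h by (intro mult_mono) (auto simp: h_def)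
        also have "\<dots> = (T / \<mu>) * (1 / h ^ d)" using h by (simp add: T_def power_add)
        finally show ?thesis by (simp add: h_def)
      qed
      have "norm (\<integral>z. u z * Lt (\<lambda>z. e z * \<psi>y z) (z - 0) \<partial>lborel) \<le> N * (\<integral>z. anorm z powr \<eta> * norm (Lt (\<lambda>z. e z * \<psi>y z) (z - 0)) \<partial>lborel)"
        by (rule adm_bound[OF u schwartz_opL_t[OF Sg]])
      also have "\<dots> \<le> N * (\<integral>z. (T / \<mu>) * (1 / (1 + norm (z::real^'n)) ^ d) \<partial>lborel)"
      proof (intro mult_left_mono[OF _ N] integral_mono)
        show "integrable lborel (\<lambda>z. anorm z powr \<eta> * norm (Lt (\<lambda>z. e z * \<psi>y z) (z - 0)))"
          by (rule integrable_weight_schwartz[OF weight_cont weight_pgrow schwartz_opL_t[OF Sg]])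
        show "integrable lborel (\<lambda>z::real^'n. (T / \<mu>) * (1 / (1 + norm z) ^ d))"
          unfolding d_def by (intro integrable_mult_right integrable_weight)
      qed (use pt in simp)
      also have "\<dots> = N * (T * J / \<mu>)" unfolding J_def by (subst integral_mult_right_zero) simp
      also have "\<dots> \<le> N * \<delta>" by (rule mult_left_mono[OF \<mu>(2) N])
      finally show ?thesis by (simp add: mult.commute)
    qed
    ultimately show ?thesis
      unfolding split distrib_left Bochner_Integration.integral_add[OF i1 i2]
      by (intro order_trans[OF norm_triangle_ineq] add_mono)
  qed
  with C'(1) show "\<exists>C\<ge>0. \<forall>u N A y. adm u N A \<longrightarrow> norm y \<le> r \<longrightarrow> norm (\<integral>z. u z * Lt \<psi> (z - y) \<partial>lborel) \<le> C * A + \<delta> * N"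
    by blast
qed

text \<open>Fundamental theorem of calculus in the centre of the kernel: the pairing at y is the one
  at 0 plus increments along coordinate directions, whose rates are pairings with the first partial
  derivatives.\<close>

lemma controlled_from_partials:
  assumes \<Phi>: "schwartz \<Phi>" and r: "r \<ge> 0" and c0: "controlled 0 \<Phi>" and ci: "\<And>i. controlled r (partial i \<Phi>)"
  shows "controlled r \<Phi>"
  unfolding controlled_def
proof (intro allI impI)
  fix \<delta> :: real assume \<delta>: "\<delta> > 0"
  define n where "n = real CARD('n)"
  \<comment> \<open>One share for the pairing at 0 and r shares for each of the n coordinate
    segments, of length at most r.\<close>
  define \<delta>' where "\<delta>' = \<delta> / (1 + n * r)"
  have nr: "1 + n * r > 0" using r by (simp add: n_def add_pos_nonneg)
  have \<delta>': "\<delta>' > 0" using \<delta> nr by (simp add: \<delta>'_def)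
  obtain C where C: "C \<ge> 0" "\<And>u N A y. adm u N A \<Longrightarrow> norm y \<le> 0 \<Longrightarrow> norm (\<integral>z. u z * \<Phi> (z - y) \<partial>lborel) \<le> C * A + \<delta>' * N"
    using c0 \<delta>' unfolding controlled_def by meson
  have "\<forall>i. \<exists>D\<ge>0. \<forall>u N A y. adm u N A \<longrightarrow> norm y \<le> r \<longrightarrow> norm (\<integral>z. u z * partial i \<Phi> (z - y) \<partial>lborel) \<le> D * A + \<delta>' * N"
    using ci \<delta>' unfolding controlled_def by meson
  then obtain D where D: "\<And>i. D i \<ge> 0" "\<And>i u N A y. adm u N A \<Longrightarrow> norm y \<le> r \<Longrightarrow> norm (\<integral>z. u z * partial i \<Phi> (z - y) \<partial>lborel) \<le> D i * A + \<delta>' * N"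
    by metis
  have "norm (\<integral>z. u z * \<Phi> (z - y) \<partial>lborel) \<le> (C + (\<Sum>i\<in>UNIV. r * D i)) * A + \<delta> * N"
    if u: "adm u N A" and y: "norm y \<le> r" for u N A y
  proof -
    define V where "V = (\<lambda>p. \<integral>z. u z * \<Phi> (z - p) \<partial>lborel)"
    have der: "((\<lambda>t. V (p + t *\<^sub>R axis i 1)) has_vector_derivative - (\<integral>z. u z * partial i \<Phi> (z - (p + t *\<^sub>R axis i 1)) \<partial>lborel)) (at t)" for p i t
    proof -
      obtain Cu q where Cu: "Cu \<ge> 0" "\<And>z. norm (u z) \<le> Cu * (1 + norm z) ^ q" using pgrowE[OF adm_pgrow[OF u]] by metis
      have "rdecay (partial i \<Phi>)" by (rule schwartz_rdecay[OF schwartz_partial[OF \<Phi>]])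
      \<comment> \<open>The radius covers all centres with parameter within 1 of t. The exponent
        compensates the growth q of u and leaves an integrable weight.\<close>
      then obtain E where E: "E \<ge> 0" "\<And>x b. norm b \<le> norm p + \<bar>t\<bar> + 1 \<Longrightarrow> norm (partial i \<Phi> (x + b)) * (1 + norm x) ^ (q + 2 * CARD('n)) \<le> E"
        using rdecay_shift_uniform by metis
      have "((\<lambda>t. \<integral>z. u z * \<Phi> (z - (p + t *\<^sub>R axis i 1)) \<partial>lborel) has_vector_derivative (\<integral>z. - (u z * partial i \<Phi> (z - (p + t *\<^sub>R axis i 1))) \<partial>lborel)) (at t)"
      proof (rule has_vector_derivative_integral[where w = "\<lambda>z. Cu * E * (1 / (1 + norm z) ^ (2 * CARD('n)))"])
        show "integrable lborel (\<lambda>z. u z * \<Phi> (z - (p + t' *\<^sub>R axis i 1)))" for t'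
          by (rule adm_integrable[OF u \<Phi>])
        show "integrable lborel (\<lambda>z::real^'n. Cu * E * (1 / (1 + norm z) ^ (2 * CARD('n))))"
          by (intro integrable_mult_right integrable_weight)
        show "(\<lambda>z. - (u z * partial i \<Phi> (z - (p + t *\<^sub>R axis i 1)))) \<in> borel_measurable lborel"
          using adm_integrable[OF u schwartz_partial[OF \<Phi>]] by auto
        fix t' z
        have "((\<lambda>h. \<Phi> ((z - p) + h *\<^sub>R axis i 1)) has_vector_derivative partial i \<Phi> ((z - p) + (- t') *\<^sub>R axis i 1)) (at (- t'))"
          by (rule has_pd_at[OF schwartz_has_pd[OF \<Phi>]])
        from vector_diff_chain_at[OF has_vector_derivative_minus[OF has_vector_derivative_id] this]
        have "((\<lambda>t. \<Phi> (z - (p + t *\<^sub>R axis i 1))) has_vector_derivative - partial i \<Phi> (z - (p + t' *\<^sub>R axis i 1))) (at t')"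
          by (simp add: o_def algebra_simps)
        from has_vector_derivative_mult_right[OF this, of "u z"]
        show "((\<lambda>t. u z * \<Phi> (z - (p + t *\<^sub>R axis i 1))) has_vector_derivative - (u z * partial i \<Phi> (z - (p + t' *\<^sub>R axis i 1)))) (at t')"
          by simp
        assume t': "\<bar>t' - t\<bar> \<le> 1"
        have "norm (- (p + t' *\<^sub>R axis i 1)) \<le> norm p + \<bar>t'\<bar>"
          unfolding norm_minus_cancel using norm_triangle_ineq[of p "t' *\<^sub>R axis i 1"] by simp
        then have "norm (- (p + t' *\<^sub>R axis i 1)) \<le> norm p + \<bar>t\<bar> + 1" using t' by linarith
        from E(2)[OF this, of z] have "norm (partial i \<Phi> (z - (p + t' *\<^sub>R axis i 1))) * (1 + norm z) ^ (q + 2 * CARD('n)) \<le> E"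
          by (simp only: add_uminus_conv_diff)
        then have "norm (partial i \<Phi> (z - (p + t' *\<^sub>R axis i 1))) \<le> E / (1 + norm z) ^ (q + 2 * CARD('n))"
          by (simp add: pos_le_divide_eq add_pos_nonneg)
        then have "norm (u z) * norm (partial i \<Phi> (z - (p + t' *\<^sub>R axis i 1))) \<le> (Cu * (1 + norm z) ^ q) * (E / (1 + norm z) ^ (q + 2 * CARD('n)))"
          by (intro mult_mono Cu) (auto simp: Cu)
        also have "\<dots> = Cu * E * (1 / (1 + norm z) ^ (2 * CARD('n)))"
        proof -
          have "1 + norm z \<noteq> 0" using norm_ge_zero[of z] by linarith
          then show ?thesis by (simp add: power_add)
        qed
        finally show "norm (- (u z * partial i \<Phi> (z - (p + t' *\<^sub>R axis i 1)))) \<le> Cu * E * (1 / (1 + norm z) ^ (2 * CARD('n)))"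
          by (simp add: norm_mult)
      qed
      then show ?thesis by (simp add: V_def)
    qed
    \<comment> \<open>The vertices of an axis-parallel path from 0 to y: the coordinates of y are
      switched on one after the other. The induction on S walks along it.\<close>
    define p where "p = (\<lambda>S. (\<chi> i. if i \<in> S then y $ i else 0) :: real^'n)"
    have N: "N \<ge> 0" "A \<ge> 0" using u by (auto simp: adm_def)
    have "norm (V (p S)) \<le> (C * A + \<delta>' * N) + (\<Sum>i\<in>S. r * (D i * A + \<delta>' * N))" if "finite S" for S
      using that
    proof (induction S)
      case empty
      have "p {} = 0" by (simp add: p_def vec_eq_iff)
      then show ?case using C(2)[OF u, of 0] by (simp add: V_def)
    next
      case (insert i S)
      have ins: "p (insert i S) = p S + (y $ i) *\<^sub>R axis i 1"
        using insert(2) by (auto simp: p_def vec_eq_iff axis_def)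
      have yi: "\<bar>y $ i\<bar> \<le> r" using component_le_norm_cart[of y i] y by linarith
      have "norm (V (p S + (y $ i) *\<^sub>R axis i 1) - V (p S + 0 *\<^sub>R axis i 1)) \<le> (D i * A + \<delta>' * N) * norm (y $ i - 0)"
      proof (rule differentiable_bound[where S = "closed_segment 0 (y $ i)"])
        fix t assume "t \<in> closed_segment 0 (y $ i)"
        then have t: "\<bar>t\<bar> \<le> \<bar>y $ i\<bar>" by (auto simp: closed_segment_eq_real_ivl split: if_splits)
        show "((\<lambda>t. V (p S + t *\<^sub>R axis i 1)) has_derivative (\<lambda>h. h *\<^sub>R - (\<integral>z. u z * partial i \<Phi> (z - (p S + t *\<^sub>R axis i 1)) \<partial>lborel)))
            (at t within closed_segment 0 (y $ i))"
          using der[of "p S" i t] by (simp add: has_vector_derivative_def has_derivative_at_withinI)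
        \<comment> \<open>No coordinate exceeds that of y in modulus, so the path stays in the ball
          where the partial derivatives are controlled.\<close>
        have "norm (p S + t *\<^sub>R axis i 1) \<le> norm y"
          by (rule norm_le_componentwise_cart) (use t insert(2) in \<open>auto simp: p_def axis_def\<close>)
        then have "norm (\<integral>z. u z * partial i \<Phi> (z - (p S + t *\<^sub>R axis i 1)) \<partial>lborel) \<le> D i * A + \<delta>' * N"
          using y by (intro D(2)[OF u]) simp
        then show "onorm (\<lambda>h. h *\<^sub>R - (\<integral>z. u z * partial i \<Phi> (z - (p S + t *\<^sub>R axis i 1)) \<partial>lborel)) \<le> D i * A + \<delta>' * N"
          by (intro onorm_le) (simp add: mult.commute[of _ "\<bar>_\<bar>"] mult_left_mono)
      qed auto
      also have "\<dots> \<le> (D i * A + \<delta>' * N) * r"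
        using yi D(1)[of i] N \<delta>' by (intro mult_left_mono) auto
      finally have "norm (V (p (insert i S))) \<le> norm (V (p S)) + r * (D i * A + \<delta>' * N)"
        using norm_triangle_ineq2[of "V (p (insert i S))" "V (p S)"] by (simp add: ins mult.commute)
      then show ?case using insert by simp
    qed
    from this[of UNIV] have "norm (V y) \<le> (C * A + \<delta>' * N) + (\<Sum>i\<in>UNIV. r * (D i * A + \<delta>' * N))"
      by (simp add: p_def)
    also have "(\<Sum>i\<in>UNIV. r * (D i * A + \<delta>' * N)) = (\<Sum>i\<in>UNIV. r * D i) * A + n * r * \<delta>' * N"
      by (simp add: n_def sum.distrib distrib_left sum_distrib_right mult.assoc)
    also have "(C * A + \<delta>' * N) + ((\<Sum>i\<in>UNIV. r * D i) * A + n * r * \<delta>' * N)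
        = (C + (\<Sum>i\<in>UNIV. r * D i)) * A + (\<delta>' * (1 + n * r)) * N"
      by (simp add: algebra_simps)
    also have "\<delta>' * (1 + n * r) = \<delta>" using nr by (simp add: \<delta>'_def)
    finally show ?thesis by (simp add: V_def)
  qed
  moreover have "0 \<le> C + (\<Sum>i\<in>UNIV. r * D i)" using C(1) D(1) r by (simp add: sum_nonneg)
  ultimately show "\<exists>C\<ge>0. \<forall>u N A y. adm u N A \<longrightarrow> norm y \<le> r \<longrightarrow> norm (\<integral>z. u z * \<Phi> (z - y) \<partial>lborel) \<le> C * A + \<delta> * N"
    by blast
qed

end

context elliptic_germ
begin

section \<open>The heat kernel of the operator\<close>

abbreviation P :: "real^'n \<Rightarrow> complex" where
  "P \<equiv> symbol s m a"

definition M :: "real^'n \<Rightarrow> real" where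
  "M \<xi> = (norm (P \<xi>))\<^sup>2"

lemma M_eq: "complex_of_real (M \<xi>) = P \<xi> * cnj (P \<xi>)"
  unfolding M_def by (rule complex_norm_square)

lemma M_cpoly: "(\<lambda>\<xi>. complex_of_real (M \<xi>)) \<in> cpoly"
  unfolding M_eq by (intro cpoly.mult symbol_cpoly cpoly_cnj)

lemma m_pos: "m > 0"
  using eta_pos eta_less by linarith

lemma M_dil: "r > 0 \<Longrightarrow> M (dil s r \<xi>) = r ^ (2 * m) * M \<xi>"
  unfolding M_def symbol_dil by (simp add: norm_mult norm_power power_mult_distrib power_mult[symmetric] mult.commute)

text \<open>M is bounded below by some c > 0 on the compact anisotropic unit sphere, and homogeneity
  spreads this to M x \<ge> c * anorm x ^ (2 * m). It remains to bound |x| by a power of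
  \<open>anorm\<close>.\<close>

lemma coercive_M: "coercive M"
  unfolding coercive_def
proof (intro conjI allI)
  show "M x \<ge> 0" for x by (simp add: M_def)
  define S where "S = {\<omega>::real^'n. anorm \<omega> = 1}"
  have "closed S" unfolding S_def by (intro closed_Collect_eq continuous_anorm continuous_intros)
  moreover have "bounded S"
  proof (rule boundedI)
    fix w assume "w \<in> S"
    then have w: "anorm w = 1" by (simp add: S_def)
    have "norm w \<le> (\<Sum>i\<in>UNIV. \<bar>w $ i\<bar>)" by (rule norm_le_l1_cart)
    also have "\<dots> \<le> (\<Sum>i\<in>(UNIV::'n set). 1)"
      using component_le_anorm[of w] w by (intro sum_mono) auto
    finally show "norm w \<le> real CARD('n)" by simp
  qed
  ultimately have cpt: "compact S" by (simp add: compact_eq_bounded_closed)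
  have Mc: "continuous_on S M"
    unfolding M_def by (intro continuous_intros continuous_on_subset[OF cpoly_cont[OF symbol_cpoly]]) simp
  have Mpos: "M \<omega> > 0" if "\<omega> \<in> S" for \<omega>
  proof -
    have "\<omega> \<noteq> 0" using that by (auto simp: S_def)
    then show ?thesis using symbol_nz by (simp add: M_def)
  qed
  have "\<exists>c>0. \<forall>\<omega>\<in>S. c \<le> M \<omega>"
  proof (cases "S = {}")
    case False
    then obtain \<omega>0 where "\<omega>0 \<in> S" "\<And>\<omega>. \<omega> \<in> S \<Longrightarrow> M \<omega>0 \<le> M \<omega>"
      using continuous_attains_inf[OF cpt False Mc] by blast
    then show ?thesis using Mpos by blast
  qed (auto intro: exI[of _ 1])
  then obtain c where c: "c > 0" "\<And>\<omega>. \<omega> \<in> S \<Longrightarrow> c \<le> M \<omega>" by blast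
  have low: "c * anorm x ^ (2 * m) \<le> M x" for x
  proof (cases "x = 0")
    case True
    then show ?thesis using m_pos by (simp add: M_def power_0_left)
  next
    case False
    define \<rho> where "\<rho> = anorm x"
    have \<rho>: "\<rho> > 0" using anorm_pos[OF False] by (simp add: \<rho>_def)
    have "dil s (1 / \<rho>) x \<in> S" using \<rho> anorm_dil[of "1 / \<rho>" x] by (simp add: S_def \<rho>_def)
    then have "c \<le> M (dil s (1 / \<rho>) x)" by (rule c)
    then have "c * \<rho> ^ (2 * m) \<le> M (dil s (1 / \<rho>) x) * \<rho> ^ (2 * m)" using \<rho> by (intro mult_right_mono) auto
    also have "\<dots> = M (dil s \<rho> (dil s (1 / \<rho>) x))" using M_dil[OF \<rho>] by simp
    also have "\<dots> = M x" by (simp add: dil_inverse[OF \<rho>])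
    finally show ?thesis by (simp add: \<rho>_def)
  qed
  \<comment> \<open>The sum dominates every single s i, so one exponent serves for all
    coordinates.\<close>
  define k where "k = (\<Sum>i\<in>UNIV. s i)"
  define C where "C = (1 + real CARD('n)) * (1 + 1 / c) ^ k"
  have "1 + norm x \<le> C * (1 + M x) ^ k" for x
  proof -
    define \<rho> where "\<rho> = anorm x"
    have \<rho>: "\<rho> \<ge> 0" by (simp add: \<rho>_def)
    have M0: "M x \<ge> 0" by (simp add: M_def)
    have \<rho>M: "1 + \<rho> \<le> 1 + (1 + M x / c)"
    proof (cases "\<rho> \<le> 1")
      case True
      have "M x / c \<ge> 0" using M0 c by simp
      then show ?thesis using True by linarith
    next
      case False
      then have "\<rho> ^ 1 \<le> \<rho> ^ (2 * m)" using m_pos by (intro power_increasing) auto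
      then have "c * \<rho> \<le> c * \<rho> ^ (2 * m)" using c(1) by simp
      then have "c * \<rho> \<le> M x" using low[of x] unfolding \<rho>_def by linarith
      then have "\<rho> \<le> M x / c" using c by (simp add: pos_le_divide_eq mult.commute)
      then show ?thesis by simp
    qed
    \<comment> \<open>The maximum with 1 makes powers increasing in the exponent, which fails for
      \<rho> < 1.\<close>
    define B where "B = max 1 \<rho>"
    have B: "B \<ge> 1" "B \<le> 1 + M x / c" using \<rho>M c M0 \<rho> by (auto simp: B_def)
    have "norm x \<le> (\<Sum>i\<in>UNIV. \<bar>x $ i\<bar>)" by (rule norm_le_l1_cart)
    also have "\<dots> \<le> (\<Sum>i\<in>(UNIV::'n set). B ^ k)"
    proof (rule sum_mono)
      fix i
      have "\<bar>x $ i\<bar> \<le> \<rho> ^ s i" unfolding \<rho>_def by (rule component_le_anorm)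
      also have "\<dots> \<le> B ^ s i" using \<rho> by (intro power_mono) (auto simp: B_def)
      also have "\<dots> \<le> B ^ k" using B(1) unfolding k_def by (intro power_increasing member_le_sum) auto
      finally show "\<bar>x $ i\<bar> \<le> B ^ k" .
    qed
    also have "\<dots> = real CARD('n) * B ^ k" by simp
    finally have "1 + norm x \<le> 1 * B ^ k + real CARD('n) * B ^ k"
      using one_le_power[OF B(1), of k] by linarith
    also have "\<dots> = (1 + real CARD('n)) * B ^ k" by (simp add: algebra_simps)
    also have "B ^ k \<le> ((1 + 1 / c) * (1 + M x)) ^ k"
    proof (rule power_mono)
      have "1 + M x / c \<le> (1 + 1 / c) * (1 + M x)" using c M0 by (simp add: field_simps)
      then show "B \<le> (1 + 1 / c) * (1 + M x)" using B by simp
    qed (use B in simp)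
    finally show ?thesis by (simp add: C_def power_mult_distrib mult.assoc mult_left_mono)
  qed
  then show "\<exists>C k. \<forall>x. 1 + norm x \<le> C * (1 + M x) ^ k" by blast
qed

definition heat :: "real \<Rightarrow> real^'n \<Rightarrow> complex" where
  "heat t = fourier (\<lambda>\<xi>. of_real (exp (- (t * M \<xi>))))"

lemma schwartz_heat_mult:
  "t > 0 \<Longrightarrow> schwartz (\<lambda>\<xi>. of_real (exp (- (t * M \<xi>))))"
  using schwartz_heat[OF M_cpoly coercive_M, of t "\<lambda>_. 1"] by (simp add: cpoly.const)

lemma schwartz_heat_kernel: "t > 0 \<Longrightarrow> schwartz (heat t)"
  unfolding heat_def by (intro schwartz_fourier schwartz_heat_mult)

text \<open>The multiplier \<open>(exp (- b M) - exp (- c M)) / P\<close> is smooth also at the zero of \<open>P\<close>, being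
  \<open>cnj P\<close> times the integral of \<open>exp (- t M)\<close> over \<open>b \<le> t \<le> c\<close>.\<close>

lemma heat_difference_aux:
  assumes "0 < b" "b \<le> c"
  shows "\<exists>\<psi>. schwartz \<psi> \<and> (\<forall>x. pderivs l (heat b) x = pderivs l (heat c) x + Lt \<psi> x)"
proof -
  define q where "q = (\<lambda>\<xi>::real^'n. \<Prod>i\<leftarrow>l. \<i> * complex_of_real (\<xi> $ i))"
  define f where "f = (\<lambda>\<xi>. (q \<xi> * cnj (P \<xi>)) * of_real (heat_integral b c 0 (M \<xi>)))"
  have qc: "q \<in> cpoly" unfolding q_def by (rule prod_list_cpoly)
  have sf: "schwartz f" unfolding f_def
    by (rule schwartz_heat_integral[OF M_cpoly coercive_M assms cpoly.mult[OF qc cpoly_cnj[OF symbol_cpoly]]])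
  have c: "0 < c" using assms by simp
  have b1: "pderivs l (heat b) = fourier (\<lambda>\<xi>. q \<xi> * of_real (exp (- (b * M \<xi>))))"
    unfolding heat_def q_def by (rule fourier_pderivs[OF schwartz_heat_mult[OF assms(1)]])
  have c1: "pderivs l (heat c) = fourier (\<lambda>\<xi>. q \<xi> * of_real (exp (- (c * M \<xi>))))"
    unfolding heat_def q_def by (rule fourier_pderivs[OF schwartz_heat_mult[OF c]])
  have Pf: "schwartz (\<lambda>\<xi>. P \<xi> * f \<xi>)"
  proof -
    have "schwartz (\<lambda>\<xi>. (P \<xi> * (q \<xi> * cnj (P \<xi>))) * of_real (heat_integral b c 0 (M \<xi>)))"
      by (rule schwartz_heat_integral[OF M_cpoly coercive_M assms cpoly.mult[OF symbol_cpoly cpoly.mult[OF qc cpoly_cnj[OF symbol_cpoly]]]])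
    then show ?thesis by (simp add: f_def mult.assoc)
  qed
  have qs: "schwartz (\<lambda>\<xi>. q \<xi> * of_real (exp (- (c * M \<xi>))))"
    by (rule schwartz_heat[OF M_cpoly coercive_M c qc])
  have eq: "(\<lambda>\<xi>. q \<xi> * of_real (exp (- (b * M \<xi>)))) = (\<lambda>\<xi>. q \<xi> * of_real (exp (- (c * M \<xi>))) + P \<xi> * f \<xi>)"
  proof
    fix \<xi>
    have "P \<xi> * f \<xi> = q \<xi> * (complex_of_real (M \<xi>) * of_real (heat_integral b c 0 (M \<xi>)))"
      by (simp add: f_def M_eq mult_ac)
    also have "\<dots> = q \<xi> * of_real (M \<xi> * heat_integral b c 0 (M \<xi>))" by simp
    also have "\<dots> = q \<xi> * of_real (exp (- (b * M \<xi>)) - exp (- (c * M \<xi>)))"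
      unfolding heat_integral_mult[OF assms(2)] ..
    finally show "q \<xi> * of_real (exp (- (b * M \<xi>))) = q \<xi> * of_real (exp (- (c * M \<xi>))) + P \<xi> * f \<xi>"
      by (simp add: algebra_simps)
  qed
  have "pderivs l (heat b) x = pderivs l (heat c) x + Lt (fourier f) x" for x
    unfolding b1 c1 opL_t_fourier[OF sf] eq by (rule fourier_add[OF qs Pf])
  then show ?thesis using schwartz_fourier[OF sf] by blast
qed

lemma heat_difference:
  assumes "0 < b" "0 < c"
  shows "\<exists>\<psi>. schwartz \<psi> \<and> (\<forall>x. pderivs l (heat b) x = Lt \<psi> x + pderivs l (heat c) x)"
proof (cases "b \<le> c")
  case True
  then show ?thesis using heat_difference_aux[OF assms(1) True, of l] by (auto simp: add.commute)
next
  case False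
  then obtain \<psi> where \<psi>: "schwartz \<psi>" "\<And>x. pderivs l (heat c) x = pderivs l (heat b) x + Lt \<psi> x"
    using heat_difference_aux[of c b l] assms by auto
  have "Lt (\<lambda>x. (-1) * \<psi> x) = (\<lambda>x. (-1) * Lt \<psi> x)" by (rule opL_t_cmult[OF schwartz_smooth[OF \<psi>(1)]])
  then have "pderivs l (heat b) x = Lt (\<lambda>x. (-1) * \<psi> x) x + pderivs l (heat c) x" for x
    using \<psi>(2)[of x] by simp
  then show ?thesis using schwartz_cmult[OF \<psi>(1)] by blast
qed

text \<open>M is homogeneous of degree 2 * m under dilations, so the kernel at time \<tau> ^ (2 * m)
  is that at time 1 dilated to the anisotropic width \<tau>.\<close>

lemma heat_scaling:
  assumes \<tau>: "\<tau> > 0"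
  shows "pderivs l (heat (\<tau> ^ (2 * m))) x = of_real ((1 / \<tau>) ^ (ldeg s l + hdim s)) * pderivs l (heat 1) (dil s (1 / \<tau>) x)"
proof -
  have k: "heat (\<tau> ^ (2 * m)) = (\<lambda>x. of_real ((1 / \<tau>) ^ hdim s) * heat 1 (diag_aff (\<lambda>i. (1 / \<tau>) ^ s i) 0 x))"
  proof
    fix x
    have "heat (\<tau> ^ (2 * m)) x = fourier (\<lambda>\<xi>. of_real (exp (- (1 * M (diag_aff (\<lambda>i. \<tau> ^ s i) 0 \<xi>))))) x"
      unfolding heat_def using M_dil[OF \<tau>] by (simp add: dil_def)
    also have "\<dots> = of_real (1 / (\<Prod>i\<in>UNIV. \<tau> ^ s i)) * fourier (\<lambda>\<xi>. of_real (exp (- (1 * M \<xi>)))) (diag_aff (\<lambda>i. 1 / \<tau> ^ s i) 0 x)"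
      by (rule fourier_diag[of "\<lambda>i. \<tau> ^ s i" "\<lambda>\<xi>. of_real (exp (- (1 * M \<xi>)))"]) (use \<tau> schwartz_heat_mult[of 1] in auto)
    finally show "heat (\<tau> ^ (2 * m)) x = of_real ((1 / \<tau>) ^ hdim s) * heat 1 (diag_aff (\<lambda>i. (1 / \<tau>) ^ s i) 0 x)"
      unfolding heat_def prod_dil by (simp add: power_one_over)
  qed
  have sm: "smooth (heat 1)" by (rule schwartz_smooth[OF schwartz_heat_kernel]) simp
  show ?thesis
    unfolding k pderivs_cmult[OF smooth_diag_aff[OF sm]] pderivs_diag_aff[OF sm] prod_list_dil dil_def
    by (simp add: power_add mult_ac)
qed

lemma schwartz_pderivs_heat: "t > 0 \<Longrightarrow> schwartz (pderivs l (heat t))"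
  by (intro schwartz_pderivs schwartz_heat_kernel)

lemma integral_dil_shift:
  fixes G :: "real^'n \<Rightarrow> real"
  assumes \<tau>: "\<tau> > 0" and G: "continuous_on UNIV G"
  shows "(\<integral>z. G (dil s (1 / \<tau>) (z - y)) \<partial>lborel) = \<tau> ^ hdim s * (\<integral>w. G w \<partial>lborel)"
proof -
  have "dil s (1 / \<tau>) (z - y) = diag_aff (\<lambda>i. (1 / \<tau>) ^ s i) (- dil s (1 / \<tau>) y) z" for z
    by (simp add: vec_eq_iff diag_aff_def algebra_simps)
  then have "(\<integral>z. G (dil s (1 / \<tau>) (z - y)) \<partial>lborel) = (\<integral>z. G (diag_aff (\<lambda>i. (1 / \<tau>) ^ s i) (- dil s (1 / \<tau>) y) z) \<partial>lborel)"
    by simp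
  also have "\<dots> = (1 / (\<Prod>i\<in>UNIV. (1 / \<tau>) ^ s i)) *\<^sub>R (\<integral>w. G w \<partial>lborel)"
    using \<tau> by (intro integral_diag_aff borel_measurable_continuous_onI[OF G]) simp
  also have "1 / (\<Prod>i\<in>UNIV. (1 / \<tau>) ^ s i) = \<tau> ^ hdim s" unfolding prod_dil by (simp add: power_one_over)
  finally show ?thesis by simp
qed

lemma integrable_shifted_weight:
  assumes "D \<ge> 0" "schwartz \<Phi>"
  shows "integrable lborel (\<lambda>w. (D + anorm w) powr \<eta> * norm (\<Phi> w))"
proof -
  have "integrable lborel (\<lambda>w. (D + anorm w) powr \<eta> * norm (\<Phi> (w - 0)))"
    by (rule integrable_weight_schwartz[OF continuous_anorm_powr pgrow_anorm_powr assms(2)]) (use eta_pos assms(1) in auto)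
  then show ?thesis by simp
qed

text \<open>At width \<tau> the weight contributes \<tau> powr \<eta> and the derivatives \<tau> to
  the power minus their degree; the Jacobian cancels. A centre y within \<tau> D appears after
  rescaling as a shift of size D. The sign of \<eta> - ldeg s l decides which limit of \<tau> is
  useful.\<close>

lemma heat_weight_bound:
  assumes \<tau>: "\<tau> > 0" and D: "D \<ge> 0" and y: "anorm y \<le> \<tau> * D"
  shows "(\<integral>z. anorm z powr \<eta> * norm (pderivs l (heat (\<tau> ^ (2 * m))) (z - y)) \<partial>lborel)
    \<le> \<tau> powr (\<eta> - real (ldeg s l)) * (\<integral>w. (D + anorm w) powr \<eta> * norm (pderivs l (heat 1) w) \<partial>lborel)"
proof -
  define K where "K = pderivs l (heat 1)"
  have K: "schwartz K" unfolding K_def by (rule schwartz_pderivs_heat) simp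
  have J: "integrable lborel (\<lambda>w. (D + anorm w) powr \<eta> * norm (K w))"
    by (rule integrable_shifted_weight[OF D K])
  define e where "e = (1 / \<tau>) ^ (ldeg s l + hdim s)"
  have e: "e \<ge> 0" using \<tau> by (simp add: e_def)
  \<comment> \<open>The integrand in the variable w = dil s (1 / \<tau>) (z - y).\<close>
  define G where "G = (\<lambda>w. anorm (dil s \<tau> w + y) powr \<eta> * (e * norm (K w)))"
  have dc: "continuous_on UNIV (\<lambda>w. anorm (dil s \<tau> w + y) powr \<eta>)"
    by (rule continuous_on_compose2[OF weight_cont]) (auto simp: dil_def intro!: continuous_intros)
  have Gc: "continuous_on UNIV G"
    unfolding G_def by (intro continuous_on_mult dc continuous_on_norm schwartz_cont[OF K] continuous_on_const)
  have "(\<integral>z. anorm z powr \<eta> * norm (pderivs l (heat (\<tau> ^ (2 * m))) (z - y)) \<partial>lborel) = (\<integral>z. G (dil s (1 / \<tau>) (z - y)) \<partial>lborel)"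
    unfolding G_def heat_scaling[OF \<tau>] dil_inverse[OF \<tau>] K_def using \<tau> by (simp add: norm_mult norm_power norm_divide e_def)
  also have "\<dots> = \<tau> ^ hdim s * (\<integral>w. G w \<partial>lborel)" by (rule integral_dil_shift[OF \<tau> Gc])
  also have "\<dots> \<le> \<tau> ^ hdim s * (\<integral>w. \<tau> powr \<eta> * e * ((D + anorm w) powr \<eta> * norm (K w)) \<partial>lborel)"
  proof (intro mult_left_mono)
    have Gle: "G w \<le> \<tau> powr \<eta> * e * ((D + anorm w) powr \<eta> * norm (K w))" for w
    proof -
      have "anorm (dil s \<tau> w + y) \<le> \<tau> * anorm w + \<tau> * D"
        using anorm_triangle[of "dil s \<tau> w" y] anorm_dil[OF \<tau>, of w] y by simp
      then have "anorm (dil s \<tau> w + y) powr \<eta> \<le> (\<tau> * (D + anorm w)) powr \<eta>"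
        using eta_pos by (intro powr_mono2) (auto simp: algebra_simps)
      also have "\<dots> = \<tau> powr \<eta> * (D + anorm w) powr \<eta>" using \<tau> D by (simp add: powr_mult)
      finally have "G w \<le> (\<tau> powr \<eta> * (D + anorm w) powr \<eta>) * (e * norm (K w))"
        unfolding G_def using e by (intro mult_right_mono) auto
      then show ?thesis by (simp add: mult_ac)
    qed
    have iR: "integrable lborel (\<lambda>w. \<tau> powr \<eta> * e * ((D + anorm w) powr \<eta> * norm (K w)))" by (rule integrable_mult_right[OF J])
    have "integrable lborel G"
    proof (rule Bochner_Integration.integrable_bound[OF iR])
      show "G \<in> borel_measurable lborel" using borel_measurable_continuous_onI[OF Gc] by simp
      have "norm (G w) \<le> norm (\<tau> powr \<eta> * e * ((D + anorm w) powr \<eta> * norm (K w)))" for w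
      proof -
        have "0 \<le> G w" using e by (simp add: G_def)
        then show ?thesis using Gle[of w] unfolding real_norm_def by linarith
      qed
      then show "AE w in lborel. norm (G w) \<le> norm (\<tau> powr \<eta> * e * ((D + anorm w) powr \<eta> * norm (K w)))" by (intro AE_I2)
    qed
    then show "(\<integral>w. G w \<partial>lborel) \<le> (\<integral>w. \<tau> powr \<eta> * e * ((D + anorm w) powr \<eta> * norm (K w)) \<partial>lborel)"
      by (rule integral_mono[OF _ iR Gle])
  qed (use \<tau> in simp)
  also have "\<dots> = \<tau> ^ hdim s * (\<tau> powr \<eta> * e) * (\<integral>w. (D + anorm w) powr \<eta> * norm (K w) \<partial>lborel)"
    by simp
  also have "\<tau> ^ hdim s * (\<tau> powr \<eta> * e) = \<tau> powr (\<eta> - real (ldeg s l))"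
    using \<tau> by (simp add: e_def power_add power_one_over powr_diff powr_realpow field_simps)
  finally show ?thesis by (simp add: K_def)
qed

section \<open>Control of all heat kernel derivatives\<close>

lemma small_powr:
  fixes p J \<epsilon> :: real
  assumes "p < 0" "\<epsilon> > 0"
  shows "\<exists>\<tau>\<ge>1. \<tau> powr p * J \<le> \<epsilon>"
proof -
  have "((\<lambda>\<tau>. \<tau> powr p * J) \<longlongrightarrow> 0 * J) at_top"
    by (intro tendsto_mult tendsto_const tendsto_neg_powr assms filterlim_ident)
  then have "\<forall>\<^sub>F \<tau> in at_top. \<tau> powr p * J < \<epsilon>"
    using order_tendstoD(2)[of _ "0 * J" at_top \<epsilon>] assms by simp
  then obtain T where T: "\<And>\<tau>. \<tau> \<ge> T \<Longrightarrow> \<tau> powr p * J < \<epsilon>" by (auto simp: eventually_at_top_linorder)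
  show ?thesis using T[of "max 1 T"] by (intro exI[of _ "max 1 T"]) (simp add: less_imp_le)
qed

lemma small_powr_pos:
  fixes p J \<epsilon> :: real
  assumes "p > 0" "\<epsilon> > 0"
  shows "\<exists>\<tau>>0. \<tau> powr p * J \<le> \<epsilon>"
proof -
  obtain \<tau> where "\<tau> \<ge> 1" "\<tau> powr (- p) * J \<le> \<epsilon>" using small_powr[of "- p" \<epsilon> J] assms by auto
  moreover from this have "(1 / \<tau>) powr p = \<tau> powr (- p)" by (simp add: powr_minus_divide powr_divide)
  ultimately show ?thesis by (intro exI[of _ "1 / \<tau>"]) simp
qed

text \<open>The kernel at time t is traded for one at time \<tau> ^ (2 * m): the difference is of
  the form \<open>Lt \<psi>\<close> and hence controlled, whatever the constant, and the new kernel
  is small in the weighted norm.\<close>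

lemma controlled_via_scale:
  assumes t: "t > 0"
    and small: "\<And>\<epsilon>. \<epsilon> > 0 \<Longrightarrow> \<exists>\<tau>>0. \<forall>y. norm y \<le> r \<longrightarrow>
      (\<integral>z. anorm z powr \<eta> * norm (pderivs l (heat (\<tau> ^ (2 * m))) (z - y)) \<partial>lborel) \<le> \<epsilon>"
  shows "controlled r (pderivs l (heat t))"
proof (rule controlled_approx)
  fix \<epsilon> :: real assume "\<epsilon> > 0"
  then obtain \<tau> where \<tau>: "\<tau> > 0" "\<And>y. norm y \<le> r \<Longrightarrow>
      (\<integral>z. anorm z powr \<eta> * norm (pderivs l (heat (\<tau> ^ (2 * m))) (z - y)) \<partial>lborel) \<le> \<epsilon>"
    using small by blast
  have \<tau>2: "\<tau> ^ (2 * m) > 0" using \<tau> by simp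
  obtain \<psi> where \<psi>: "schwartz \<psi>" "\<And>x. pderivs l (heat t) x = Lt \<psi> x + pderivs l (heat (\<tau> ^ (2 * m))) x"
    using heat_difference[OF t \<tau>2, of l] by blast
  show "\<exists>\<Phi>1 \<Phi>2. schwartz \<Phi>1 \<and> schwartz \<Phi>2 \<and> pderivs l (heat t) = (\<lambda>z. \<Phi>1 z + \<Phi>2 z) \<and> controlled r \<Phi>1 \<and>
     (\<forall>y. norm y \<le> r \<longrightarrow> (\<integral>z. anorm z powr \<eta> * norm (\<Phi>2 (z - y)) \<partial>lborel) \<le> \<epsilon>)"
    using \<psi> \<tau>(2) schwartz_opL_t[OF \<psi>(1)] schwartz_pderivs_heat[OF \<tau>2] controlled_Lt[OF \<psi>(1)]
    by (intro exI[of _ "Lt \<psi>"] exI[of _ "pderivs l (heat (\<tau> ^ (2 * m)))"]) auto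
qed

text \<open>The limit of large \<tau>. As \<tau> \<ge> 1, the same D bounds all centres in the ball
  on every scale used.\<close>

lemma controlled_heat_high:
  assumes t: "t > 0" and r: "r \<ge> 0" and l: "real (ldeg s l) > \<eta>"
  shows "controlled r (pderivs l (heat t))"
proof (rule controlled_via_scale[OF t])
  fix \<epsilon> :: real assume e: "\<epsilon> > 0"
  define D where "D = real CARD('n) * (1 + r)"
  have D: "D \<ge> 0" using r by (simp add: D_def)
  define J where "J = (\<integral>w. (D + anorm w) powr \<eta> * norm (pderivs l (heat 1) w) \<partial>lborel)"
  obtain \<tau> where \<tau>: "\<tau> \<ge> 1" "\<tau> powr (\<eta> - real (ldeg s l)) * J \<le> \<epsilon>"
    using small_powr[of "\<eta> - real (ldeg s l)" \<epsilon> J] l e by auto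
  have "(\<integral>z. anorm z powr \<eta> * norm (pderivs l (heat (\<tau> ^ (2 * m))) (z - y)) \<partial>lborel) \<le> \<epsilon>" if "norm y \<le> r" for y
  proof (rule order_trans[OF heat_weight_bound \<tau>(2)[unfolded J_def]])
    have "real CARD('n) * (1 + norm y) \<le> D" unfolding D_def using that by (intro mult_left_mono) auto
    then have "anorm y \<le> D" using anorm_le[of y] by linarith
    also have "\<dots> \<le> \<tau> * D" using \<tau>(1) D by (simp add: mult_left_mono[of 1 \<tau> D, simplified] mult.commute[of \<tau>] mult_le_cancel_left1)
    finally show "anorm y \<le> \<tau> * D" .
  qed (use \<tau> D in auto)
  then show "\<exists>\<tau>>0. \<forall>y. norm y \<le> r \<longrightarrow> (\<integral>z. anorm z powr \<eta> * norm (pderivs l (heat (\<tau> ^ (2 * m))) (z - y)) \<partial>lborel) \<le> \<epsilon>"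
    using \<tau>(1) by (intro exI[of _ \<tau>]) auto
qed

text \<open>The limit of small \<tau>. It requires the centre 0: for another centre y the condition
  anorm y \<le> \<tau> * D would force D to blow up.\<close>

lemma controlled_heat_low:
  assumes t: "t > 0" and l: "real (ldeg s l) < \<eta>"
  shows "controlled 0 (pderivs l (heat t))"
proof (rule controlled_via_scale[OF t])
  fix \<epsilon> :: real assume e: "\<epsilon> > 0"
  define J where "J = (\<integral>w. (0 + anorm w) powr \<eta> * norm (pderivs l (heat 1) w) \<partial>lborel)"
  obtain \<tau> where \<tau>: "\<tau> > 0" "\<tau> powr (\<eta> - real (ldeg s l)) * J \<le> \<epsilon>"
    using small_powr_pos[of "\<eta> - real (ldeg s l)" \<epsilon> J] l e by auto
  have "(\<integral>z. anorm z powr \<eta> * norm (pderivs l (heat (\<tau> ^ (2 * m))) (z - y)) \<partial>lborel) \<le> \<epsilon>" if "norm y \<le> 0" for y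
    by (rule order_trans[OF heat_weight_bound \<tau>(2)[unfolded J_def]]) (use \<tau> that in auto)
  then show "\<exists>\<tau>>0. \<forall>y. norm y \<le> 0 \<longrightarrow> (\<integral>z. anorm z powr \<eta> * norm (pderivs l (heat (\<tau> ^ (2 * m))) (z - y)) \<partial>lborel) \<le> \<epsilon>"
    using \<tau>(1) by blast
qed

text \<open>Descending induction on the degree. Above \<eta> every centre is reached directly; below
  \<eta> the centre 0 is, and the first partial derivatives, of larger degree, carry the bound to
  the other centres. The degree is never equal to \<eta>, as \<eta> is no natural number.\<close>

lemma controlled_pderivs_heat:
  assumes t: "t > 0" and r: "r \<ge> 0"
  shows "controlled r (pderivs l (heat t))"
proof (induction "nat \<lceil>\<eta>\<rceil> - ldeg s l" arbitrary: l rule: less_induct)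
  case less
  have "real (ldeg s l) \<noteq> \<eta>" using eta_nat by (metis of_nat_in_Nats)
  then consider "real (ldeg s l) > \<eta>" | "real (ldeg s l) < \<eta>" by linarith
  then show ?case
  proof cases
    case 1
    then show ?thesis by (rule controlled_heat_high[OF t r])
  next
    case 2
    show ?thesis
    proof (rule controlled_from_partials[OF schwartz_pderivs_heat[OF t] r controlled_heat_low[OF t 2]])
      fix i
      have "ldeg s (i # l) > ldeg s l" using s_ge_1[of i] by (simp add: ldeg_def)
      \<comment> \<open>Needed for the truncated subtraction to decrease strictly.\<close>
      moreover have "ldeg s l < nat \<lceil>\<eta>\<rceil>" using 2 by linarith
      ultimately have "nat \<lceil>\<eta>\<rceil> - ldeg s (i # l) < nat \<lceil>\<eta>\<rceil> - ldeg s l" by simp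
      from less[OF this] show "controlled r (partial i (pderivs l (heat t)))" by simp
    qed
  qed
qed

section \<open>Reproduction of polynomials\<close>

text \<open>The mass of every heat kernel. Only its nonvanishing is established and used.\<close>

definition kappa :: complex where
  "kappa = (\<integral>w. heat 1 w \<partial>lborel)"

lemma kappa_nonzero: "kappa \<noteq> 0"
  unfolding kappa_def heat_def
  by (rule integral_fourier_nonzero) (use schwartz_heat_mult[of 1] in auto)

lemma integral_annihilated:
  assumes p: "slowly_growing p" and z: "\<And>l. ldeg s l = m \<Longrightarrow> pderivs l p = (\<lambda>x. 0)" and \<psi>: "schwartz \<psi>"
  shows "(\<integral>z. p z * Lt \<psi> z \<partial>lborel) = 0"
proof -
  have "(\<integral>z. p z * Lt \<psi> z \<partial>lborel) = (\<integral>z. (\<Sum>\<gamma>\<in>{\<gamma>. aniso_deg s \<gamma> = m}. opl_coeff a \<gamma> * (p z * pderivs (mlist \<gamma>) \<psi> z)) \<partial>lborel)"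
    by (simp add: opL_t_pderivs sum_distrib_left mult.left_commute)
  also have "\<dots> = (\<Sum>\<gamma>\<in>{\<gamma>. aniso_deg s \<gamma> = m}. opl_coeff a \<gamma> * (\<integral>z. p z * pderivs (mlist \<gamma>) \<psi> z \<partial>lborel))"
  proof (subst Bochner_Integration.integral_sum)
    show "integrable lborel (\<lambda>z. opl_coeff a \<gamma> * (p z * pderivs (mlist \<gamma>) \<psi> z))" for \<gamma>
      by (intro integrable_mult_right integrable_slow_schwartz p schwartz_pderivs \<psi>)
  qed simp
  also have "\<dots> = 0"
  proof (rule sum.neutral, rule ballI)
    fix \<gamma> assume "\<gamma> \<in> {\<gamma>. aniso_deg s \<gamma> = m}"
    then have "ldeg s (rev (mlist \<gamma>)) = m" by (simp add: ldeg_count ldeg_mlist[symmetric])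
    from z[OF this] show "opl_coeff a \<gamma> * (\<integral>z. p z * pderivs (mlist \<gamma>) \<psi> z \<partial>lborel) = 0"
      by (simp add: integral_by_parts_pderivs[OF p \<psi>])
  qed
  finally show ?thesis .
qed

lemma dil_contraction:
  assumes "0 < \<tau>" "\<tau> \<le> 1" shows "norm (dil s \<tau> w) \<le> norm w"
proof (rule norm_le_componentwise_cart)
  fix i
  have "\<tau> ^ s i * \<bar>w $ i\<bar> \<le> 1 * \<bar>w $ i\<bar>"
    using assms by (intro mult_right_mono power_le_one) auto
  then show "norm (dil s \<tau> w $ i) \<le> norm (w $ i)" using assms by (simp add: abs_mult)
qed

text \<open>The left side is independent of t, because differences of kernels are of the form
  \<open>Lt \<psi>\<close> and p is annihilated by derivatives of degree m. As the width tends to 0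
  the kernel concentrates at y with mass \<open>kappa\<close>.\<close>

lemma heat_reproduces:
  assumes p: "slowly_growing p" and z: "\<And>l. ldeg s l = m \<Longrightarrow> pderivs l p = (\<lambda>x. 0)" and t: "t > 0"
  shows "(\<integral>z. p z * heat t (z - y) \<partial>lborel) = kappa * p y"
proof -
  have pc: "continuous_on UNIV p" and pg: "pgrow p" using p by (auto intro: slowly_growing_cont slowly_growing_pgrow)
  have indep: "(\<integral>z. p z * heat t (z - y) \<partial>lborel) = (\<integral>z. p z * heat t' (z - y) \<partial>lborel)" if t': "t' > 0" for t'
  proof -
    obtain \<psi> where \<psi>: "schwartz \<psi>" "\<And>x. heat t x = Lt \<psi> x + heat t' x"
      using heat_difference[OF t t', of "[]"] by auto
    have "(\<integral>z. p z * Lt \<psi> (z - y) \<partial>lborel) = (\<integral>z. p z * Lt (\<lambda>z. \<psi> (z - y)) z \<partial>lborel)"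
      by (simp add: opL_t_shift[OF schwartz_smooth[OF \<psi>(1)]])
    also have "\<dots> = 0" by (rule integral_annihilated[OF p z schwartz_shift[OF \<psi>(1)]])
    finally have "(\<integral>z. p z * Lt \<psi> (z - y) \<partial>lborel) = 0" .
    then show ?thesis
      unfolding \<psi>(2)
      by (simp add: distrib_left integrable_pgrow_schwartz[OF pc pg] schwartz_opL_t[OF \<psi>(1)] schwartz_heat_kernel[OF t'])
  qed
  \<comment> \<open>Puts the width into the argument of p, so that the limit becomes dominated
    convergence against a fixed kernel.\<close>
  have rescaled: "(\<integral>z. p z * heat (\<tau> ^ (2 * m)) (z - y) \<partial>lborel) = (\<integral>w. p (dil s \<tau> w + y) * heat 1 w \<partial>lborel)" if \<tau>: "\<tau> > 0" for \<tau>
  proof -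
    have d: "dil s \<tau> w + y = diag_aff (\<lambda>i. \<tau> ^ s i) y w" for w by (simp add: vec_eq_iff diag_aff_def)
    have "(\<integral>w. p (diag_aff (\<lambda>i. \<tau> ^ s i) y w) * heat (\<tau> ^ (2 * m)) (diag_aff (\<lambda>i. \<tau> ^ s i) y w - y) \<partial>lborel)
       = (1 / (\<Prod>i\<in>UNIV. \<tau> ^ s i)) *\<^sub>R (\<integral>z. p z * heat (\<tau> ^ (2 * m)) (z - y) \<partial>lborel)"
    proof (rule integral_diag_aff)
      show "(\<lambda>z. p z * heat (\<tau> ^ (2 * m)) (z - y)) \<in> borel_measurable borel"
        using integrable_pgrow_schwartz[OF pc pg schwartz_heat_kernel, of "\<tau> ^ (2 * m)" y] \<tau> by auto
    qed (use \<tau> in simp)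
    moreover have "heat (\<tau> ^ (2 * m)) (diag_aff (\<lambda>i. \<tau> ^ s i) y w - y) = of_real ((1 / \<tau>) ^ hdim s) * heat 1 w" for w
      using heat_scaling[OF \<tau>, of "[]" "dil s \<tau> w"] by (simp add: d[symmetric] dil_inverse'[OF \<tau>] ldeg_def)
    ultimately have "(\<integral>w. of_real ((1 / \<tau>) ^ hdim s) * (p (dil s \<tau> w + y) * heat 1 w) \<partial>lborel) = of_real ((1 / \<tau>) ^ hdim s) * (\<integral>z. p z * heat (\<tau> ^ (2 * m)) (z - y) \<partial>lborel)"
      by (simp add: d prod_dil scaleR_conv_of_real power_one_over mult_ac)
    then show ?thesis using \<tau> by simp
  qed
  define \<tau> where "\<tau> = (\<lambda>k. 1 / real (Suc k))"
  have \<tau>: "\<tau> k > 0" "\<tau> k \<le> 1" for k by (auto simp: \<tau>_def)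
  obtain C q where C: "C \<ge> 0" "\<And>x. norm (p x) \<le> C * (1 + norm x) ^ q" using pgrowE[OF pg] by metis
  have H: "schwartz (heat 1)" by (rule schwartz_heat_kernel) simp
  have "(\<lambda>k. \<integral>w. p (dil s (\<tau> k) w + y) * heat 1 w \<partial>lborel) \<longlonglongrightarrow> (\<integral>w. p y * heat 1 w \<partial>lborel)"
  proof (rule integral_dominated_convergence[where w = "\<lambda>w. C * (1 + norm y + norm w) ^ q * norm (heat 1 w)"])
    have wc: "continuous_on UNIV (\<lambda>w::real^'n. C * (1 + norm y + norm w) ^ q)" by (intro continuous_intros)
    have wg: "pgrow (\<lambda>w::real^'n. C * (1 + norm y + norm w) ^ q)"
      unfolding pgrow_def
    proof (intro exI allI)
      fix w :: "real^'n"
      have "1 + norm y + norm w \<le> (1 + norm y) * (1 + norm w)" by (simp add: algebra_simps)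
      then have "(1 + norm y + norm w) ^ q \<le> ((1 + norm y) * (1 + norm w)) ^ q" by (intro power_mono) auto
      then show "norm (C * (1 + norm y + norm w) ^ q) \<le> (C * (1 + norm y) ^ q) * (1 + norm w) ^ q"
        using C(1) by (simp add: power_mult_distrib abs_mult mult.assoc mult_left_mono)
    qed
    show "integrable lborel (\<lambda>w. C * (1 + norm y + norm w) ^ q * norm (heat 1 w))"
      using integrable_weight_schwartz[OF wc wg H, of 0] by simp
    have Hm: "heat 1 \<in> borel_measurable borel" by (rule borel_measurable_continuous_onI[OF schwartz_cont[OF H]])
    then show "(\<lambda>w. p y * heat 1 w) \<in> borel_measurable lborel" by simp
    have "continuous_on UNIV (\<lambda>w. p (dil s (\<tau> k) w + y))" for k
      by (rule continuous_on_compose2[OF pc]) (auto simp: dil_def intro!: continuous_intros)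
    then have "(\<lambda>w. p (dil s (\<tau> k) w + y)) \<in> borel_measurable borel" for k
      by (rule borel_measurable_continuous_onI)
    then show "(\<lambda>w. p (dil s (\<tau> k) w + y) * heat 1 w) \<in> borel_measurable lborel" for k
      using Hm by simp
    show "AE w in lborel. (\<lambda>k. p (dil s (\<tau> k) w + y) * heat 1 w) \<longlonglongrightarrow> p y * heat 1 w"
    proof (intro AE_I2 tendsto_mult tendsto_const)
      fix w :: "real^'n"
      have "(\<lambda>k. dil s (\<tau> k) w + y) \<longlonglongrightarrow> 0 + y"
      proof (intro tendsto_add tendsto_const vec_tendstoI)
        fix i
        have t0: "\<tau> \<longlonglongrightarrow> 0" unfolding \<tau>_def using LIMSEQ_inverse_real_of_nat by (simp add: divide_inverse)
        have "(\<lambda>k. \<tau> k ^ s i * w $ i) \<longlonglongrightarrow> 0 ^ s i * w $ i" by (intro tendsto_mult tendsto_power t0 tendsto_const)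
        then show "(\<lambda>k. dil s (\<tau> k) w $ i) \<longlonglongrightarrow> 0 $ i" using s_ge_1[of i] by (simp add: power_0_left)
      qed
      moreover have "isCont p y" using pc by (simp add: continuous_on_eq_continuous_at)
      ultimately show "(\<lambda>k. p (dil s (\<tau> k) w + y)) \<longlonglongrightarrow> p y" by (intro isCont_tendsto_compose[of y p]) auto
    qed
    show "AE w in lborel. norm (p (dil s (\<tau> k) w + y) * heat 1 w) \<le> C * (1 + norm y + norm w) ^ q * norm (heat 1 w)" for k
    proof (rule AE_I2)
      fix w :: "real^'n"
      have "norm (dil s (\<tau> k) w + y) \<le> norm w + norm y"
        using norm_triangle_ineq[of "dil s (\<tau> k) w" y] dil_contraction[OF \<tau>, of k w] by linarith
      then have "(1 + norm (dil s (\<tau> k) w + y)) ^ q \<le> (1 + norm y + norm w) ^ q" by (intro power_mono) auto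
      then have "norm (p (dil s (\<tau> k) w + y)) \<le> C * (1 + norm y + norm w) ^ q"
        using C(2)[of "dil s (\<tau> k) w + y"] mult_left_mono[OF _ C(1)] order_trans by blast
      then show "norm (p (dil s (\<tau> k) w + y) * heat 1 w) \<le> C * (1 + norm y + norm w) ^ q * norm (heat 1 w)"
        by (simp add: norm_mult mult_right_mono)
    qed
  qed
  \<comment> \<open>The sequence is in fact constant, so its limit is the integral at the given time
    t.\<close>
  moreover have "(\<integral>w. p (dil s (\<tau> k) w + y) * heat 1 w \<partial>lborel) = (\<integral>z. p z * heat t (z - y) \<partial>lborel)" for k
    unfolding rescaled[OF \<tau>(1), symmetric] by (rule indep[symmetric]) (use \<tau> in simp)
  ultimately have "(\<lambda>k::nat. \<integral>z. p z * heat t (z - y) \<partial>lborel) \<longlonglongrightarrow> p y * kappa"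
    by (simp add: kappa_def)
  from LIMSEQ_unique[OF tendsto_const this] show ?thesis by (simp add: mult.commute)
qed

section \<open>The estimate at unit scale\<close>

text \<open>u and v stand for the germ members at x and y, moved to unit distance, and p for the
  polynomial between them. As v vanishes at y, p y = u y, so \<open>kappa\<close> times u y is the
  pairing of p with the kernel at y. Writing p as u minus (u - p) leaves a controlled pairing of u,
  and a remainder bounded by v and B.\<close>

lemma unit_scale_estimate:
  assumes \<alpha>: "0 < \<alpha>" "\<alpha> < \<eta>"
  shows "\<exists>C\<ge>0. \<forall>u N A B y v p. adm u N A \<longrightarrow> B \<ge> 0 \<longrightarrow> anorm y = 1 \<longrightarrow>
    slowly_growing p \<longrightarrow> (\<forall>l. ldeg s l = m \<longrightarrow> pderivs l p = (\<lambda>x. 0)) \<longrightarrow>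
    (\<forall>z. norm (v z) \<le> N * anorm (z - y) powr \<eta>) \<longrightarrow>
    (\<forall>z. norm (u z - v z - p z) \<le> B * anorm (z - y) powr \<alpha> * (1 + anorm (z - y)) powr (\<eta> - \<alpha>)) \<longrightarrow>
    norm (u y) \<le> C * (A + B) + N / 2"
proof -
  define k where "k = norm kappa"
  have k: "k > 0" using kappa_nonzero by (simp add: k_def)
  define J where "J = (\<integral>w. (0 + anorm w) powr \<eta> * norm (pderivs [] (heat 1) w) \<partial>lborel)"
  \<comment> \<open>The width is chosen so small that v, of size N |z - y|^\<eta>, contributes at
    most N k / 4. The controlled pairing gets the error k / 4 * N as well; after division by k both
    add up to N / 2.\<close>
  obtain \<tau> where \<tau>: "\<tau> > 0" "\<tau> powr (\<eta> - real (ldeg s [])) * J \<le> k / 4"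
    using small_powr_pos[of "\<eta> - real (ldeg s [])" "k / 4" J] eta_pos k by (auto simp: ldeg_def)
  define t where "t = \<tau> ^ (2 * m)"
  have t: "t > 0" using \<tau> by (simp add: t_def)
  have H: "schwartz (heat t)" by (rule schwartz_heat_kernel[OF t])
  have W: "(\<integral>z. anorm z powr \<eta> * norm (heat t z) \<partial>lborel) \<le> k / 4"
    using order_trans[OF heat_weight_bound[OF \<tau>(1), of 0 0 "[]"] \<tau>(2)[unfolded J_def]] \<tau>(1) by (simp add: t_def)
  define w2 where "w2 = (\<lambda>h. anorm h powr \<alpha> * (1 + anorm h) powr (\<eta> - \<alpha>))"
  have w2c: "continuous_on UNIV w2"
    unfolding w2_def using continuous_on_mult[OF continuous_anorm_powr[of \<alpha> 0] continuous_anorm_powr[of "\<eta> - \<alpha>" 1]] \<alpha> by simp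
  have w2g: "pgrow w2"
    unfolding w2_def using pgrow_mult[OF pgrow_anorm_powr[of \<alpha> 0] pgrow_anorm_powr[of "\<eta> - \<alpha>" 1]] \<alpha> by simp
  define I2 where "I2 = (\<integral>z. w2 z * norm (heat t z) \<partial>lborel)"
  have I2: "I2 \<ge> 0" unfolding I2_def w2_def by (intro Bochner_Integration.integral_nonneg) auto
  \<comment> \<open>Points with anorm y = 1 have coordinates of modulus at most 1, hence Euclidean
    norm at most CARD('n).\<close>
  have "controlled (real CARD('n)) (heat t)" using controlled_pderivs_heat[OF t, of "real CARD('n)" "[]"] by simp
  then obtain C1 where C1: "C1 \<ge> 0" "\<And>u N A y. adm u N A \<Longrightarrow> norm y \<le> real CARD('n) \<Longrightarrow>
     norm (\<integral>z. u z * heat t (z - y) \<partial>lborel) \<le> C1 * A + k / 4 * N"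
    unfolding controlled_def using k by (meson divide_pos_pos zero_less_numeral)
  define C where "C = (C1 + I2) / k"
  have C: "C \<ge> 0" using C1 I2 k by (simp add: C_def)
  have "norm (u y) \<le> C * (A + B) + N / 2"
    if u: "adm u N A" and B: "B \<ge> 0" and y: "anorm y = 1" and p: "slowly_growing p" and z: "\<forall>l. ldeg s l = m \<longrightarrow> pderivs l p = (\<lambda>x. 0)"
      and v: "\<forall>z. norm (v z) \<le> N * anorm (z - y) powr \<eta>"
      and uvp: "\<forall>z. norm (u z - v z - p z) \<le> B * anorm (z - y) powr \<alpha> * (1 + anorm (z - y)) powr (\<eta> - \<alpha>)" for u N A B y v p
  proof -
    have N: "N \<ge> 0" "A \<ge> 0" using u by (auto simp: adm_def)
    have uc: "continuous_on UNIV u" using u by (simp add: adm_def)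
    have pc: "continuous_on UNIV p" "pgrow p" using p by (auto intro: slowly_growing_cont slowly_growing_pgrow)
    \<comment> \<open>Both here and in the next line the bound contains 0 powr an exponent, which is
      0.\<close>
    have "v y = 0" using v[rule_format, of y] by simp
    then have py: "p y = u y" using uvp[rule_format, of y] by simp
    have yn: "norm y \<le> real CARD('n)"
    proof -
      have "norm y \<le> (\<Sum>i\<in>UNIV. \<bar>y $ i\<bar>)" by (rule norm_le_l1_cart)
      also have "\<dots> \<le> (\<Sum>i\<in>(UNIV::'n set). 1)"
        using component_le_anorm[of y] y by (intro sum_mono) auto
      finally show ?thesis by simp
    qed
    have iu: "integrable lborel (\<lambda>z. u z * heat t (z - y))" by (rule adm_integrable[OF u H])
    have ip: "integrable lborel (\<lambda>z. p z * heat t (z - y))" by (rule integrable_pgrow_schwartz[OF pc H])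
    have i1: "integrable lborel (\<lambda>z. anorm (z - y) powr \<eta> * norm (heat t (z - y)))"
      using integrable_shift[OF integrable_weight_schwartz[OF weight_cont weight_pgrow H, of 0], of "- y"] by simp
    have i2: "integrable lborel (\<lambda>z. w2 (z - y) * norm (heat t (z - y)))"
      using integrable_shift[OF integrable_weight_schwartz[OF w2c w2g H, of 0], of "- y"] by simp
    have e1: "(\<integral>z. anorm (z - y) powr \<eta> * norm (heat t (z - y)) \<partial>lborel) = (\<integral>z. anorm z powr \<eta> * norm (heat t z) \<partial>lborel)"
      using integral_shift[of "\<lambda>z. anorm z powr \<eta> * norm (heat t z)" "- y"] integrable_weight_schwartz[OF weight_cont weight_pgrow H, of 0]
      by (simp add: borel_measurable_integrable)
    have e2: "(\<integral>z. w2 (z - y) * norm (heat t (z - y)) \<partial>lborel) = I2"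
      unfolding I2_def using integral_shift[of "\<lambda>z. w2 z * norm (heat t z)" "- y"] integrable_weight_schwartz[OF w2c w2g H, of 0]
      by (simp add: borel_measurable_integrable)
    have "norm (\<integral>z. (u z - p z) * heat t (z - y) \<partial>lborel) \<le> (\<integral>z. norm ((u z - p z) * heat t (z - y)) \<partial>lborel)"
      by (rule integral_norm_bound)
    also have "\<dots> \<le> (\<integral>z. N * (anorm (z - y) powr \<eta> * norm (heat t (z - y))) + B * (w2 (z - y) * norm (heat t (z - y))) \<partial>lborel)"
    proof (rule integral_mono)
      show "integrable lborel (\<lambda>z. norm ((u z - p z) * heat t (z - y)))"
        using Bochner_Integration.integrable_diff[OF iu ip] by (intro integrable_norm) (simp add: left_diff_distrib)
      show "integrable lborel (\<lambda>z. N * (anorm (z - y) powr \<eta> * norm (heat t (z - y))) + B * (w2 (z - y) * norm (heat t (z - y))))"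
        by (intro Bochner_Integration.integrable_add integrable_mult_right i1 i2)
      fix z
      have "norm (u z - p z) \<le> norm (u z - v z - p z) + norm (v z)"
        using norm_triangle_ineq[of "u z - v z - p z" "v z"] by simp
      also have "\<dots> \<le> B * w2 (z - y) + N * anorm (z - y) powr \<eta>"
        using uvp[rule_format, of z] v[rule_format, of z] by (simp add: w2_def mult.assoc)
      finally have "norm (u z - p z) * norm (heat t (z - y)) \<le> (B * w2 (z - y) + N * anorm (z - y) powr \<eta>) * norm (heat t (z - y))"
        by (rule mult_right_mono) simp
      then show "norm ((u z - p z) * heat t (z - y)) \<le> N * (anorm (z - y) powr \<eta> * norm (heat t (z - y))) + B * (w2 (z - y) * norm (heat t (z - y)))"
        unfolding norm_mult by (simp add: algebra_simps)
    qed
    also have "\<dots> = N * (\<integral>z. anorm z powr \<eta> * norm (heat t z) \<partial>lborel) + B * I2"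
      by (subst Bochner_Integration.integral_add) (simp_all add: i1 i2 e1 e2)
    also have "\<dots> \<le> N * (k / 4) + B * I2" by (intro add_mono mult_left_mono W N order_refl)
    finally have diff: "norm (\<integral>z. (u z - p z) * heat t (z - y) \<partial>lborel) \<le> N * (k / 4) + B * I2" .
    have "kappa * u y = (\<integral>z. p z * heat t (z - y) \<partial>lborel)"
      using heat_reproduces[OF p z[rule_format] t, of y] py by simp
    also have "\<dots> = (\<integral>z. u z * heat t (z - y) \<partial>lborel) - (\<integral>z. (u z - p z) * heat t (z - y) \<partial>lborel)"
      by (simp add: left_diff_distrib iu ip)
    finally have "k * norm (u y) \<le> norm (\<integral>z. u z * heat t (z - y) \<partial>lborel) + norm (\<integral>z. (u z - p z) * heat t (z - y) \<partial>lborel)"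
      unfolding k_def norm_mult[symmetric] by (simp add: norm_triangle_ineq4)
    also have "\<dots> \<le> (C1 * A + k / 4 * N) + (N * (k / 4) + B * I2)"
      by (intro add_mono C1(2)[OF u yn] diff)
    also have "\<dots> \<le> (C1 + I2) * (A + B) + k * (N / 2)"
    proof -
      have "C1 * A + B * I2 \<le> (C1 + I2) * (A + B)" using C1(1) I2 N B by (simp add: algebra_simps)
      then show ?thesis by (simp add: algebra_simps)
    qed
    finally have "norm (u y) \<le> ((C1 + I2) * (A + B) + k * (N / 2)) / k"
      using k by (simp add: pos_le_divide_eq mult.commute)
    also have "((C1 + I2) * (A + B) + k * (N / 2)) / k = C * (A + B) + N / 2"
      using k by (simp add: C_def field_simps)
    finally show ?thesis .
  qed
  with C show ?thesis by (intro exI[of _ C]) blast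
qed

end

section \<open>Anisotropic polynomials\<close>

lemma pderivs_sum:
  assumes "finite A" "\<And>k. k \<in> A \<Longrightarrow> smooth (f k)"
  shows "pderivs l (\<lambda>x. \<Sum>k\<in>A. f k x) = (\<lambda>x. \<Sum>k\<in>A. pderivs l (f k) x)"
  using assms
proof (induction A)
  case empty
  show ?case using pderivs_cmult[OF smooth_const[of 0], of l 0] by simp
next
  case (insert k A)
  then show ?case by (simp add: pderivs_add smooth_sum)
qed

definition monomial :: "('n::finite \<Rightarrow> nat) \<Rightarrow> real^'n \<Rightarrow> complex" where
  "monomial \<beta> x = (\<Prod>i\<in>UNIV. complex_of_real (x $ i) ^ \<beta> i)"

lemma monomial_cpoly: "monomial \<beta> \<in> cpoly"
proof -
  have "(\<lambda>x. \<Prod>i\<in>A. complex_of_real (x $ i) ^ \<beta> i) \<in> cpoly" for A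
  proof (induction A rule: infinite_finite_induct)
    case (insert i A)
    then show ?case using cpoly.mult[OF cpoly_power[OF cpoly.coord[of i], of "\<beta> i"] insert(3)] by simp
  qed (auto intro: cpoly.const)
  then show ?thesis by (simp add: monomial_def[abs_def])
qed

text \<open>For \<beta> j = 0 the truncated subtraction leaves the monomial unchanged, and the
  factor \<beta> j makes the derivative 0.\<close>

lemma has_pd_monomial:
  "has_pd j (monomial \<beta>) (\<lambda>x. of_nat (\<beta> j) * monomial (\<beta>(j := \<beta> j - 1)) x)"
  unfolding has_pd_def
proof
  fix x :: "real^'a"
  define R where "R = (\<Prod>i\<in>UNIV - {j}. complex_of_real (x $ i) ^ \<beta> i)"
  have split: "monomial \<gamma> y = complex_of_real (y $ j) ^ \<gamma> j * (\<Prod>i\<in>UNIV - {j}. complex_of_real (y $ i) ^ \<gamma> i)" for \<gamma> y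
    unfolding monomial_def by (rule prod.remove) auto
  have line: "monomial \<beta> (x + t *\<^sub>R axis j 1) = complex_of_real ((x $ j + t) ^ \<beta> j) * R" for t
  proof -
    have "(\<Prod>i\<in>UNIV - {j}. complex_of_real ((x + t *\<^sub>R axis j 1) $ i) ^ \<beta> i) = R"
      unfolding R_def by (intro prod.cong) (auto simp: axis_def)
    then show ?thesis by (simp add: split axis_def)
  qed
  have "((\<lambda>t. (x $ j + t) ^ \<beta> j) has_real_derivative real (\<beta> j) * (x $ j + 0) ^ (\<beta> j - 1)) (at 0)"
    by (auto intro!: derivative_eq_intros)
  then have "((\<lambda>t. complex_of_real ((x $ j + t) ^ \<beta> j)) has_vector_derivative of_real (real (\<beta> j) * (x $ j + 0) ^ (\<beta> j - 1))) (at 0)"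
    by (rule has_vector_derivative_of_real)
  from has_vector_derivative_mult_left[OF this, of R]
  have "((\<lambda>t. monomial \<beta> (x + t *\<^sub>R axis j 1)) has_vector_derivative of_real (real (\<beta> j) * (x $ j + 0) ^ (\<beta> j - 1)) * R) (at 0)"
    unfolding line .
  moreover have "(\<Prod>i\<in>UNIV - {j}. complex_of_real (x $ i) ^ (\<beta>(j := \<beta> j - 1)) i) = R"
    unfolding R_def by (intro prod.cong) auto
  then have "monomial (\<beta>(j := \<beta> j - 1)) x = complex_of_real (x $ j) ^ (\<beta> j - 1) * R"
    using split[of "\<beta>(j := \<beta> j - 1)" x] by simp
  ultimately show "((\<lambda>t. monomial \<beta> (x + t *\<^sub>R axis j 1)) has_vector_derivative of_nat (\<beta> j) * monomial (\<beta>(j := \<beta> j - 1)) x) (at 0)"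
    by (simp only: of_real_mult of_real_of_nat_eq of_real_power add_0_right mult.assoc)
qed

context scaling
begin

lemma aniso_deg_decrease:
  assumes "\<beta> j > 0" shows "aniso_deg s (\<beta>(j := \<beta> j - 1)) + s j = aniso_deg s \<beta>"
proof -
  have "aniso_deg s \<gamma> = s j * \<gamma> j + (\<Sum>i\<in>UNIV - {j}. s i * \<gamma> i)" for \<gamma>
    unfolding aniso_deg_def by (rule sum.remove) auto
  moreover have "(\<Sum>i\<in>UNIV - {j}. s i * (\<beta>(j := \<beta> j - 1)) i) = (\<Sum>i\<in>UNIV - {j}. s i * \<beta> i)"
    by (intro sum.cong) auto
  moreover have "s j * (\<beta> j - 1) + s j = s j * \<beta> j" using assms by (cases "\<beta> j") auto
  ultimately show ?thesis by simp
qed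

lemma smooth_monomial: "smooth (monomial \<beta>)"
  using cpoly_slowly_growing[OF monomial_cpoly, of \<beta>] unfolding slowly_growing_def by (rule conjunct1)

lemma pderivs_monomial:
  "aniso_deg s \<beta> < ldeg s l \<Longrightarrow> pderivs l (monomial \<beta>) = (\<lambda>x. 0)"
\<comment> \<open>Induction from the end of the list, as the last entry is the derivative applied
  first and lowers the monomial.\<close>
proof (induction l arbitrary: \<beta> rule: rev_induct)
  case Nil
  then show ?case by (simp add: ldeg_def)
next
  case (snoc j l)
  have "pderivs (l @ [j]) (monomial \<beta>) = pderivs l (\<lambda>x. of_nat (\<beta> j) * monomial (\<beta>(j := \<beta> j - 1)) x)"
    unfolding pderivs_snoc[symmetric] has_pd_partial[OF has_pd_monomial] ..
  also have "\<dots> = (\<lambda>x. of_nat (\<beta> j) * pderivs l (monomial (\<beta>(j := \<beta> j - 1))) x)"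
    by (rule pderivs_cmult[OF smooth_monomial])
  also have "\<dots> = (\<lambda>x. 0)"
  proof (cases "\<beta> j = 0")
    case False
    then have "aniso_deg s (\<beta>(j := \<beta> j - 1)) < ldeg s l"
      using aniso_deg_decrease[of \<beta> j] snoc.prems by (simp add: ldeg_def)
    then show ?thesis by (simp only: snoc.IH mult_zero_right)
  qed simp
  finally show ?case .
qed

lemma aniso_polys_monomial:
  assumes "p \<in> aniso_polys s k"
  obtains c where "p = (\<lambda>z. \<Sum>\<beta>\<in>{\<beta>. aniso_deg s \<beta> \<le> k}. c \<beta> * monomial \<beta> z)"
  using assms by (auto simp: aniso_polys_def monomial_def)

lemma aniso_polys_slowly_growing:
  assumes "p \<in> aniso_polys s k" shows "slowly_growing p"
proof -
  obtain c where c: "p = (\<lambda>z. \<Sum>\<beta>\<in>{\<beta>. aniso_deg s \<beta> \<le> k}. c \<beta> * monomial \<beta> z)"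
    using aniso_polys_monomial[OF assms] by blast
  show ?thesis unfolding c
    by (intro cpoly_slowly_growing cpoly_sum cpoly.mult cpoly.const monomial_cpoly)
qed

lemma aniso_polys_pderivs:
  assumes "p \<in> aniso_polys s k" "k < ldeg s l" shows "pderivs l p = (\<lambda>x. 0)"
proof -
  obtain c where c: "p = (\<lambda>z. \<Sum>\<beta>\<in>{\<beta>. aniso_deg s \<beta> \<le> k}. c \<beta> * monomial \<beta> z)"
    using aniso_polys_monomial[OF assms(1)] by blast
  have "pderivs l p = (\<lambda>z. \<Sum>\<beta>\<in>{\<beta>. aniso_deg s \<beta> \<le> k}. pderivs l (\<lambda>z. c \<beta> * monomial \<beta> z) z)"
    unfolding c by (rule pderivs_sum[OF finite_aniso_deg smooth_cmult[OF smooth_monomial]])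
  also have "\<dots> = (\<lambda>z. 0)"
  proof (rule ext, rule sum.neutral, rule ballI)
    fix z \<beta> assume "\<beta> \<in> {\<beta>. aniso_deg s \<beta> \<le> k}"
    then have "aniso_deg s \<beta> < ldeg s l" using assms(2) by simp
    then show "pderivs l (\<lambda>z. c \<beta> * monomial \<beta> z) z = 0"
      by (simp add: pderivs_cmult[OF smooth_monomial] pderivs_monomial)
  qed
  finally show ?thesis .
qed

end

lemma slowly_growing_diag_aff:
  assumes p: "slowly_growing p" shows "slowly_growing (\<lambda>x. p (diag_aff r b x))"
proof -
  have "\<exists>C\<ge>0. \<forall>x::real^'a. 1 + norm (diag_aff r b x) \<le> C * (1 + norm x)"
  proof (intro exI conjI allI)
    let ?R = "\<Sum>i\<in>UNIV. \<bar>r i\<bar>"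
    have R: "?R \<ge> 0" by (intro sum_nonneg) auto
    then show "1 + norm b + ?R \<ge> 0" by simp
    fix x :: "real^'a"
    have "norm (\<chi> i. r i * x $ i) \<le> (\<Sum>i\<in>UNIV. \<bar>(\<chi> i. r i * x $ i) $ i\<bar>)" by (rule norm_le_l1_cart)
    also have "\<dots> \<le> (\<Sum>i\<in>UNIV. \<bar>r i\<bar> * norm x)"
      by (intro sum_mono) (simp add: abs_mult component_le_norm_cart mult_left_mono)
    also have "\<dots> = ?R * norm x" by (simp add: sum_distrib_right)
    finally have 1: "norm (\<chi> i. r i * x $ i) \<le> ?R * norm x" .
    have "diag_aff r b x = (\<chi> i. r i * x $ i) + b" by (simp add: diag_aff_def vec_eq_iff)
    then have "norm (diag_aff r b x) \<le> ?R * norm x + norm b"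
      using 1 norm_triangle_ineq[of "\<chi> i. r i * x $ i" b] by simp
    moreover have "0 \<le> norm b * norm x" by simp
    moreover have "(1 + norm b + ?R) * (1 + norm x) = 1 + norm b + ?R + norm x + norm b * norm x + ?R * norm x"
      by (simp add: algebra_simps)
    ultimately show "1 + norm (diag_aff r b x) \<le> (1 + norm b + ?R) * (1 + norm x)"
      using R norm_ge_zero[of x] by linarith
  qed
  then obtain C where C: "C \<ge> 0" "\<And>x::real^'a. 1 + norm (diag_aff r b x) \<le> C * (1 + norm x)" by blast
  have pg: "pgrow (\<lambda>x. g (diag_aff r b x))" if "pgrow g" for g :: "real^'a \<Rightarrow> complex"
  proof -
    obtain D q where D: "D \<ge> 0" "\<And>x. norm (g x) \<le> D * (1 + norm x) ^ q" using pgrowE[OF \<open>pgrow g\<close>] by metis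
    have "norm (g (diag_aff r b x)) \<le> (D * C ^ q) * (1 + norm x) ^ q" for x
    proof -
      have "(1 + norm (diag_aff r b x)) ^ q \<le> (C * (1 + norm x)) ^ q" by (intro power_mono C) simp
      then have "D * (1 + norm (diag_aff r b x)) ^ q \<le> D * (C * (1 + norm x)) ^ q" by (intro mult_left_mono D)
      with D(2)[of "diag_aff r b x"] show ?thesis by (simp add: power_mult_distrib mult.assoc)
    qed
    then show ?thesis unfolding pgrow_def by blast
  qed
  have s: "smooth p" using p by (simp add: slowly_growing_def)
  have "pgrow (pderivs l (\<lambda>x. p (diag_aff r b x)))" for l
    unfolding pderivs_diag_aff[OF s] using p by (intro pgrow_mult pgrow_const pg) (simp add: slowly_growing_def)
  then show ?thesis using s by (simp add: slowly_growing_def smooth_diag_aff)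
qed

section \<open>Germs at a fixed scale\<close>

context elliptic_germ
begin

lemma testB_schwartz:
  assumes "\<phi> \<in> testB s \<gamma>" shows "schwartz \<phi>"
  by (rule test_fun_schwartz[of UNIV]) (use assms in \<open>auto simp: testB_def test_fun_def\<close>)

lemma schwartz_rescale:
  assumes "lam > 0" "schwartz \<phi>" shows "schwartz (rescale s \<phi> x lam)"
proof -
  have "schwartz (\<lambda>y. of_real (1 / lam ^ hdim s) * \<phi> (diag_aff (\<lambda>i. (1 / lam) ^ s i) 0 (y - x)))"
    using assms by (intro schwartz_cmult schwartz_shift[OF schwartz_diag]) auto
  then show ?thesis by (simp add: rescale_eq[OF assms(1), abs_def] dil_def)
qed

lemma dil_affine: "x + dil s r z = diag_aff (\<lambda>i. r ^ s i) x z"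
  by (simp add: vec_eq_iff diag_aff_def)

lemma opL_t_diag_aff:
  assumes "smooth f"
  shows "Lt (\<lambda>z. f (x + dil s r z)) z = of_real (r ^ m) * Lt f (x + dil s r z)"
proof -
  have "Lt (\<lambda>z. f (x + dil s r z)) z = (\<Sum>\<gamma>\<in>{\<gamma>. aniso_deg s \<gamma> = m}. of_real (r ^ m) * (opl_coeff a \<gamma> * pderivs (mlist \<gamma>) f (x + dil s r z)))"
    unfolding opL_t_pderivs dil_affine pderivs_diag_aff[OF assms] prod_list_dil ldeg_mlist
    by (intro sum.cong) auto
  then show ?thesis by (simp add: opL_t_pderivs sum_distrib_left)
qed

lemma aniso_dist_dil: "r > 0 \<Longrightarrow> aniso_dist s (x + dil s r y) (x + dil s r z) = r * anorm (z - y)"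
  using anorm_dil[of r "z - y"] by (subst aniso_dist_eq) (simp add: dil_diff)

text \<open>The operator is homogeneous of degree m, so a test function of scale lam around 0
  corresponds to one of scale lam * r around x, with a factor r ^ m. Together with (lam * r) powr
  (\<eta> - m) this gives r powr \<eta>, the same factor that N acquires.\<close>

lemma adm_rescaled:
  assumes cont: "continuous_on UNIV (U x)" and N: "N \<ge> 0" "\<And>y. norm (U x y) \<le> N * aniso_dist s x y powr \<eta>"
    and A: "A \<ge> 0" "\<And>\<phi> lam. \<phi> \<in> testB s (\<eta> - real m) \<Longrightarrow> lam > 0 \<Longrightarrow>
       lam powr (- (\<eta> - real m)) * norm (opL_germ s m a U x (rescale s \<phi> x lam)) \<le> A"
    and r: "r > 0"
  shows "adm (\<lambda>z. U x (x + dil s r z)) (N * r powr \<eta>) (A * r powr \<eta>)"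
  unfolding adm_def
proof (intro conjI allI ballI impI)
  show "continuous_on UNIV (\<lambda>z. U x (x + dil s r z))"
    unfolding dil_affine by (rule continuous_on_diag_comp[OF cont])
  show "0 \<le> N * r powr \<eta>" "0 \<le> A * r powr \<eta>" using N A by auto
  show "norm (U x (x + dil s r z)) \<le> N * r powr \<eta> * anorm z powr \<eta>" for z
    using N(2)[of "x + dil s r z"] aniso_dist_dil[OF r, of x 0 z] r by (simp add: powr_mult mult.assoc)
  fix \<phi> lam assume \<phi>: "\<phi> \<in> testB s (\<eta> - real m)" and lam: "0 < (lam::real)"
  \<comment> \<open>The test function seen by the original germ member.\<close>
  define F where "F = rescale s \<phi> x (lam * r)"
  have F: "schwartz F" unfolding F_def using lam r by (intro schwartz_rescale testB_schwartz[OF \<phi>]) simp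
  have LF: "schwartz (Lt F)" by (rule schwartz_opL_t[OF F])
  have "pgrow (\<lambda>z. N * anorm (z - x) powr \<eta>)"
  proof -
    have "pgrow (\<lambda>z. (anorm x + anorm z) powr \<eta>)" using eta_pos by (intro pgrow_anorm_powr) auto
    then have "pgrow (\<lambda>z. N * (anorm x + anorm z) powr \<eta>)" by (intro pgrow_mult pgrow_const)
    then show ?thesis
    proof (rule pgrow_bound)
      fix z
      have "anorm (z - x) \<le> anorm x + anorm z"
        using anorm_triangle[of z "- x"] by (simp add: aniso_dist_def)
      then have "anorm (z - x) powr \<eta> \<le> (anorm x + anorm z) powr \<eta>" using eta_pos by (intro powr_mono2) auto
      then show "norm (N * anorm (z - x) powr \<eta>) \<le> norm (N * (anorm x + anorm z) powr \<eta>)"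
        using N(1) by (simp add: abs_mult mult_left_mono)
    qed
  qed
  then have pg: "pgrow (U x)"
    by (rule pgrow_bound) (use N in \<open>simp add: aniso_dist_eq[of s x] abs_mult\<close>)
  have int: "integrable lborel (\<lambda>z. U x z * Lt F z)"
    using integrable_pgrow_schwartz[OF cont pg LF, of 0] by simp
  have germ: "opL_germ s m a U x F = (\<integral>z. U x z * Lt F z \<partial>lborel)"
    unfolding opL_germ_def opL_distr_def by (rule fun_distr_eq[OF int])
  have resc: "rescale s \<phi> 0 lam = (\<lambda>z. of_real (r ^ hdim s) * F (x + dil s r z))"
  proof
    fix z
    have "dil s (1 / (lam * r)) (dil s r z) = dil s (1 / lam) z"
      using r by (simp add: vec_eq_iff power_divide power_mult_distrib)
    then show "rescale s \<phi> 0 lam z = of_real (r ^ hdim s) * F (x + dil s r z)"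
      unfolding F_def using lam r by (simp add: rescale_eq power_mult_distrib)
  qed
  have sm: "smooth (\<lambda>z. F (x + dil s r z))" unfolding dil_affine by (rule smooth_diag_aff[OF schwartz_smooth[OF F]])
  have "(\<integral>z. U x (x + dil s r z) * Lt (rescale s \<phi> 0 lam) z \<partial>lborel)
      = (\<integral>z. of_real (r ^ hdim s * r ^ m) * (U x (x + dil s r z) * Lt F (x + dil s r z)) \<partial>lborel)"
    unfolding resc opL_t_cmult[OF sm] opL_t_diag_aff[OF schwartz_smooth[OF F]] by (simp add: mult_ac)
  also have "\<dots> = of_real (r ^ hdim s * r ^ m) * (\<integral>z. U x (x + dil s r z) * Lt F (x + dil s r z) \<partial>lborel)"
    by (rule integral_mult_right_zero)
  also have "(\<integral>z. U x (x + dil s r z) * Lt F (x + dil s r z) \<partial>lborel) = (1 / (\<Prod>i\<in>UNIV. r ^ s i)) *\<^sub>R (\<integral>z. U x z * Lt F z \<partial>lborel)"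
    unfolding dil_affine by (rule integral_diag_aff) (use r int in \<open>auto simp: borel_measurable_integrable\<close>)
  also have "of_real (r ^ hdim s * r ^ m) * ((1 / (\<Prod>i\<in>UNIV. r ^ s i)) *\<^sub>R (\<integral>z. U x z * Lt F z \<partial>lborel)) = of_real (r ^ m) * opL_germ s m a U x F"
    unfolding prod_dil germ using r by (simp add: scaleR_conv_of_real)
  finally have "norm (\<integral>z. U x (x + dil s r z) * Lt (rescale s \<phi> 0 lam) z \<partial>lborel) = r ^ m * norm (opL_germ s m a U x F)"
    using r by (simp add: norm_mult norm_power)
  also have "\<dots> \<le> r ^ m * (A * (lam * r) powr (\<eta> - real m))"
  proof (rule mult_left_mono)
    have "(lam * r) powr (- (\<eta> - real m)) * norm (opL_germ s m a U x F) \<le> A"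
      unfolding F_def using lam r by (intro A(2) \<phi>) simp
    then show "norm (opL_germ s m a U x F) \<le> A * (lam * r) powr (\<eta> - real m)"
      using lam r by (simp add: powr_minus divide_inverse[symmetric] mult.commute[of "inverse _"] pos_divide_le_eq del: minus_diff_eq)
  qed (use r in simp)
  also have "r ^ m * (A * (lam * r) powr (\<eta> - real m)) = A * r powr \<eta> * lam powr (\<eta> - real m)"
    using lam r by (simp add: powr_mult powr_diff powr_realpow)
  finally show "norm (\<integral>z. U x (x + dil s r z) * Lt (rescale s \<phi> 0 lam) z \<partial>lborel) \<le> A * r powr \<eta> * lam powr (\<eta> - real m)" .
qed

text \<open>Translation by x and dilation by r = d(x,y) reduce to unit distance; N, A and B all
  acquire the factor r powr \<eta>, which is the power of the distance claimed. The constant N is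
  thereby improved to N / 2 plus the seminorms.\<close>

lemma germ_estimate:
  assumes \<alpha>: "0 < \<alpha>" "\<alpha> < \<eta>"
  shows "\<exists>C\<ge>0. \<forall>U N A B. (\<forall>x. continuous_on UNIV (U x)) \<longrightarrow> N \<ge> 0 \<longrightarrow> A \<ge> 0 \<longrightarrow> B \<ge> 0 \<longrightarrow>
    (\<forall>x y. norm (U x y) \<le> N * aniso_dist s x y powr \<eta>) \<longrightarrow>
    (\<forall>\<phi> x lam. \<phi> \<in> testB s (\<eta> - real m) \<longrightarrow> lam > 0 \<longrightarrow>
       lam powr (- (\<eta> - real m)) * norm (opL_germ s m a U x (rescale s \<phi> x lam)) \<le> A) \<longrightarrow>
    (\<forall>x y. \<exists>P\<in>aniso_polys s (nat \<lfloor>\<eta>\<rfloor>). \<forall>z. norm (U x z - U y z - P z) \<le>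
           B * aniso_dist s y z powr \<alpha> * (aniso_dist s x y + aniso_dist s y z) powr (\<eta> - \<alpha>)) \<longrightarrow>
    (\<forall>x y. norm (U x y) \<le> (C * (A + B) + N / 2) * aniso_dist s x y powr \<eta>)"
proof -
  obtain C where C: "C \<ge> 0" "\<forall>u N A B y v p. adm u N A \<longrightarrow> B \<ge> 0 \<longrightarrow> anorm y = 1 \<longrightarrow>
    slowly_growing p \<longrightarrow> (\<forall>l. ldeg s l = m \<longrightarrow> pderivs l p = (\<lambda>x. 0)) \<longrightarrow>
    (\<forall>z. norm (v z) \<le> N * anorm (z - y) powr \<eta>) \<longrightarrow>
    (\<forall>z. norm (u z - v z - p z) \<le> B * anorm (z - y) powr \<alpha> * (1 + anorm (z - y)) powr (\<eta> - \<alpha>)) \<longrightarrow>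
    norm (u y) \<le> C * (A + B) + N / 2"
    using unit_scale_estimate[OF \<alpha>] by auto
  show ?thesis
  proof (intro exI[of _ C] conjI C(1) allI impI)
    fix U :: "real^'n \<Rightarrow> real^'n \<Rightarrow> complex" and N A B :: real and x y :: "real^'n"
    assume cont: "\<forall>x. continuous_on UNIV (U x)" and NAB: "0 \<le> N" "0 \<le> A" "0 \<le> B"
      and UN: "\<forall>x y. norm (U x y) \<le> N * aniso_dist s x y powr \<eta>"
      and UA: "\<forall>\<phi> x lam. \<phi> \<in> testB s (\<eta> - real m) \<longrightarrow> lam > 0 \<longrightarrow>
       lam powr (- (\<eta> - real m)) * norm (opL_germ s m a U x (rescale s \<phi> x lam)) \<le> A"
      and UB: "\<forall>x y. \<exists>P\<in>aniso_polys s (nat \<lfloor>\<eta>\<rfloor>). \<forall>z. norm (U x z - U y z - P z) \<le>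
           B * aniso_dist s y z powr \<alpha> * (aniso_dist s x y + aniso_dist s y z) powr (\<eta> - \<alpha>)"
    define r where "r = aniso_dist s x y"
    show "norm (U x y) \<le> (C * (A + B) + N / 2) * aniso_dist s x y powr \<eta>"
    proof (cases "r = 0")
      case True
      then show ?thesis using UN[rule_format, of x y] by (simp add: r_def)
    next
      case False
      then have r: "r > 0" using aniso_dist_nonneg[of s x y] by (simp add: r_def less_le)
      define w where "w = dil s (1 / r) (y - x)"
      have y: "y = x + dil s r w" by (simp add: w_def dil_inverse[OF r])
      have w1: "anorm w = 1"
        using anorm_dil[of "1 / r" "y - x"] r aniso_dist_eq[of s x y] by (simp add: w_def r_def)
      obtain P where P: "P \<in> aniso_polys s (nat \<lfloor>\<eta>\<rfloor>)" "\<And>z. norm (U x z - U y z - P z) \<le>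
           B * aniso_dist s y z powr \<alpha> * (aniso_dist s x y + aniso_dist s y z) powr (\<eta> - \<alpha>)"
        using UB by blast
      \<comment> \<open>Makes the polynomial vanish under all derivatives of degree m, as
        \<open>heat_reproduces\<close> demands.\<close>
      have low: "nat \<lfloor>\<eta>\<rfloor> < m" using eta_less eta_pos by linarith
      have Psg: "slowly_growing P" by (rule aniso_polys_slowly_growing[OF P(1)])
      have Ps: "smooth P" using Psg by (simp add: slowly_growing_def)
      have dist: "aniso_dist s y (x + dil s r z) = r * anorm (z - w)" for z
        unfolding y by (rule aniso_dist_dil[OF r])
      have "norm (U x (x + dil s r w)) \<le> C * (A * r powr \<eta> + B * r powr \<eta>) + (N * r powr \<eta>) / 2"
      proof (rule C(2)[rule_format, where v = "\<lambda>z. U y (x + dil s r z)" and p = "\<lambda>z. P (x + dil s r z)" and u = "\<lambda>z. U x (x + dil s r z)"])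
        show "adm (\<lambda>z. U x (x + dil s r z)) (N * r powr \<eta>) (A * r powr \<eta>)"
          by (rule adm_rescaled) (use cont NAB UN UA r in auto)
        show "0 \<le> B * r powr \<eta>" using NAB by simp
        show "anorm w = 1" by (rule w1)
        show "slowly_growing (\<lambda>z. P (x + dil s r z))"
          unfolding dil_affine by (rule slowly_growing_diag_aff[OF Psg])
        show "pderivs l (\<lambda>z. P (x + dil s r z)) = (\<lambda>x. 0)" if "ldeg s l = m" for l
          unfolding dil_affine pderivs_diag_aff[OF Ps] using aniso_polys_pderivs[OF P(1), of l] low that by simp
        show "norm (U y (x + dil s r z)) \<le> N * r powr \<eta> * anorm (z - w) powr \<eta>" for z
          using UN[rule_format, of y "x + dil s r z"] r by (simp add: dist powr_mult mult.assoc)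
        fix z
        have "norm (U x (x + dil s r z) - U y (x + dil s r z) - P (x + dil s r z)) \<le>
            B * (r * anorm (z - w)) powr \<alpha> * (r + r * anorm (z - w)) powr (\<eta> - \<alpha>)"
          using P(2)[of "x + dil s r z"] unfolding dist r_def[symmetric] .
        also have "(r + r * anorm (z - w)) = r * (1 + anorm (z - w))" by (simp add: algebra_simps)
        also have "B * (r * anorm (z - w)) powr \<alpha> * (r * (1 + anorm (z - w))) powr (\<eta> - \<alpha>)
            = B * (r powr \<alpha> * r powr (\<eta> - \<alpha>)) * anorm (z - w) powr \<alpha> * (1 + anorm (z - w)) powr (\<eta> - \<alpha>)"
          using r by (simp add: powr_mult mult_ac)
        also have "r powr \<alpha> * r powr (\<eta> - \<alpha>) = r powr \<eta>" by (simp add: powr_add[symmetric])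
        finally show "norm (U x (x + dil s r z) - U y (x + dil s r z) - P (x + dil s r z)) \<le>
            B * r powr \<eta> * anorm (z - w) powr \<alpha> * (1 + anorm (z - w)) powr (\<eta> - \<alpha>)" .
      qed
      then show ?thesis
        unfolding y[symmetric] r_def[symmetric] by (simp add: algebra_simps)
    qed
  qed
qed

end

section \<open>From real constants to infima in the extended reals\<close>

lemma ereal_Inf_approx:
  assumes "Inf {ereal M | M. M > 0 \<and> Q M} < \<infinity>" "e > 0"
  obtains M where "M > 0" "Q M" "ereal M \<le> Inf {ereal M | M. M > 0 \<and> Q M} + ereal e"
proof -
  define I where "I = Inf {ereal M | M. M > 0 \<and> Q M}"
  have "0 \<le> I" unfolding I_def by (rule Inf_greatest) (auto simp: less_imp_le)
  then have "I < I + ereal e" using assms by (cases I) (auto simp: I_def[symmetric])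
  then obtain X where "X \<in> {ereal M | M. M > 0 \<and> Q M}" "X < I + ereal e"
    unfolding I_def by (auto simp: Inf_less_iff)
  then show ?thesis using that unfolding I_def by (auto simp: less_imp_le)
qed

theorem theorem3p1:
  fixes s :: "'n::finite \<Rightarrow> nat" and m :: nat and a :: "('n \<Rightarrow> nat) \<Rightarrow> complex"
    and \<alpha> \<eta> :: real
  assumes "\<forall>i. s i \<ge> 1"
    and "elliptic s m a"
    and "0 < \<alpha>" and "\<alpha> < \<eta>" and "\<eta> < real m"
    and "\<alpha> \<notin> \<nat>" and "\<eta> \<notin> \<nat>"
  shows "\<exists>C::real. \<forall>U :: real^'n \<Rightarrow> real^'n \<Rightarrow> complex.
           (\<forall>x. continuous_on UNIV (U x)) \<longrightarrow> germ_norm s \<eta> U < \<infinity> \<longrightarrow>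
           germ_norm s \<eta> U \<le> ereal C * (distr_germ_seminorm s (\<eta> - real m) UNIV (opL_germ s m a U)
                                         + germ_seminorm s \<eta> \<alpha> U)"
proof -
  interpret sc: scaling s by unfold_locales (use assms(1) in auto)
  interpret eg: elliptic_germ s m a \<eta>
    by unfold_locales (use assms sc.elliptic_symbol_nonzero in auto)
  obtain C0 where C0: "C0 \<ge> 0" "\<forall>U N A B. (\<forall>x. continuous_on UNIV (U x)) \<longrightarrow> N \<ge> 0 \<longrightarrow> A \<ge> 0 \<longrightarrow> B \<ge> 0 \<longrightarrow>
    (\<forall>x y. norm (U x y) \<le> N * aniso_dist s x y powr \<eta>) \<longrightarrow>
    (\<forall>\<phi> x lam. \<phi> \<in> testB s (\<eta> - real m) \<longrightarrow> lam > 0 \<longrightarrow>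
       lam powr (- (\<eta> - real m)) * norm (opL_germ s m a U x (rescale s \<phi> x lam)) \<le> A) \<longrightarrow>
    (\<forall>x y. \<exists>P\<in>aniso_polys s (nat \<lfloor>\<eta>\<rfloor>). \<forall>z. norm (U x z - U y z - P z) \<le>
           B * aniso_dist s y z powr \<alpha> * (aniso_dist s x y + aniso_dist s y z) powr (\<eta> - \<alpha>)) \<longrightarrow>
    (\<forall>x y. norm (U x y) \<le> (C0 * (A + B) + N / 2) * aniso_dist s x y powr \<eta>)"
    using eg.germ_estimate[OF assms(3,4)] by auto
  \<comment> \<open>The factor 2 comes from absorbing half of the norm; the summand 1 makes C
    positive, since 0 times infinity is 0 in the extended reals and the case of an infinite seminorm
    would fail.\<close>
  define C where "C = 2 * C0 + 1"
  have C: "C > 0" using C0 by (simp add: C_def)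
  show ?thesis
  proof (intro exI[of _ C] allI impI)
    fix U :: "real^'n \<Rightarrow> real^'n \<Rightarrow> complex"
    assume cont: "\<forall>x. continuous_on UNIV (U x)" and fin: "germ_norm s \<eta> U < \<infinity>"
    define SA where "SA = distr_germ_seminorm s (\<eta> - real m) UNIV (opL_germ s m a U)"
    define SB where "SB = germ_seminorm s \<eta> \<alpha> U"
    \<comment> \<open>The zero test function makes the supremum range over a nonempty set and hence
      nonnegative.\<close>
    have zero: "(\<lambda>_. 0) \<in> testB s (\<eta> - real m)"
    proof -
      have "pdiff \<beta> (\<lambda>_::real^'n. 0) = (\<lambda>_. 0)" for \<beta>
        using pderivs_cmult[OF smooth_const[of 0], of "mlist \<beta>" 0] by (simp add: pdiff_mlist)
      then show ?thesis by (simp add: testB_def smooth_const)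
    qed
    have mem: "ereal (lam powr (- (\<eta> - real m)) * norm (opL_germ s m a U x (rescale s \<phi> x lam))) \<le> SA"
      if "\<phi> \<in> testB s (\<eta> - real m)" "lam > 0" for \<phi> x lam
      unfolding SA_def distr_germ_seminorm_def by (rule Sup_upper) (use that in blast)
    have SA0: "0 \<le> SA"
      by (rule order_trans[OF _ mem[OF zero zero_less_one, of 0]]) simp
    have SB0: "0 \<le> SB" unfolding SB_def germ_seminorm_def by (rule Inf_greatest) (auto simp: less_imp_le)
    show "germ_norm s \<eta> U \<le> ereal C * (SA + SB)"
    proof (cases "SA = \<infinity> \<or> SB = \<infinity>")
      case True
      then have "SA + SB = \<infinity>" using SA0 SB0 by auto
      then have top: "ereal C * (SA + SB) = \<infinity>" using C by simp
      show ?thesis unfolding top by simp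
    next
      case False
      then obtain A where A: "SA = ereal A" "A \<ge> 0" using SA0 by (cases SA) auto
      obtain B where B: "SB = ereal B" "B \<ge> 0" using False SB0 by (cases SB) auto
      define G where "G = germ_norm s \<eta> U"
      have G0: "0 \<le> G" unfolding G_def germ_norm_def by (rule Inf_greatest) (auto simp: less_imp_le)
      \<comment> \<open>Finiteness of the germ norm enters here: half of a real number can be
        subtracted from both sides.\<close>
      obtain g where g: "G = ereal g" using fin G0 by (cases G) (auto simp: G_def)
      \<comment> \<open>The infima need not be attained, so N and B' are taken within e of
        them.\<close>
      have approx: "g \<le> C0 * (A + (B + e)) + (g + e) / 2 + e" if e: "e > 0" for e
      proof -
        obtain N where N: "N > 0" "\<forall>x y. norm (U x y) \<le> N * aniso_dist s x y powr \<eta>" "ereal N \<le> G + ereal e"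
          using ereal_Inf_approx[OF fin[unfolded germ_norm_def] e] unfolding G_def germ_norm_def by blast
        have Bfin: "SB < \<infinity>" by (simp add: B)
        obtain B' where B': "B' > 0" "\<forall>x y. \<exists>P\<in>aniso_polys s (nat \<lfloor>\<eta>\<rfloor>). \<forall>z. norm (U x z - U y z - P z) \<le>
           B' * aniso_dist s y z powr \<alpha> * (aniso_dist s x y + aniso_dist s y z) powr (\<eta> - \<alpha>)" "ereal B' \<le> SB + ereal e"
          using ereal_Inf_approx[OF Bfin[unfolded SB_def germ_seminorm_def] e] unfolding SB_def germ_seminorm_def by blast
        have le: "N \<le> g + e" "B' \<le> B + e" using N(3) B'(3) by (auto simp: g B)
        have Aall: "\<forall>\<phi> x lam. \<phi> \<in> testB s (\<eta> - real m) \<longrightarrow> lam > 0 \<longrightarrow>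
            lam powr (- (\<eta> - real m)) * norm (opL_germ s m a U x (rescale s \<phi> x lam)) \<le> A"
          using mem unfolding A by simp
        have est: "norm (U x y) \<le> (C0 * (A + B') + N / 2) * aniso_dist s x y powr \<eta>" for x y
          by (rule C0(2)[THEN spec[where x = U], THEN spec[where x = N], THEN spec[where x = A], THEN spec[where x = B'],
                THEN mp, OF cont, THEN mp, OF less_imp_le[OF N(1)], THEN mp, OF A(2), THEN mp, OF less_imp_le[OF B'(1)],
                THEN mp, OF N(2), THEN mp, OF Aall, THEN mp, OF B'(2), rule_format])
        \<comment> \<open>The set in \<open>germ_norm\<close> contains positive constants
          only.\<close>
        have "C0 * (A + B') + N / 2 > 0" using C0(1) A(2) B'(1) N(1) by (intro add_nonneg_pos mult_nonneg_nonneg) auto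
        then have "G \<le> ereal (C0 * (A + B') + N / 2)"
          unfolding G_def germ_norm_def using est by (intro Inf_lower) blast
        then have "g \<le> C0 * (A + B') + N / 2" by (simp add: g)
        also have "\<dots> \<le> C0 * (A + (B + e)) + (g + e) / 2"
          using le C0(1) by (intro add_mono mult_left_mono) auto
        finally show ?thesis using e by simp
      qed
      have small: "g / 2 - C0 * (A + B) \<le> (C0 + 2) * e" if "e > 0" for e
      proof -
        \<comment> \<open>With the products abstracted to p and q the inequality is linear.\<close>
        have aux: "g / 2 - p \<le> q + 2 * e" if "g \<le> (p + q) + (g + e) / 2 + e" for p q
          using that \<open>e > 0\<close> by (simp add: field_simps)
        have "g / 2 - C0 * (A + B) \<le> C0 * e + 2 * e"
          by (rule aux) (use approx[OF that] in \<open>simp add: distrib_left\<close>)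
        then show ?thesis by (simp only: distrib_right)
      qed
      have "g / 2 - C0 * (A + B) \<le> 0"
      proof (rule field_le_epsilon)
        fix e :: real assume "e > 0"
        then show "g / 2 - C0 * (A + B) \<le> 0 + e" using small[of "e / (C0 + 2)"] C0(1) by simp
      qed
      moreover have "0 \<le> A + B" using A B by simp
      ultimately have "g \<le> C * (A + B)" by (simp add: C_def algebra_simps)
      then show ?thesis unfolding G_def[symmetric] g A B by simp
    qed
  qed
qed

end
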